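(* Let $N\ge1$ be an integer and let $\lambda$ be a partition of $n$ with $\lambda'_1+\lambda'_2\le N$. Let $\Omega$ be the column tableau of the Young diagram of $\lambda$. Then the image of the operator $F_\Omega(0)$ on $(\mathbb C^N)^{\otimes n}$ consists of all traceless tensors from the image of the operator $E_\Omega$. In particular, the image of $F_\Omega(0)$ in $(\mathbb C^N)^{\otimes n}$ is equivalent to $W_\lambda$ as a representation of the complex orthogonal group $O_N$.
   Context: $\lambda'$ denotes the partition conjugate to $\lambda$. The Young diagram of $\lambda$ is $\{(i,j)\in\mathbb Z^2: i\ge1,\ \lambda_i\ge j\ge1\}$, where $i$ is the row index (increasing downwards) and $j$ the column index (increasing to the right). The column tableau $\Omega$ is obtained by filling its boxes with $1,\dots,n$ consecutively by columns from left to right, downwards in every column. $c_k=j-i$ if the box $(i,j)$ contains $k$. On $(\mathbb C^N)^{\otimes n}$, $P_{kl}$ exchanges the $k$th and $l$th tensor factors, and $Q_{kl}$ acts as $u\otimes v\mapsto\langle u,v\rangle\sum_{i=1}^N e_i\otimes e_i$ in the $k$th and $l$th tensor factors and as the identity in the others, where $e_1,\dots,e_N$ is the standard basis of $\mathbb C^N$ and $\langle\ ,\ \rangle$ is the symmetric bilinear form with $\langle e_i,e_j\rangle=\delta_{ij}$. Let $t_1,\dots,t_n$ be complex variables constrained by $t_k=t_l$ whenever $k,l$ are in the same column of $\Omega$. The rational function $$\prod_{1\le k<l\le n}^{\longrightarrow}\Bigl(1-\frac{P_{kl}}{c_k-c_l+t_k-t_l}\Bigr)$$ (factors ordered from left to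 right lexicographically in $(k,l)$) of the constrained variables is regular at $t_1=\dots=t_n$, and $E_\Omega$ denotes its value there. Then $$F_\Omega(0)=\prod_{(k,l)}^{\longrightarrow}\Bigl(1-\frac{Q_{kl}}{c_k+c_l+N-1}\Bigr)\cdot E_\Omega,$$ the product being over all pairs $k<l$ such that $k$ and $l$ appear in different columns of $\Omega$, in lexicographic order; all denominators here are non-zero. A tensor in $(\mathbb C^N)^{\otimes n}$ is traceless if applying $\langle\ ,\ \rangle$ to its $k$th and $l$th tensor factors gives $0$ for all distinct $k,l$. $O_N\subset GL_N$ is the subgroup preserving $\langle\ ,\ \rangle$. $W_\lambda$ is the irreducible representation of $O_N$ labelled by $\lambda$ following Weyl: with $V_\lambda\subset(\mathbb C^N)^{\otimes n}$ any embedded copy of the irreducible polynomial $GL_N$-representation of highest weight $\lambda$, $W_\lambda$ is the intersection of $V_\lambda$ with the space of traceless tensors. *)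

theory Defs
  imports
    "Jordan_Normal_Form.Matrix"
    "HOL-Library.Function_Algebras"
    "HOL-Library.FuncSet"
    "HOL-Combinatorics.Transposition"
    Complex_Main
begin

text \<open>
  A tensor in the \<open>n\<close>-th tensor power of \<open>\<complex>\<^sup>N\<close> is given by its coordinates: \<open>T i\<close> is the
  coefficient of \<open>e (i 1) \<otimes> \<dots> \<otimes> e (i n)\<close>. Tensor factors are numbered from \<open>1\<close> to \<open>n\<close>,
  whereas the standard basis vectors of \<open>\<complex>\<^sup>N\<close> are numbered from \<open>0\<close> to \<open>N - 1\<close>, as the
  entries of vectors and matrices in \<open>Jordan_Normal_Form\<close>.
\<close>

type_synonym tensor = "(nat \<Rightarrow> nat) \<Rightarrow> complex"

definition midx :: "nat \<Rightarrow> nat \<Rightarrow> (nat \<Rightarrow> nat) set" where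
  "midx N n = {1..n} \<rightarrow>\<^sub>E {..<N}"

definition tensors :: "nat \<Rightarrow> nat \<Rightarrow> tensor set" where
  "tensors N n = {T. \<forall>i. i \<notin> midx N n \<longrightarrow> T i = 0}"

definition tscale :: "complex \<Rightarrow> tensor \<Rightarrow> tensor" where
  "tscale c T = (\<lambda>i. c * T i)"

global_interpretation tensor: vector_space tscale
  by unfold_locales (auto simp: tscale_def fun_eq_iff algebra_simps)


subsection \<open>Operators on tensors\<close>

definition P_op :: "nat \<Rightarrow> nat \<Rightarrow> tensor \<Rightarrow> tensor" where
  "P_op k l T = (\<lambda>i. T (i \<circ> Transposition.transpose k l))"

text \<open>
  Application of the bilinear form to the \<open>k\<close>-th and \<open>l\<close>-th factors. The result, a tensor in
  the remaining \<open>n - 2\<close> factors, is written as a function of \<open>i\<close> which does not depend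
  on \<open>i k\<close> and \<open>i l\<close>.
\<close>

definition contract :: "nat \<Rightarrow> nat \<Rightarrow> nat \<Rightarrow> tensor \<Rightarrow> tensor" where
  "contract N k l T = (\<lambda>i. \<Sum>a<N. T (i(k := a, l := a)))"

definition Q_op :: "nat \<Rightarrow> nat \<Rightarrow> nat \<Rightarrow> nat \<Rightarrow> tensor \<Rightarrow> tensor" where
  "Q_op N n k l T = (\<lambda>i. if i \<in> midx N n \<and> i k = i l then contract N k l T i else 0)"

definition traceless_tensors :: "nat \<Rightarrow> nat \<Rightarrow> tensor set" where
  "traceless_tensors N n = {T \<in> tensors N n.
     \<forall>k\<in>{1..n}. \<forall>l\<in>{1..n}. k \<noteq> l \<longrightarrow> (\<forall>i\<in>midx N n. contract N k l T i = 0)}"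

text \<open>The leftmost operator of the list is applied last.\<close>

definition ordered_prod :: "(tensor \<Rightarrow> tensor) list \<Rightarrow> tensor \<Rightarrow> tensor" where
  "ordered_prod As = foldr (\<circ>) As id"

definition lex_pairs :: "nat \<Rightarrow> (nat \<times> nat) list" where
  "lex_pairs n = [(k, l). k \<leftarrow> [1..<Suc n], l \<leftarrow> [Suc k..<Suc n]]"


subsection \<open>Partitions and the column tableau\<close>

definition partition_of :: "nat \<Rightarrow> nat list \<Rightarrow> bool" where
  "partition_of n lam \<longleftrightarrow> sorted_wrt (\<ge>) lam \<and> 0 \<notin> set lam \<and> sum_list lam = n"

definition part :: "nat list \<Rightarrow> nat \<Rightarrow> nat" where
  "part lam i = (if 1 \<le> i \<and> i \<le> length lam then lam ! (i - 1) else 0)"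

definition conj_part :: "nat list \<Rightarrow> nat \<Rightarrow> nat" where
  "conj_part lam j = card {i \<in> {1..length lam}. j \<le> part lam i}"

text \<open>
  The boxes \<open>(i, j)\<close> of the Young diagram in the order in which the column tableau numbers them.
\<close>

definition column_boxes :: "nat list \<Rightarrow> (nat \<times> nat) list" where
  "column_boxes lam = [(i, j). j \<leftarrow> [1..<Suc (part lam 1)], i \<leftarrow> [1..<Suc (conj_part lam j)]]"

definition box :: "nat list \<Rightarrow> nat \<Rightarrow> nat \<times> nat" where
  "box lam k = column_boxes lam ! (k - 1)"

definition column_no :: "nat list \<Rightarrow> nat \<Rightarrow> nat" where
  "column_no lam k = snd (box lam k)"

definition content :: "nat list \<Rightarrow> nat \<Rightarrow> int" where
  "content lam k = int (snd (box lam k)) - int (fst (box lam k))"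


subsection \<open>Regular values of rational functions\<close>

inductive_set poly_fun :: "nat \<Rightarrow> ((nat \<Rightarrow> complex) \<Rightarrow> complex) set" for n :: nat where
  const: "(\<lambda>_. c) \<in> poly_fun n"
| var: "k \<in> {1..n} \<Longrightarrow> (\<lambda>t. t k) \<in> poly_fun n"
| add: "p \<in> poly_fun n \<Longrightarrow> q \<in> poly_fun n \<Longrightarrow> (\<lambda>t. p t + q t) \<in> poly_fun n"
| mult: "p \<in> poly_fun n \<Longrightarrow> q \<in> poly_fun n \<Longrightarrow> (\<lambda>t. p t * q t) \<in> poly_fun n"

text \<open>
  Here \<open>f\<close> is a rational function which is given by its values on the set \<open>D\<close> where a certain
  expression for it has no vanishing denominators. It is regular at \<open>z\<close> with the value \<open>v\<close>
  there if it has a representation as a fraction whose denominator does not vanish at \<open>z\<close>.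
\<close>

definition regular_value ::
    "nat \<Rightarrow> (nat \<Rightarrow> complex) set \<Rightarrow> ((nat \<Rightarrow> complex) \<Rightarrow> complex) \<Rightarrow> (nat \<Rightarrow> complex) \<Rightarrow> complex \<Rightarrow> bool"
  where
  "regular_value n D f z v \<longleftrightarrow>
     (\<exists>p\<in>poly_fun n. \<exists>q\<in>poly_fun n. q z \<noteq> 0 \<and> (\<forall>t\<in>D. q t * f t = p t) \<and> v = p z / q z)"


subsection \<open>The operators \<open>E\<^sub>\<Omega>\<close> and \<open>F\<^sub>\<Omega>(0)\<close>\<close>

definition E_den :: "nat list \<Rightarrow> (nat \<Rightarrow> complex) \<Rightarrow> nat \<Rightarrow> nat \<Rightarrow> complex" where
  "E_den lam t k l = of_int (content lam k - content lam l) + t k - t l"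

definition E_domain :: "nat \<Rightarrow> nat list \<Rightarrow> (nat \<Rightarrow> complex) set" where
  "E_domain n lam = {t.
     (\<forall>k\<in>{1..n}. \<forall>l\<in>{1..n}. column_no lam k = column_no lam l \<longrightarrow> t k = t l) \<and>
     (\<forall>k\<in>{1..n}. \<forall>l\<in>{1..n}. k < l \<longrightarrow> E_den lam t k l \<noteq> 0)}"

definition E_fun :: "nat \<Rightarrow> nat list \<Rightarrow> (nat \<Rightarrow> complex) \<Rightarrow> tensor \<Rightarrow> tensor" where
  "E_fun n lam t =
     ordered_prod [\<lambda>T. T - tscale (1 / E_den lam t k l) (P_op k l T). (k, l) \<leftarrow> lex_pairs n]"

text \<open>
  The value is taken coordinatewise, at the points with \<open>t\<^sub>1 = \<dots> = t\<^sub>n\<close>. It is the same at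
  all such points since \<open>E_fun\<close> depends only on the differences of the variables.
\<close>

definition E_Omega :: "nat \<Rightarrow> nat list \<Rightarrow> tensor \<Rightarrow> tensor" where
  "E_Omega n lam T =
     (\<lambda>i. THE v. \<forall>z. regular_value n (E_domain n lam) (\<lambda>t. E_fun n lam t T i) (\<lambda>_. z) v)"

definition F_den :: "nat \<Rightarrow> nat list \<Rightarrow> nat \<Rightarrow> nat \<Rightarrow> complex" where
  "F_den N lam k l = of_int (content lam k + content lam l + int N - 1)"

definition F_Omega_0 :: "nat \<Rightarrow> nat \<Rightarrow> nat list \<Rightarrow> tensor \<Rightarrow> tensor" where
  "F_Omega_0 N n lam =
     ordered_prod [\<lambda>T. T - tscale (1 / F_den N lam k l) (Q_op N n k l T).
       (k, l) \<leftarrow> lex_pairs n, column_no lam k \<noteq> column_no lam l] \<circ> E_Omega n lam"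


subsection \<open>Representations of \<open>GL\<^sub>N\<close> and \<open>O\<^sub>N\<close> on subspaces of tensors\<close>

definition GL_group :: "nat \<Rightarrow> complex mat set" where
  "GL_group N = {g \<in> carrier_mat N N. invertible_mat g}"

text \<open>
  The dot product \<open>\<bullet>\<close> on \<open>complex vec\<close> is the bilinear one, without complex conjugation.
\<close>

definition O_group :: "nat \<Rightarrow> complex mat set" where
  "O_group N = {g \<in> GL_group N. \<forall>u\<in>carrier_vec N. \<forall>v\<in>carrier_vec N.
     (g *\<^sub>v u) \<bullet> (g *\<^sub>v v) = u \<bullet> v}"

text \<open>The diagonal action \<open>g \<otimes> \<dots> \<otimes> g\<close>.\<close>

definition act :: "nat \<Rightarrow> nat \<Rightarrow> complex mat \<Rightarrow> tensor \<Rightarrow> tensor" where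
  "act N n g T = (\<lambda>i. if i \<in> midx N n
     then \<Sum>j\<in>midx N n. (\<Prod>k\<in>{1..n}. g $$ (i k, j k)) * T j else 0)"

definition subrep :: "nat \<Rightarrow> nat \<Rightarrow> complex mat set \<Rightarrow> tensor set \<Rightarrow> bool" where
  "subrep N n G V \<longleftrightarrow> V \<subseteq> tensors N n \<and> tensor.subspace V \<and> (\<forall>g\<in>G. \<forall>T\<in>V. act N n g T \<in> V)"

definition irreducible_subrep :: "nat \<Rightarrow> nat \<Rightarrow> complex mat set \<Rightarrow> tensor set \<Rightarrow> bool" where
  "irreducible_subrep N n G V \<longleftrightarrow>
     subrep N n G V \<and> V \<noteq> {0} \<and> (\<forall>U. subrep N n G U \<and> U \<subseteq> V \<longrightarrow> U = {0} \<or> U = V)"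

definition highest_weight_vector :: "nat \<Rightarrow> nat \<Rightarrow> nat list \<Rightarrow> tensor \<Rightarrow> bool" where
  "highest_weight_vector N n lam T \<longleftrightarrow> T \<noteq> 0 \<and>
     (\<forall>g\<in>carrier_mat N N. upper_triangular g \<and> (\<forall>a<N. g $$ (a, a) = 1) \<longrightarrow> act N n g T = T) \<and>
     (\<forall>x. (\<forall>a<N. x a \<noteq> 0) \<longrightarrow>
        act N n (mat_diag N x) T = tscale (\<Prod>a<N. x a ^ part lam (Suc a)) T)"

text \<open>
  The copies of \<open>V\<^sub>\<lambda>\<close> in the space of tensors. Every subrepresentation of this space
  is polynomial.
\<close>

definition V_copy :: "nat \<Rightarrow> nat \<Rightarrow> nat list \<Rightarrow> tensor set \<Rightarrow> bool" where
  "V_copy N n lam V \<longleftrightarrow>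
     irreducible_subrep N n (GL_group N) V \<and> (\<exists>T\<in>V. highest_weight_vector N n lam T)"

text \<open>The realisations of \<open>W\<^sub>\<lambda>\<close> obtained from the various copies of \<open>V\<^sub>\<lambda>\<close>.\<close>

definition W_realisation :: "nat \<Rightarrow> nat \<Rightarrow> nat list \<Rightarrow> tensor set \<Rightarrow> bool" where
  "W_realisation N n lam W \<longleftrightarrow> (\<exists>V. V_copy N n lam V \<and> W = V \<inter> traceless_tensors N n)"

text \<open>
  The linear map is total, but it only matters on \<open>U\<close>: any linear map on a subspace
  extends to the whole space.
\<close>

definition equivalent_reps ::
    "nat \<Rightarrow> nat \<Rightarrow> complex mat set \<Rightarrow> tensor set \<Rightarrow> tensor set \<Rightarrow> bool" where
  "equivalent_reps N n G U W \<longleftrightarrow> subrep N n G U \<and> subrep N n G W \<and>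
     (\<exists>\<phi>. Vector_Spaces.linear tscale tscale \<phi> \<and> bij_betw \<phi> U W \<and>
       (\<forall>g\<in>G. \<forall>T\<in>U. \<phi> (act N n g T) = act N n g (\<phi> T)))"

end

theory Submission
  imports Defs
begin

text \<open>
  For tensors which are alternating in a column, the factors \<open>1 - P/(\<dots>)\<close> belonging to one position
  and that column telescope to a single sum of exchanges. This makes \<open>E\<^sub>\<Omega>\<close> regular and shows, by
  induction on the columns, that its values satisfy the Garnir relations; it does not vanish, as its
  pairing with a suitable word is a product of non-zero factors. A Casimir argument shows that up to
  a factor there is only one tensor with the Garnir relations which is annihilated by the raising
  operators, so by the Hermitian form these tensors form an irreducible representation of \<open>GL\<^sub>N\<close>,
  the image of \<open>E\<^sub>\<Omega>\<close>.

  The factors \<open>1 - Q/(\<dots>)\<close> telescope in the same way, hence preserve the Garnir relations. The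
  leftmost one is \<open>1 - Q/N\<close> for the tops of the first two columns, so the result is annihilated by
  this contraction, and then by every contraction because of the relations. Conversely, all the factors
  fix traceless tensors.

  For two copies of an irreducible representation, the matrix coefficients of the highest weight
  vectors are proportional, which yields an equivariant isometry up to scaling. It commutes with the
  sum of all \<open>Q\<^sub>k\<^sub>l\<close>, which comes from the action of elementary matrices and whose kernel consists of
  the traceless tensors. So it maps traceless tensors to traceless ones.
\<close>

subsection \<open>Linear operators on tensors\<close>

text \<open>At t_1 = ... = t_n the factor of two boxes on one diagonal has a pole. Telescoping over
  a column leaves only the denominator at the top of that column, and the content there exceeds all
  contents in earlier columns, so no pole survives. For the factors with Q the denominators c_k +
  c_l + N - 1 decrease down a column, and the one at the bottom survives. Writing y_k = c_k + (N -
  1)/2 turns them into sums y_k + y_l, parallel to the differences in E. For the tops of the first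
  two columns this sum is N, which is the value that makes Q annihilate 1 - Q/N; the bound on the
  first two columns makes every sum positive. The order of the factors is the obstacle for F:
  alternation in a column and the exchange relations become visible in different arrangements of the
  same product, so each is proved after its own rearrangement. Only neighbouring columns have to be
  compared, as the relations propagate to later ones. Letters start from 0, so raising operators
  lower the sum of the letters of a word. Alternation in the columns bounds this sum from below, and
  highest weight vectors are found in the least degree.\<close>

lemma sum_fun_apply: "(sum f A :: 'a \<Rightarrow> 'b :: comm_monoid_add) x = (\<Sum>a\<in>A. f a x)"
  by (induction A rule: infinite_finite_induct) (auto simp: plus_fun_apply)

lemma tscale_apply: "tscale c T x = c * T x"
  by (simp add: tscale_def)

declare plus_fun_apply [simp del] minus_apply [simp del] uminus_apply [simp del] zero_fun_apply [simp del]

lemmas pointwise = fun_eq_iff plus_fun_apply minus_apply uminus_apply zero_fun_apply tscale_apply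
  sum_fun_apply

definition lin :: "(tensor \<Rightarrow> tensor) \<Rightarrow> bool" where
  "lin F \<longleftrightarrow> (\<forall>S T. F (S + T) = F S + F T) \<and> (\<forall>c T. F (tscale c T) = tscale c (F T))"

lemma lin_add: "lin F \<Longrightarrow> F (S + T) = F S + F T"
  and lin_scale: "lin F \<Longrightarrow> F (tscale c T) = tscale c (F T)"
  by (auto simp: lin_def)

lemma lin_zero: "lin F \<Longrightarrow> F 0 = 0"
  using lin_scale[of F 0 0] by (simp add: pointwise)

lemma lin_minus: "lin F \<Longrightarrow> F (- T) = - F T"
proof -
  assume "lin F"
  moreover have "- T = tscale (-1) T" "- F T = tscale (-1) (F T)" by (auto simp: pointwise)
  ultimately show ?thesis by (metis lin_scale)
qed

lemma lin_diff: "lin F \<Longrightarrow> F (S - T) = F S - F T"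
  using lin_add[of F S "- T"] lin_minus[of F T] by simp

lemma lin_sum: "lin F \<Longrightarrow> F (sum f A) = (\<Sum>a\<in>A. F (f a))"
  by (induction A rule: infinite_finite_induct) (auto simp: lin_zero lin_add)

lemma linI:
  assumes "\<And>S T x. F (S + T) x = F S x + F T x" "\<And>c T x. F (tscale c T) x = c * F T x"
  shows "lin F"
  using assms by (auto simp: lin_def pointwise)

lemma lin_id: "lin (\<lambda>T. T)"
  by (rule linI) (auto simp: pointwise)

lemma lin_subtract: "lin F \<Longrightarrow> lin G \<Longrightarrow> lin (\<lambda>T. F T - G T)"
  by (rule linI) (simp_all add: pointwise lin_add lin_scale algebra_simps)

lemma lin_scaled: "lin F \<Longrightarrow> lin (\<lambda>T. tscale c (F T))"
  by (rule linI) (simp_all add: pointwise lin_add lin_scale algebra_simps)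

lemma lin_sums: "(\<And>a. a \<in> A \<Longrightarrow> lin (F a)) \<Longrightarrow> lin (\<lambda>T. \<Sum>a\<in>A. F a T)"
  by (simp add: lin_def sum.distrib tensor.scale_sum_right)

lemma lin_foldr: "(\<And>a. a \<in> set as \<Longrightarrow> lin (f a)) \<Longrightarrow> lin (\<lambda>T. foldr f as T)"
proof (induction as)
  case Nil show ?case by (simp add: lin_id)
next
  case (Cons a as)
  have "lin (f a)" by (rule Cons.prems) simp
  moreover have "lin (foldr f as)" by (rule Cons.IH, rule Cons.prems) simp
  ultimately show ?case by (simp add: lin_def)
qed

subsection \<open>Permuting the tensor factors\<close>

lemma lin_P: "lin (P_op k l)"
  by (rule linI) (simp_all add: pointwise P_op_def)

lemma P_P [simp]: "P_op k l (P_op k l T) = T"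
  by (simp add: P_op_def comp_assoc)

lemma P_sym: "P_op k l = P_op l k"
  by (simp add: P_op_def transpose_commute pointwise)

lemma P_conj: "P_op i j (P_op k l T)
    = P_op (Transposition.transpose i j k) (Transposition.transpose i j l) (P_op i j T)"
proof -
  have "Transposition.transpose i j \<circ> Transposition.transpose k l
      = Transposition.transpose (Transposition.transpose i j k) (Transposition.transpose i j l)
          \<circ> Transposition.transpose i j"
    by (auto simp: fun_eq_iff Transposition.transpose_def)
  thus ?thesis by (simp add: P_op_def comp_assoc)
qed

lemma P_comm: "{i, j} \<inter> {k, l} = {} \<Longrightarrow> P_op i j (P_op k l T) = P_op k l (P_op i j T)"
  by (subst P_conj) (auto simp: Transposition.transpose_def)

text \<open>Two transpositions sharing k form a 3-cycle, which has other factorisations into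
  transpositions. They bring an exchange to the right, where antisymmetry or a relation of T absorbs
  it.\<close>

lemma P_cycle: "l \<noteq> k \<Longrightarrow> l \<noteq> m \<Longrightarrow> k \<noteq> m \<Longrightarrow> P_op k l (P_op k m T) = P_op k m (P_op l m T)"
  by (subst (2) P_conj) (auto simp: Transposition.transpose_def P_sym)

lemma P_cycle': "l \<noteq> k \<Longrightarrow> l \<noteq> m \<Longrightarrow> k \<noteq> m \<Longrightarrow> P_op k l (P_op k m T) = P_op l m (P_op k l T)"
  by (subst P_conj) (auto simp: Transposition.transpose_def P_sym)

text \<open>A partial Jucys-Murphy element; B is mostly a column or a union of columns.\<close>

definition PS :: "nat \<Rightarrow> nat set \<Rightarrow> tensor \<Rightarrow> tensor" where
  "PS k B T = (\<Sum>l\<in>B. P_op k l T)"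

lemma lin_PS: "lin (PS k B)"
  unfolding PS_def by (intro lin_sums lin_P)

lemma PS_empty [simp]: "PS k {} T = 0"
  by (simp add: PS_def)

lemma PS_union: "finite A \<Longrightarrow> finite B \<Longrightarrow> A \<inter> B = {} \<Longrightarrow> PS k (A \<union> B) T = PS k A T + PS k B T"
  by (simp add: PS_def sum.union_disjoint)

lemma PS_insert: "finite B \<Longrightarrow> b \<notin> B \<Longrightarrow> PS k (insert b B) T = P_op k b T + PS k B T"
  by (simp add: PS_def)

lemma P_PS: "P_op i j (PS k B T)
    = PS (Transposition.transpose i j k) (Transposition.transpose i j ` B) (P_op i j T)"
proof -
  have "inj_on (Transposition.transpose i j) B"
    by (meson inj_on_subset inj_transpose subset_UNIV)
  thus ?thesis by (simp add: PS_def lin_sum[OF lin_P] sum.reindex P_conj[of i j])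
qed

lemma transpose_image_same:
  "(i \<in> B \<longleftrightarrow> j \<in> B) \<Longrightarrow> Transposition.transpose i j ` B = B"
  by (auto simp: Transposition.transpose_def image_iff)

lemma P_PS_comm: "k \<noteq> i \<Longrightarrow> k \<noteq> j \<Longrightarrow> (i \<in> B \<longleftrightarrow> j \<in> B) \<Longrightarrow> P_op i j (PS k B T) = PS k B (P_op i j T)"
  by (metis P_PS transpose_image_same transpose_apply_other)

text \<open>Operators of this kind preserve alternation and exchange relations within B. The
  predicate covers exchanges and contractions at other positions as well as the action of
  matrices.\<close>

definition commutes_on :: "nat set \<Rightarrow> (tensor \<Rightarrow> tensor) \<Rightarrow> bool" where
  "commutes_on B F \<longleftrightarrow> lin F \<and> (\<forall>i\<in>B. \<forall>j\<in>B. \<forall>T. F (P_op i j T) = P_op i j (F T))"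

lemma commutes_onD: "commutes_on B F \<Longrightarrow> i \<in> B \<Longrightarrow> j \<in> B \<Longrightarrow> F (P_op i j T) = P_op i j (F T)"
  and commutes_on_lin: "commutes_on B F \<Longrightarrow> lin F"
  by (auto simp: commutes_on_def)

lemma commutes_on_mono: "commutes_on B F \<Longrightarrow> A \<subseteq> B \<Longrightarrow> commutes_on A F"
  by (auto simp: commutes_on_def)

lemma commutes_on_id: "commutes_on B (\<lambda>T. T)"
  by (simp add: commutes_on_def lin_id)

lemma commutes_on_subtract: "commutes_on B F \<Longrightarrow> commutes_on B G \<Longrightarrow> commutes_on B (\<lambda>T. F T - G T)"
  by (auto simp: commutes_on_def lin_subtract lin_diff[OF lin_P])

lemma commutes_on_scaled: "commutes_on B F \<Longrightarrow> commutes_on B (\<lambda>T. tscale c (F T))"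
  by (auto simp: commutes_on_def lin_scaled lin_scale[OF lin_P])

lemma commutes_on_foldr:
  "(\<And>a. a \<in> set as \<Longrightarrow> commutes_on B (f a)) \<Longrightarrow> commutes_on B (\<lambda>T. foldr f as T)"
proof (induction as)
  case Nil show ?case by (simp add: commutes_on_id)
next
  case (Cons a as)
  have "commutes_on B (f a)" by (rule Cons.prems) simp
  moreover have "commutes_on B (foldr f as)" by (rule Cons.IH, rule Cons.prems) simp
  ultimately show ?case by (simp add: commutes_on_def lin_def)
qed

lemma commutes_on_PS: "k \<notin> B \<Longrightarrow> B \<subseteq> L \<or> B \<inter> L = {} \<Longrightarrow> commutes_on B (PS k L)"
  unfolding commutes_on_def by (auto simp: lin_PS intro!: P_PS_comm[symmetric])

lemma commutes_on_PS_apply: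
  assumes "commutes_on C F" "k \<in> C" "B \<subseteq> C" shows "F (PS k B T) = PS k B (F T)"
  unfolding PS_def lin_sum[OF commutes_on_lin[OF assms(1)]]
  using assms by (intro sum.cong) (auto simp: commutes_onD)

section \<open>Alternating tensors and telescoping over a column\<close>

definition alternating :: "nat set \<Rightarrow> tensor \<Rightarrow> bool" where
  "alternating B T \<longleftrightarrow> (\<forall>i\<in>B. \<forall>j\<in>B. i \<noteq> j \<longrightarrow> P_op i j T = - T)"

lemma alternatingD: "alternating B T \<Longrightarrow> i \<in> B \<Longrightarrow> j \<in> B \<Longrightarrow> i \<noteq> j \<Longrightarrow> P_op i j T = - T"
  by (auto simp: alternating_def)

lemma alternating_mono: "alternating B T \<Longrightarrow> A \<subseteq> B \<Longrightarrow> alternating A T"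
  by (auto simp: alternating_def)

lemma commutes_on_alternating: "commutes_on B F \<Longrightarrow> alternating B T \<Longrightarrow> alternating B (F T)"
  unfolding alternating_def by (metis commutes_onD commutes_on_lin lin_minus)

text \<open>By \<open>P_cycle\<close>, (k l)(k m) = (k m)(l m), and (l m) acts on T by the sign
  because l and m both lie in C.\<close>

lemma P_PS_alternating:
  assumes "alternating B T" "finite B" "k \<notin> B" "l \<notin> B" "k \<noteq> l" "insert l B \<subseteq> C" "alternating C T"
  shows "P_op k l (PS k B T) = - PS k B T"
proof -
  have "P_op k l (P_op k m T) = - P_op k m T" if "m \<in> B" for m
  proof -
    have "P_op k l (P_op k m T) = P_op k m (P_op l m T)" using assms that by (intro P_cycle) auto
    moreover have "P_op l m T = - T" using assms that by (intro alternatingD[of C]) auto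
    ultimately show ?thesis by (simp add: lin_minus[OF lin_P])
  qed
  thus ?thesis by (simp add: PS_def lin_sum[OF lin_P] sum_negf)
qed

text \<open>The factors telescope because the contents decrease by one down a column.\<close>

lemma column_telescope_P:
  assumes "alternating (set bs) T" "distinct bs" "k \<notin> set bs"
    and "\<And>i. i < length bs \<Longrightarrow> d (bs ! i) = u + of_nat i"
    and "\<And>l. l \<in> set bs \<Longrightarrow> d l \<noteq> 0" "bs \<noteq> []"
  shows "foldr (\<lambda>l T. T - tscale (1 / d l) (P_op k l T)) bs T
    = T - tscale (1 / u) (PS k (set bs) T)"
  using assms
proof (induction bs arbitrary: u)
  case (Cons l bs)
  have du: "d l = u" using Cons.prems(4)[of 0] by simp
  hence u0: "u \<noteq> 0" using Cons.prems(5) by auto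
  show ?case
  proof (cases "bs = []")
    case True thus ?thesis by (simp add: du PS_def)
  next
    case False
    have IH: "foldr (\<lambda>l T. T - tscale (1 / d l) (P_op k l T)) bs T
        = T - tscale (1 / (u + 1)) (PS k (set bs) T)"
    proof (rule Cons.IH)
      show "d (bs ! i) = u + 1 + of_nat i" if "i < length bs" for i
        using Cons.prems(4)[of "Suc i"] that by (simp add: algebra_simps)
    qed (use Cons.prems False in \<open>auto intro: alternating_mono\<close>)
    have u1: "u + 1 \<noteq> 0"
      using Cons.prems(4)[of 1] Cons.prems(5)[of "bs ! 0"] False by auto
    have *: "P_op k l (PS k (set bs) T) = - PS k (set bs) T"
      using Cons.prems by (intro P_PS_alternating[of _ _ _ _ "set (l # bs)"]) (auto intro: alternating_mono)
    \<comment> \<open>The telescoping identity 1/(u + 1) + 1/(u (u + 1)) = 1/u; its second term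
      arises because \<open>P_op k l\<close> acts by -1 on the sum over the rest of the
      column.\<close>
    have "PS k (set bs) T x / (u + 1) + PS k (set bs) T x / (u + 1) / u = PS k (set bs) T x / u" for x
      using u0 u1 by (simp add: divide_simps) (simp add: algebra_simps)
    note eq = this[symmetric]
    show ?thesis using Cons.prems(2)
      by (simp add: IH du lin_diff[OF lin_P] lin_scale[OF lin_P] * PS_insert)
        (simp add: pointwise add_divide_distrib diff_divide_distrib eq)
  qed
qed auto

subsection \<open>Antisymmetrizers\<close>

text \<open>The sum of all signed permutations of the listed positions. The recursion is chosen so
  that the exchange relation of r with c for \<open>Ant c W\<close> is literally the equation
  \<open>Ant (r # c) W = 0\<close>.\<close>

primrec Ant :: "nat list \<Rightarrow> tensor \<Rightarrow> tensor" where
  "Ant [] = (\<lambda>T. T)"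
| "Ant (x # xs) = (\<lambda>T. Ant xs T - PS x (set xs) (Ant xs T))"

lemma lin_Ant: "lin (Ant xs)"
proof (induction xs)
  case Nil show ?case using lin_id by (simp add: lin_def)
next
  case (Cons x xs)
  show ?case by (rule linI)
      (simp_all add: lin_add[OF Cons] lin_scale[OF Cons] lin_add[OF lin_PS] lin_scale[OF lin_PS],
        simp_all add: pointwise algebra_simps)
qed

lemma alternating_Ant: "distinct xs \<Longrightarrow> alternating (set xs) (Ant xs T)"
proof (induction xs)
  case Nil show ?case by (simp add: alternating_def)
next
  case (Cons x xs)
  let ?U = "Ant xs T"
  have alt: "alternating (set xs) ?U" using Cons by simp
  have tail: "P_op i j (Ant (x # xs) T) = - Ant (x # xs) T" if "i \<in> set xs" "j \<in> set xs" "i \<noteq> j" for i j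
  proof -
    have "x \<noteq> i" "x \<noteq> j" using that Cons.prems by auto
    thus ?thesis using that alternatingD[OF alt that]
      by (simp add: lin_diff[OF lin_P] P_PS_comm lin_minus[OF lin_PS])
  qed
  have head: "P_op x y (Ant (x # xs) T) = - Ant (x # xs) T" if "y \<in> set xs" for y
  proof -
    have split: "PS x (set xs) ?U = P_op x y ?U + PS x (set xs - {y}) ?U"
      using that PS_insert[of "set xs - {y}" y x ?U] by (simp add: insert_absorb)
    have "P_op x y (PS x (set xs - {y}) ?U) = - PS x (set xs - {y}) ?U"
      using Cons.prems that
      by (intro P_PS_alternating[of _ _ _ _ "set xs"]) (auto intro: alternating_mono[OF alt] simp: alt)
    thus ?thesis by (simp add: split lin_diff[OF lin_P] lin_add[OF lin_P])
  qed
  show ?case unfolding alternating_def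
  proof (intro ballI impI)
    fix i j assume *: "i \<in> set (x # xs)" "j \<in> set (x # xs)" "i \<noteq> j"
    thus "P_op i j (Ant (x # xs) T) = - Ant (x # xs) T"
      using tail[of i j] head[of i] head[of j] by (auto simp del: Ant.simps simp: P_sym)
  qed
qed

lemma P_Ant: "P_op i j (Ant xs T) = Ant (map (Transposition.transpose i j) xs) (P_op i j T)"
  by (induction xs) (auto simp: lin_diff[OF lin_P] P_PS)

lemma commutes_on_Ant: "B \<inter> set xs = {} \<Longrightarrow> commutes_on B (Ant xs)"
  unfolding commutes_on_def
proof (intro conjI ballI allI)
  fix i j T assume *: "B \<inter> set xs = {}" "i \<in> B" "j \<in> B"
  have "map (Transposition.transpose i j) xs = xs"
    using * by (intro map_idI) (auto simp: Transposition.transpose_def)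
  thus "Ant xs (P_op i j T) = P_op i j (Ant xs T)" by (simp add: P_Ant)
qed (rule lin_Ant)

lemma Ant_commute:
  assumes "lin F" "\<And>i j T. i \<in> set xs \<Longrightarrow> j \<in> set xs \<Longrightarrow> i \<noteq> j \<Longrightarrow> F (P_op i j T) = P_op i j (F T)" "distinct xs"
  shows "F (Ant xs T) = Ant xs (F T)"
  using assms(2,3)
proof (induction xs)
  case (Cons x xs)
  have "F (Ant xs T) = Ant xs (F T)" using Cons by auto
  moreover have "F (PS x (set xs) U) = PS x (set xs) (F U)" for U
    unfolding PS_def lin_sum[OF assms(1)] using Cons.prems by (intro sum.cong) auto
  ultimately show ?case by (simp add: lin_diff[OF assms(1)])
qed simp

text \<open>The antisymmetry on the other side. The recursion is one-sided, so the exchanges of x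
  are first moved to the right of \<open>Ant xs\<close> (\<open>comm\<close>).\<close>

lemma Ant_P: "distinct xs \<Longrightarrow> i \<in> set xs \<Longrightarrow> j \<in> set xs \<Longrightarrow> i \<noteq> j \<Longrightarrow> Ant xs (P_op i j T) = - Ant xs T"
proof (induction xs arbitrary: i j T)
  case (Cons x xs)
  have tail: "Ant (x # xs) (P_op i j T) = - Ant (x # xs) T" if "i \<in> set xs" "j \<in> set xs" "i \<noteq> j" for i j T
    using Cons.IH[OF _ that] Cons.prems by (simp add: lin_minus[OF lin_PS])
  have comm: "PS x (set xs) (Ant xs U) = Ant xs (PS x (set xs) U)" for U
    using Cons.prems by (intro Ant_commute lin_PS P_PS_comm[symmetric]) auto
  have head: "Ant (x # xs) (P_op x y T) = - Ant (x # xs) T" if y: "y \<in> set xs" for y T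
  proof -
    have xy: "x \<noteq> y" using Cons.prems y by auto
    have split: "PS x (set xs) U = P_op x y U + PS x (set xs - {y}) U" for U
      using y PS_insert[of "set xs - {y}" y x U] by (simp add: insert_absorb)
    have "Ant xs (P_op x m (P_op x y T)) = - Ant xs (P_op x m T)" if m: "m \<in> set xs - {y}" for m
    proof -
      have "P_op x m (P_op x y T) = P_op m y (P_op x m T)" using m xy Cons.prems by (intro P_cycle') auto
      thus ?thesis using Cons.IH[of m y "P_op x m T"] m y Cons.prems by auto
    qed
    hence "Ant xs (PS x (set xs - {y}) (P_op x y T)) = - Ant xs (PS x (set xs - {y}) T)"
      by (simp add: PS_def lin_sum[OF lin_Ant] sum_negf)
    moreover have "Ant (x # xs) U = Ant xs U - Ant xs (P_op x y U) - Ant xs (PS x (set xs - {y}) U)" for U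
      unfolding Ant.simps comm split[of U] by (simp add: lin_add[OF lin_Ant])
    ultimately show ?thesis by (simp del: Ant.simps)
  qed
  show ?case using Cons.prems(2-4) tail[of i j] head[of i] head[of j]
    by (auto simp del: Ant.simps simp: P_sym)
qed simp

declare set_concat [simp del]

subsection \<open>Column relations\<close>

text \<open>
  These relations cut the Schur module out of the tensor product of the exterior powers given by
  the columns. In characteristic zero the exchanges of a single factor are sufficient.
\<close>

fun garnir :: "nat list list \<Rightarrow> tensor \<Rightarrow> bool" where
  "garnir [] T \<longleftrightarrow> True"
| "garnir (c # cs) T \<longleftrightarrow>
    alternating (set c) T \<and> (\<forall>r\<in>set (concat cs). PS r (set c) T = T) \<and> garnir cs T"

lemma commutes_on_garnir:
  "commutes_on (set (concat cs)) F \<Longrightarrow> garnir cs T \<Longrightarrow> garnir cs (F T)"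
proof (induction cs)
  case (Cons c cs)
  have "commutes_on (set c) F" "commutes_on (set (concat cs)) F"
    using Cons.prems(1) by (auto intro: commutes_on_mono)
  moreover have "PS r (set c) (F T) = F T" if "r \<in> set (concat cs)" for r
    using commutes_on_PS_apply[OF Cons.prems(1), of r "set c" T] Cons.prems(2) that by auto
  ultimately show ?case using Cons by (auto intro: commutes_on_alternating)
qed simp

lemma garnir_alternating: "garnir cs T \<Longrightarrow> c \<in> set cs \<Longrightarrow> alternating (set c) T"
  by (induction cs) auto

text \<open>There are no antisymmetric tensors in more factors than the length of the longest column.\<close>

lemma Ant_garnir_eq_0:
  assumes "garnir (c # cs) Z" "distinct M" "set M \<subseteq> set c \<union> set (concat cs)"
    and "length c < length M" "set c \<inter> set (concat cs) = {}"
  shows "Ant M Z = 0"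
  using assms(2-4)
\<comment> \<open>The induction is on the number of positions of c missing in M. The relation for
  some r in M outside c replaces Z by a sum of exchanges: those within M give
  \<open>- Ant M Z\<close> each, the others trade r for a new position of c and vanish by induction.
  So a positive multiple of \<open>Ant M Z\<close> is zero.\<close>
proof (induction "card (set c - set M)" arbitrary: M rule: less_induct)
  case less
  have "\<not> set M \<subseteq> set c"
    using less.prems(1,3) card_mono[of "set c" "set M"] card_length[of c] by (auto simp: distinct_card)
  then obtain r where r: "r \<in> set M" "r \<notin> set c" by auto
  hence Z: "PS r (set c) Z = Z" using assms(1) less.prems(2) by auto
  have in_M: "Ant M (P_op r l Z) = - Ant M Z" if "l \<in> set c \<inter> set M" for l
    using r that less.prems(1) by (intro Ant_P) auto
  have out_M: "Ant M (P_op r l Z) = 0" if l: "l \<in> set c - set M" for l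
  proof -
    let ?M = "map (Transposition.transpose r l) M"
    have set_M: "set ?M = insert l (set M - {r})"
      using r l by (auto simp: Transposition.transpose_def image_iff)
    have "Ant ?M Z = 0"
    proof (rule less.hyps)
      show "card (set c - set ?M) < card (set c - set M)"
        by (rule psubset_card_mono) (use r l set_M in auto)
    qed (use less.prems r l set_M in \<open>auto simp: distinct_map intro: inj_on_subset[OF inj_transpose]\<close>)
    moreover have "P_op r l (Ant M (P_op r l Z)) = Ant ?M Z" by (simp add: P_Ant)
    ultimately show ?thesis by (metis P_P lin_P lin_zero)
  qed
  have "Ant M Z = Ant M (PS r (set c) Z)" by (simp only: Z)
  also have "\<dots> = (\<Sum>l\<in>set c. Ant M (P_op r l Z))" by (simp add: PS_def lin_sum[OF lin_Ant])
  also have "\<dots> = (\<Sum>l\<in>(set c \<inter> set M) \<union> (set c - set M). Ant M (P_op r l Z))"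
    by (rule sum.cong) auto
  also have "\<dots> = (\<Sum>l\<in>set c \<inter> set M. - Ant M Z)"
    by (subst sum.union_disjoint) (auto simp: in_M out_M)
  finally have *: "Ant M Z = (\<Sum>l\<in>set c \<inter> set M. - Ant M Z)" .
  have "(1 + of_nat (card (set c \<inter> set M))) * Ant M Z x = 0" for x
  proof -
    have "Ant M Z x = - (of_nat (card (set c \<inter> set M)) * Ant M Z x)"
      using fun_cong[OF *, of x] by (simp add: pointwise)
    hence "Ant M Z x + of_nat (card (set c \<inter> set M)) * Ant M Z x = 0"
      by (simp only: eq_neg_iff_add_eq_0)
    thus ?thesis by (simp only: distrib_right mult_1_left)
  qed
  moreover have "(1 + of_nat (card (set c \<inter> set M)) :: complex) \<noteq> 0"
    using of_nat_neq_0[of "card (set c \<inter> set M)"] by simp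
  ultimately show ?case by (auto simp: pointwise)
qed

section \<open>The operator E in column form and its column relations\<close>

fun good_cols :: "(nat \<Rightarrow> complex) \<Rightarrow> complex \<Rightarrow> nat list list \<Rightarrow> bool" where
  "good_cols x u [] \<longleftrightarrow> True"
| "good_cols x u (c # cs) \<longleftrightarrow> c \<noteq> [] \<and> distinct c \<and> set c \<inter> set (concat cs) = {} \<and>
    (\<forall>i<length c. x (c ! i) = u - of_nat i) \<and> (\<forall>b\<in>set cs. length b \<le> length c) \<and>
    good_cols x (u + 1) cs"

text \<open>The telescoped product of the factors of k with all positions in the columns
  \<open>cs\<close> (\<open>row_op_telescope\<close>). Only the tops of the columns enter the
  denominators, so this form stays finite where single factors have poles.\<close>

definition row_op :: "(nat \<Rightarrow> complex) \<Rightarrow> nat \<Rightarrow> nat list list \<Rightarrow> tensor \<Rightarrow> tensor" where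
  "row_op x k cs T = foldr (\<lambda>b T. T - tscale (1 / (x k - x (hd b))) (PS k (set b) T)) cs T"

text \<open>The ordered product with its poles removed: the factors within the first column make up
  its antisymmetrizer, which can be moved to the left of the factors with later columns
  (\<open>foldr_pairs_Erec\<close>).\<close>

primrec Erec :: "(nat \<Rightarrow> complex) \<Rightarrow> nat list list \<Rightarrow> tensor \<Rightarrow> tensor" where
  "Erec x [] = (\<lambda>T. T)"
| "Erec x (c # cs) = (\<lambda>T. Ant c (foldr (\<lambda>k. row_op x k cs) c (Erec x cs T)))"

text \<open>Since (k l)(k r) = (k r)(l r), the exchanges of k with B become, to the right of (k r),
  the exchanges of r with B, which fix T.\<close>

lemma PS_PS_garnir:
  assumes "finite B" "k \<notin> B" "k \<notin> C" "B \<inter> C = {}" "\<And>r. r \<in> C \<Longrightarrow> PS r B T = T"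
  shows "PS k B (PS k C T) = PS k C T"
proof -
  have "PS k B (P_op k r T) = P_op k r T" if r: "r \<in> C" for r
  proof -
    have "PS k B (P_op k r T) = (\<Sum>l\<in>B. P_op k r (P_op r l T))" unfolding PS_def
    proof (rule sum.cong)
      fix l assume "l \<in> B"
      hence "P_op k l (P_op k r T) = P_op k r (P_op l r T)" using r assms by (intro P_cycle) auto
      thus "P_op k l (P_op k r T) = P_op k r (P_op r l T)" by (simp only: P_sym)
    qed simp
    also have "\<dots> = P_op k r (PS r B T)" by (simp add: PS_def lin_sum[OF lin_P])
    finally show ?thesis using assms(5)[OF r] by simp
  qed
  thus ?thesis by (simp add: PS_def[of k C] lin_sum[OF lin_PS])
qed

text \<open>A second telescoping, now over the columns. If A and C are the sums of exchanges of k
  with the first column and with the later ones, then A C T = C T by \<open>PS_PS_garnir\<close>.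
  The tops of neighbouring columns differ by one, and 1/(d - 1) - 1/(d (d - 1)) = 1/d.\<close>

lemma row_op_garnir:
  assumes "good_cols x v cs" "garnir cs T" "k \<notin> set (concat cs)" "\<And>m::nat. x k - v - of_nat m \<noteq> 0"
  shows "row_op x k cs T = T - tscale (1 / (x k - v)) (PS k (set (concat cs)) T)"
  using assms
proof (induction cs arbitrary: v)
  case Nil thus ?case by (simp add: row_op_def pointwise)
next
  case (Cons b cs)
  let ?C = "set (concat cs)"
  define d where "d = x k - v"
  have d: "d \<noteq> 0" "d - 1 \<noteq> 0"
    using Cons.prems(4)[of 0] Cons.prems(4)[of 1] by (auto simp: d_def)
  have IH: "row_op x k cs T = T - tscale (1 / (d - 1)) (PS k ?C T)"
  proof -
    have "row_op x k cs T = T - tscale (1 / (x k - (v + 1))) (PS k ?C T)"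
    proof (rule Cons.IH)
      show "x k - (v + 1) - of_nat m \<noteq> 0" for m :: nat
        using Cons.prems(4)[of "Suc m"] by (simp add: algebra_simps)
    qed (use Cons.prems in auto)
    thus ?thesis by (simp add: d_def algebra_simps)
  qed
  have hd: "x (hd b) = v" using Cons.prems(1) by (auto simp: hd_conv_nth)
  have PP: "PS k (set b) (PS k ?C T) = PS k ?C T"
    using Cons.prems by (intro PS_PS_garnir) auto
  have split: "PS k (set (concat (b # cs))) T = PS k (set b) T + PS k ?C T"
    using Cons.prems(1) PS_union[of "set b" ?C k T] by simp
  have "row_op x k (b # cs) T = row_op x k cs T - tscale (1 / d) (PS k (set b) (row_op x k cs T))"
    by (simp add: row_op_def hd d_def)
  also have "\<dots> = T - tscale (1 / (d - 1)) (PS k ?C T)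
      - tscale (1 / d) (PS k (set b) T - tscale (1 / (d - 1)) (PS k ?C T))"
    by (simp add: IH lin_diff[OF lin_PS] lin_scale[OF lin_PS] PP)
  also have "\<dots> = T - tscale (1 / d) (PS k (set b) T + PS k ?C T)"
    using d by (auto simp: pointwise divide_simps) (simp add: algebra_simps)
  finally show ?case unfolding split by (simp only: d_def)
qed

definition row_sum_op :: "(nat \<Rightarrow> complex) \<Rightarrow> nat set \<Rightarrow> nat \<Rightarrow> tensor \<Rightarrow> tensor" where
  "row_sum_op d B k T = T - tscale (1 / d k) (PS k B T)"

lemma commutes_on_row_sum_op:
  "k \<notin> A \<Longrightarrow> A \<subseteq> B \<or> A \<inter> B = {} \<Longrightarrow> commutes_on A (row_sum_op d B k)"
proof -
  assume "k \<notin> A" "A \<subseteq> B \<or> A \<inter> B = {}"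
  hence "commutes_on A (\<lambda>T. T - tscale (1 / d k) (PS k B T))"
    by (intro commutes_on_subtract commutes_on_id commutes_on_scaled commutes_on_PS)
  thus ?thesis by (simp add: row_sum_op_def commutes_on_def lin_def)
qed

text \<open>The simplified factors commute with all permutations of the later positions, so the
  relations persist and \<open>row_op_garnir\<close> applies again at the next position.\<close>

lemma row_ops_garnir:
  assumes "good_cols x v cs" "garnir cs T" "set ks \<inter> set (concat cs) = {}"
    and "\<And>k m. k \<in> set ks \<Longrightarrow> x k - v - of_nat m \<noteq> 0"
  shows "foldr (\<lambda>k. row_op x k cs) ks T = foldr (row_sum_op (\<lambda>k. x k - v) (set (concat cs))) ks T
    \<and> garnir cs (foldr (row_sum_op (\<lambda>k. x k - v) (set (concat cs))) ks T)"
  using assms(3,4)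
proof (induction ks)
  case (Cons k ks)
  let ?V = "foldr (row_sum_op (\<lambda>k. x k - v) (set (concat cs))) ks T"
  have IH: "foldr (\<lambda>k. row_op x k cs) ks T = ?V" "garnir cs ?V" using Cons by auto
  have "row_op x k cs ?V = ?V - tscale (1 / (x k - v)) (PS k (set (concat cs)) ?V)"
    by (rule row_op_garnir) (use assms Cons.prems IH in auto)
  hence "row_op x k cs ?V = row_sum_op (\<lambda>k. x k - v) (set (concat cs)) k ?V"
    by (simp only: row_sum_op_def)
  moreover have "garnir cs (row_sum_op (\<lambda>k. x k - v) (set (concat cs)) k ?V)"
    by (rule commutes_on_garnir[OF commutes_on_row_sum_op IH(2)]) (use Cons.prems in auto)
  ultimately show ?case using IH by simp
qed (use assms in simp)

text \<open>
  In a factor whose coefficient is the inverse of \<open>length L\<close>, the exchanges with the positions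
  in \<open>L\<close> cancel against the identity, and the other exchanges move the factor into \<open>L\<close>. Thus
  all the factors in \<open>ks\<close> are finally moved to the columns \<open>cs\<close>, which are too short.
\<close>

lemma Ant_rows_eq_0:
  assumes "garnir cs Z" "good_cols x v cs"
    and "distinct (L @ ks)" "set L \<subseteq> set (concat cs)" "set ks \<inter> set (concat cs) = {}" "L \<noteq> []"
    and "\<And>i. i < length ks \<Longrightarrow> d (ks ! i) = - of_nat (length L + i)"
    and "\<And>b. b \<in> set cs \<Longrightarrow> length b < length L + length ks"
  shows "Ant (L @ ks) (foldr (row_sum_op d (set (concat cs))) ks Z) = 0"
  using assms(3-)
proof (induction ks arbitrary: L)
  case Nil
  then obtain b bs where cs: "cs = b # bs" by (cases cs) auto
  have "Ant L Z = 0" by (rule Ant_garnir_eq_0[of b bs]) (use Nil assms(1,2) cs in auto)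
  thus ?case by simp
next
  case (Cons k ks)
  let ?B = "set (concat cs)"
  let ?W = "foldr (row_sum_op d ?B) ks Z" and ?M = "L @ k # ks"
  have d: "d k = - of_nat (length L)" using Cons.prems(5)[of 0] by simp
  have in_L: "Ant ?M (P_op k l ?W) = - Ant ?M ?W" if "l \<in> set L" for l
    using that Cons.prems by (intro Ant_P) auto
  have out_L: "Ant ?M (P_op k l ?W) = 0" if l: "l \<in> ?B - set L" for l
  proof -
    have "Ant ((L @ [l]) @ ks) ?W = 0"
    proof (rule Cons.IH)
      show "d (ks ! i) = - of_nat (length (L @ [l]) + i)" if "i < length ks" for i
        using Cons.prems(5)[of "Suc i"] that by simp
    qed (use Cons.prems l in auto)
    moreover have "map (Transposition.transpose k l) ?M = (L @ [l]) @ ks"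
      using Cons.prems l by (auto intro!: map_idI simp: Transposition.transpose_def)
    ultimately have "P_op k l (Ant ?M (P_op k l ?W)) = 0" unfolding P_Ant by simp
    thus ?thesis by (metis P_P lin_P lin_zero)
  qed
  have "Ant ?M (PS k ?B ?W) = (\<Sum>l\<in>set L \<union> (?B - set L). Ant ?M (P_op k l ?W))"
    using Cons.prems(2) by (simp only: PS_def lin_sum[OF lin_Ant] Un_Diff_cancel Un_absorb1)
  also have "\<dots> = (\<Sum>l\<in>set L. - Ant ?M ?W)"
    by (subst sum.union_disjoint) (auto simp: in_L out_L)
  also have "\<dots> = tscale (- of_nat (length L)) (Ant ?M ?W)"
    using Cons.prems(1) by (simp add: pointwise distinct_card)
  finally have "Ant ?M (PS k ?B ?W) = tscale (- of_nat (length L)) (Ant ?M ?W)" .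
  hence "Ant ?M (row_sum_op d ?B k ?W) = 0" using Cons.prems(4)
    by (simp only: row_sum_op_def[of d _ k] lin_diff[OF lin_Ant] lin_scale[OF lin_Ant] d)
      (simp add: pointwise)
  thus ?case by simp
qed

lemma garnir_Erec: "good_cols x u cs \<Longrightarrow> garnir cs (Erec x cs T)"
proof (induction cs arbitrary: u)
  case (Cons c cs)
  let ?B = "set (concat cs)" and ?Z = "Erec x cs T" and ?d = "\<lambda>k. x k - (u + 1)"
  let ?W = "foldr (row_sum_op ?d ?B) c ?Z"
  have Z: "garnir cs ?Z" using Cons by auto
  have x: "x (c ! i) = u - of_nat i" if "i < length c" for i using Cons.prems that by auto
  have W: "foldr (\<lambda>k. row_op x k cs) c ?Z = ?W" "garnir cs ?W"
  proof -
    have "x k - (u + 1) - of_nat m \<noteq> 0" if kc: "k \<in> set c" for k m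
    proof -
      obtain i where i: "i < length c" and k: "k = c ! i" using kc by (metis in_set_conv_nth)
      have "x k - (u + 1) - of_nat m = - of_nat (Suc (i + m))"
        by (simp add: k x[OF i])
      thus ?thesis by (simp only: neg_equal_0_iff_equal of_nat_neq_0 not_False_eq_True)
    qed
    thus "foldr (\<lambda>k. row_op x k cs) c ?Z = ?W" "garnir cs ?W"
      using row_ops_garnir[of x "u + 1" cs ?Z c] Cons.prems Z by auto
  qed
  have "PS r (set c) (Ant c ?W) = Ant c ?W" if r: "r \<in> ?B" for r
  proof -
    \<comment> \<open>Unfolded, this is the difference of the two sides of the relation. Down the
      column c the denominators are -1, -2, ..., as \<open>Ant_rows_eq_0\<close> asks for with the
      one-element list \<open>[r]\<close> in place of \<open>L\<close>.\<close>
    have "Ant ([r] @ c) ?W = 0"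
      by (rule Ant_rows_eq_0[OF Z, of x "u + 1"]) (use Cons.prems r in \<open>auto simp: x less_Suc_eq_le\<close>)
    thus ?thesis by simp
  qed
  moreover have "garnir cs (Ant c ?W)"
    by (rule commutes_on_garnir[OF commutes_on_Ant W(2)]) (use Cons.prems in auto)
  ultimately show ?case using Cons.prems by (simp add: W alternating_Ant)
qed simp

subsection \<open>Contractions\<close>

lemma lin_Q: "lin (Q_op N n k l)"
  by (rule linI) (auto simp: Q_op_def contract_def pointwise sum.distrib sum_distrib_left)

lemma midx_comp_transpose:
  "i \<in> {1..n} \<Longrightarrow> j \<in> {1..n} \<Longrightarrow> x \<circ> Transposition.transpose i j \<in> midx N n \<longleftrightarrow> x \<in> midx N n"
proof -
  have *: "x \<circ> Transposition.transpose i j \<in> midx N n"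
    if "i \<in> {1..n}" "j \<in> {1..n}" "x \<in> midx N n" for x
    using that unfolding midx_def
    by (auto simp: PiE_def Pi_def extensional_def Transposition.transpose_def)
  assume "i \<in> {1..n}" "j \<in> {1..n}"
  thus ?thesis using *[of x] *[of "x \<circ> Transposition.transpose i j"] by (auto simp: comp_assoc)
qed

lemma P_Q:
  assumes "i \<in> {1..n}" "j \<in> {1..n}"
  shows "P_op i j (Q_op N n k l T)
    = Q_op N n (Transposition.transpose i j k) (Transposition.transpose i j l) (P_op i j T)"
proof
  fix x :: "nat \<Rightarrow> nat"
  let ?t = "Transposition.transpose i j"
  have upd: "(x \<circ> ?t)(k := a, l := a) = x(?t k := a, ?t l := a) \<circ> ?t" for a
    by (auto simp: fun_eq_iff Transposition.transpose_def)
  show "P_op i j (Q_op N n k l T) x = Q_op N n (?t k) (?t l) (P_op i j T) x"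
    using midx_comp_transpose[OF assms, of x N] by (simp add: P_op_def Q_op_def contract_def upd)
qed

lemma P_Q_comm: "i \<in> {1..n} \<Longrightarrow> j \<in> {1..n} \<Longrightarrow> {i, j} \<inter> {k, l} = {} \<Longrightarrow>
    P_op i j (Q_op N n k l T) = Q_op N n k l (P_op i j T)"
  by (subst P_Q) auto

lemma Q_sym: "Q_op N n k l = Q_op N n l k"
  by (cases "k = l") (auto simp: fun_eq_iff Q_op_def contract_def fun_upd_twist)

lemma Q_P: "Q_op N n k l (P_op k l T) = Q_op N n k l T"
proof -
  have "x(k := a, l := a) \<circ> Transposition.transpose k l = x(k := a, l := a)" for x :: "nat \<Rightarrow> nat" and a
    by (auto simp: fun_eq_iff Transposition.transpose_def)
  hence "Q_op N n k l (P_op k l T) x = Q_op N n k l T x" for x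
    by (simp add: P_op_def Q_op_def contract_def)
  thus ?thesis by blast
qed

lemma Q_eq_0: "P_op k l T = - T \<Longrightarrow> Q_op N n k l T = 0"
proof -
  assume "P_op k l T = - T"
  hence "Q_op N n k l T = - Q_op N n k l T" using Q_P[of N n k l T] by (simp add: lin_minus[OF lin_Q])
  thus ?thesis by (simp add: pointwise)
qed

lemma midx_upd: "x \<in> midx N n \<Longrightarrow> k \<in> {1..n} \<Longrightarrow> a < N \<Longrightarrow> x(k := a) \<in> midx N n"
  unfolding midx_def by auto

lemma midx_lt: "x \<in> midx N n \<Longrightarrow> k \<in> {1..n} \<Longrightarrow> x k < N"
  unfolding midx_def by auto

text \<open>A closed loop in the Brauer algebra: the inner contraction is constant along the
  diagonal, and the outer one sums it over all N letters.\<close>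

lemma Q_Q_same:
  assumes "k \<in> {1..n}" "l \<in> {1..n}"
  shows "Q_op N n k l (Q_op N n k l T) = tscale (of_nat N) (Q_op N n k l T)"
proof
  fix x :: "nat \<Rightarrow> nat"
  have "contract N k l (Q_op N n k l T) x = of_nat N * contract N k l T x" if "x \<in> midx N n"
  proof -
    have "contract N k l (Q_op N n k l T) x = (\<Sum>a<N. contract N k l T x)"
      unfolding contract_def[of N k l "Q_op N n k l T"]
    proof (rule sum.cong)
      fix a assume "a \<in> {..<N}"
      hence "x(k := a, l := a) \<in> midx N n" using that assms by (auto intro!: midx_upd)
      moreover have "contract N k l T (x(k := a, l := a)) = contract N k l T x"
        unfolding contract_def by (intro sum.cong arg_cong[of _ _ T]) auto
      ultimately show "Q_op N n k l T (x(k := a, l := a)) = contract N k l T x"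
        by (simp add: Q_op_def)
    qed simp
    thus ?thesis by simp
  qed
  thus "Q_op N n k l (Q_op N n k l T) x = tscale (of_nat N) (Q_op N n k l T) x"
    by (simp add: Q_op_def[of N n k l "Q_op N n k l T"] tscale_apply) (simp add: Q_op_def)
qed

text \<open>In Brauer diagrams the arcs k-l and k-m join the strands l and m.\<close>

lemma Q_Q:
  assumes "k \<in> {1..n}" "l \<in> {1..n}" "m \<in> {1..n}" "k \<noteq> l" "k \<noteq> m" "l \<noteq> m"
  shows "Q_op N n k l (Q_op N n k m T) = Q_op N n k l (P_op l m T)"
proof
  fix x :: "nat \<Rightarrow> nat"
  have "contract N k l (Q_op N n k m T) x = contract N k l (P_op l m T) x" if x: "x \<in> midx N n"
  proof -
    have "Q_op N n k m T (x(k := a, l := a)) = (if x m = a then contract N k m T (x(l := x m)) else 0)"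
      if "a < N" for a
    proof -
      have "x(k := a, l := a) \<in> midx N n" using that x assms by (auto intro!: midx_upd)
      moreover have "contract N k m T (x(k := a, l := a)) = contract N k m T (x(l := a))"
        unfolding contract_def using assms by (intro sum.cong arg_cong[of _ _ T]) auto
      ultimately show ?thesis using assms by (auto simp: Q_op_def)
    qed
    hence "contract N k l (Q_op N n k m T) x
        = (\<Sum>a<N. if x m = a then contract N k m T (x(l := x m)) else 0)"
      unfolding contract_def[of N k l "Q_op N n k m T"] by (intro sum.cong) auto
    also have "\<dots> = contract N k m T (x(l := x m))" using midx_lt[OF x assms(3)] by simp
    also have "\<dots> = contract N k l (P_op l m T) x"
      unfolding contract_def P_op_def using assms
      by (intro sum.cong arg_cong[of _ _ T]) (auto simp: fun_eq_iff Transposition.transpose_def)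
    finally show ?thesis .
  qed
  thus "Q_op N n k l (Q_op N n k m T) x = Q_op N n k l (P_op l m T) x"
    by (simp add: Q_op_def[of N n k l])
qed

lemma Q_comm:
  assumes "i \<in> {1..n}" "j \<in> {1..n}" "k \<in> {1..n}" "l \<in> {1..n}" "{i, j} \<inter> {k, l} = {}"
  shows "Q_op N n i j (Q_op N n k l T) = Q_op N n k l (Q_op N n i j T)"
proof -
  have *: "Q_op N n i j (Q_op N n k l T) x = (if x \<in> midx N n \<and> x i = x j \<and> x k = x l
      then \<Sum>a<N. \<Sum>b<N. T (x(i := a, j := a, k := b, l := b)) else 0)"
    if "i \<in> {1..n}" "j \<in> {1..n}" "{i, j} \<inter> {k, l} = {}" for i j k l x
  proof -
    have "Q_op N n k l T (x(i := a, j := a)) = (if x k = x l then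
        \<Sum>b<N. T (x(i := a, j := a, k := b, l := b)) else 0)" if "x \<in> midx N n" "a < N" for a
    proof -
      have "x(i := a, j := a) \<in> midx N n" using that \<open>i \<in> {1..n}\<close> \<open>j \<in> {1..n}\<close> by (auto intro!: midx_upd)
      thus ?thesis using \<open>{i, j} \<inter> {k, l} = {}\<close> by (auto simp: Q_op_def contract_def)
    qed
    thus ?thesis by (auto simp: Q_op_def[of N n i j] contract_def[of N i j])
  qed
  have upd: "x(k := b, l := b, i := a, j := a) = x(i := a, j := a, k := b, l := b)" for x :: "nat \<Rightarrow> nat" and a b
    using assms(5) by (auto simp: fun_eq_iff)
  show ?thesis
  proof
    fix x :: "nat \<Rightarrow> nat"
    show "Q_op N n i j (Q_op N n k l T) x = Q_op N n k l (Q_op N n i j T) x"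
      using assms
      by (subst (1 2) *) (auto simp: upd intro: sum.swap)
  qed
qed

lemma commutes_on_Q: "{k, l} \<inter> B = {} \<Longrightarrow> B \<subseteq> {1..n} \<Longrightarrow> commutes_on B (Q_op N n k l)"
  unfolding commutes_on_def by (auto simp: lin_Q intro!: P_Q_comm[symmetric])

section \<open>Contractions of one position with a whole column\<close>

definition QS :: "nat \<Rightarrow> nat \<Rightarrow> nat \<Rightarrow> nat set \<Rightarrow> tensor \<Rightarrow> tensor" where
  "QS N n k B T = (\<Sum>l\<in>B. Q_op N n k l T)"

lemma lin_QS: "lin (QS N n k B)"
  unfolding QS_def by (intro lin_sums lin_Q)

lemma P_QS_comm:
  assumes "i \<in> {1..n}" "j \<in> {1..n}" "k \<noteq> i" "k \<noteq> j" "i \<in> B \<longleftrightarrow> j \<in> B"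
  shows "P_op i j (QS N n k B T) = QS N n k B (P_op i j T)"
proof -
  let ?t = "Transposition.transpose i j"
  have "P_op i j (QS N n k B T) = (\<Sum>l\<in>B. Q_op N n k (?t l) (P_op i j T))"
    using assms by (simp add: QS_def lin_sum[OF lin_P] P_Q)
  also have "\<dots> = (\<Sum>l\<in>?t ` B. Q_op N n k l (P_op i j T))"
    by (subst sum.reindex) (auto intro: inj_on_subset[OF inj_transpose])
  finally show ?thesis by (simp only: transpose_image_same[OF assms(5)] QS_def)
qed

lemma commutes_on_QS:
  "k \<notin> B \<Longrightarrow> B \<subseteq> {1..n} \<Longrightarrow> B \<subseteq> L \<or> B \<inter> L = {} \<Longrightarrow> commutes_on B (QS N n k L)"
  unfolding commutes_on_def by (auto simp: lin_QS intro!: P_QS_comm[symmetric])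

definition trace_op :: "nat \<Rightarrow> nat \<Rightarrow> complex \<Rightarrow> nat \<Rightarrow> nat set \<Rightarrow> tensor \<Rightarrow> tensor" where
  "trace_op N n w k B T = T - tscale (1 / w) (QS N n k B T)"

lemma commutes_on_trace_op:
  assumes "k \<notin> B" "B \<subseteq> {1..n}" "B \<subseteq> L \<or> B \<inter> L = {}" shows "commutes_on B (trace_op N n w k L)"
proof -
  have "commutes_on B (\<lambda>T. T - tscale (1 / w) (QS N n k L T))"
    by (intro commutes_on_subtract commutes_on_id commutes_on_scaled commutes_on_QS assms)
  thus ?thesis by (simp add: trace_op_def commutes_on_def lin_def)
qed

definition Rb :: "nat \<Rightarrow> nat \<Rightarrow> (nat \<Rightarrow> complex) \<Rightarrow> nat \<Rightarrow> nat \<Rightarrow> tensor \<Rightarrow> tensor" where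
  "Rb N n y k l T = T - tscale (1 / (y k + y l)) (Q_op N n k l T)"

lemma Rb_sym: "Rb N n y k l = Rb N n y l k"
  by (auto simp: Rb_def fun_eq_iff Q_sym[of N n k l] add.commute)

lemma commutes_on_Rb:
  assumes "{k, l} \<inter> B = {}" "B \<subseteq> {1..n}" shows "commutes_on B (Rb N n y k l)"
proof -
  have "commutes_on B (\<lambda>T. T - tscale (1 / (y k + y l)) (Q_op N n k l T))"
    by (intro commutes_on_subtract commutes_on_id commutes_on_scaled commutes_on_Q assms)
  thus ?thesis by (simp add: Rb_def commutes_on_def lin_def)
qed

lemma Rb_comm:
  assumes "i \<in> {1..n}" "j \<in> {1..n}" "k \<in> {1..n}" "l \<in> {1..n}" "{i, j} \<inter> {k, l} = {}"
  shows "Rb N n y i j (Rb N n y k l T) = Rb N n y k l (Rb N n y i j T)"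
  using Q_comm[OF assms, of N T]
  by (simp add: Rb_def lin_diff[OF lin_Q] lin_scale[OF lin_Q]) (simp add: pointwise algebra_simps)

text \<open>Here the denominators decrease down the column, so the bottom one survives. By
  \<open>Q_Q\<close> and antisymmetry each term of the sum over the rest of the column contributes
  -Q_kl; their number \<open>length bs\<close> is exactly the difference between the top and the
  bottom denominator.\<close>

lemma column_telescope_Q:
  assumes "alternating (set bs) T" "distinct bs" "k \<notin> set bs" "insert k (set bs) \<subseteq> {1..n}"
    and "\<And>i. i < length bs \<Longrightarrow> y (bs ! i) = u - of_nat i"
    and "\<And>l. l \<in> set bs \<Longrightarrow> y k + y l \<noteq> 0" "bs \<noteq> []"
  shows "foldr (Rb N n y k) bs T = trace_op N n (y k + y (last bs)) k (set bs) T"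
  using assms
proof (induction bs arbitrary: u)
  case (Cons l bs)
  show ?case
  proof (cases "bs = []")
    case True thus ?thesis by (simp add: Rb_def trace_op_def QS_def)
  next
    case False
    let ?w = "y k + y (last bs)" and ?q = "Q_op N n k l T"
    have IH: "foldr (Rb N n y k) bs T = trace_op N n ?w k (set bs) T"
    proof (rule Cons.IH)
      show "y (bs ! i) = u - 1 - of_nat i" if "i < length bs" for i
        using Cons.prems(5)[of "Suc i"] that by (simp add: algebra_simps)
    qed (use Cons.prems False in \<open>auto intro: alternating_mono\<close>)
    have "y l = u" using Cons.prems(5)[of 0] by simp
    moreover have "y (last bs) = u - of_nat (length bs)"
      using Cons.prems(5)[of "length bs"] False by (simp add: last_conv_nth nth_Cons')
    ultimately have yl: "y k + y l = ?w + of_nat (length bs)" by simp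
    have nz: "?w \<noteq> 0" "?w + of_nat (length bs) \<noteq> 0"
      using Cons.prems(6)[of l] Cons.prems(6)[of "last bs"] False by (auto simp: yl)
    have "Q_op N n k l (QS N n k (set bs) T) = (\<Sum>m\<in>set bs. Q_op N n k l (Q_op N n k m T))"
      by (simp add: QS_def lin_sum[OF lin_Q])
    also have "\<dots> = (\<Sum>m\<in>set bs. - ?q)"
    proof (rule sum.cong)
      fix m assume m: "m \<in> set bs"
      have "Q_op N n k l (Q_op N n k m T) = Q_op N n k l (P_op l m T)"
        using m Cons.prems by (intro Q_Q) auto
      moreover have "P_op l m T = - T"
        using m Cons.prems by (intro alternatingD[of "set (l # bs)"]) auto
      ultimately show "Q_op N n k l (Q_op N n k m T) = - ?q" by (simp add: lin_minus[OF lin_Q])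
    qed simp
    also have "\<dots> = tscale (- of_nat (length bs)) ?q"
      using Cons.prems(2) by (simp add: pointwise distinct_card)
    finally have QQ: "Q_op N n k l (QS N n k (set bs) T) = tscale (- of_nat (length bs)) ?q" .
    have "foldr (Rb N n y k) (l # bs) T = T - tscale (1 / ?w) (QS N n k (set bs) T)
        - tscale (1 / (?w + of_nat (length bs))) (?q - tscale (1 / ?w) (tscale (- of_nat (length bs)) ?q))"
      by (simp add: IH Rb_def yl trace_op_def lin_diff[OF lin_Q] lin_scale[OF lin_Q] QQ)
    also have "\<dots> = T - tscale (1 / ?w) (?q + QS N n k (set bs) T)"
    proof -
      have "a - s / w - (q + m * q / w) / (w + m) = a - (q + s) / w"
        if "w \<noteq> 0" "w + m \<noteq> 0" for a s w q m :: complex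
        using that by (simp add: divide_simps) (simp add: algebra_simps)
      from this[OF nz] show ?thesis by (simp add: pointwise)
    qed
    also have "?q + QS N n k (set bs) T = QS N n k (set (l # bs)) T"
      using Cons.prems(2) by (simp add: QS_def)
    finally show ?thesis using False by (simp add: trace_op_def)
  qed
qed auto

text \<open>
  The difference of the two denominators equals the difference of the contents at the bottoms of
  two neighbouring columns \<open>a\<close> and \<open>b\<close>.
\<close>

lemma trace_op_two_columns:
  fixes w w' :: complex
  assumes fin: "finite a" "finite b" and disj: "a \<inter> b = {}" "r \<notin> a" "r \<notin> b"
    and sub: "insert r (a \<union> b) \<subseteq> {1..n}"
    and alt: "alternating a T" "alternating b T" and garnir: "\<And>j. j \<in> b \<Longrightarrow> PS j a T = T"
    and w: "w \<noteq> 0" "w' \<noteq> 0" "w' = w + 1 + of_nat (card a) - of_nat (card b)" and j: "j \<in> b"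
  shows "PS j a (trace_op N n w r a (trace_op N n w' r b T)) = trace_op N n w r a (trace_op N n w' r b T)"
proof -
  let ?Q = "\<lambda>k. Q_op N n r k" and ?p = "of_nat (card a) :: complex" and ?q = "of_nat (card b) :: complex"
  let ?A = "QS N n r a T" and ?B = "QS N n r b T"
  \<comment> \<open>The correction terms: \<open>PS j a\<close> changes \<open>?A\<close> and
    \<open>?B\<close> by opposite multiples of \<open>f j - q\<close> (\<open>F1\<close>,
    \<open>F2\<close>), and the double contraction, which is the sum of all \<open>f j'\<close>
    (\<open>F3\<close>), by another multiple of it.\<close>
  define f where "f j = (\<Sum>k\<in>a. ?Q k (P_op j k T))" for j
  define q where "q = ?Q j T"
  have PQ: "P_op j i (?Q k S) = (if i = k then ?Q j (P_op j i S) else ?Q k (P_op j i S))"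
    if "i \<in> a" "k \<in> a" for i k S
  proof -
    have "P_op j i (?Q k S) = Q_op N n (Transposition.transpose j i r) (Transposition.transpose j i k) (P_op j i S)"
      using that j sub by (intro P_Q) auto
    moreover have "j \<noteq> k" "j \<noteq> r" "i \<noteq> r" using that j disj by auto
    ultimately show ?thesis by (auto simp: Transposition.transpose_def)
  qed
  have split: "(\<Sum>i\<in>a. g i) = g k + (\<Sum>i\<in>a - {k}. g i)" if "k \<in> a" for g :: "nat \<Rightarrow> tensor" and k
    using sum.remove[OF fin(1) that] .
  have minus: "(\<Sum>i\<in>a - {k}. P_op j i T) = T - P_op j k T" if "k \<in> a" for k
    using garnir[OF j] that fin(1) by (simp add: PS_def sum_diff1)
  have card_minus: "of_nat (card (c - {k})) = of_nat (card c) - (1 :: complex)" if "finite c" "k \<in> c" for c :: "nat set" and k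
    by (simp flip: card_Suc_Diff1[OF that])
  have F1: "PS j a ?A = ?A - f j + q"
  proof -
    have "PS j a (?Q k T) = ?Q j (P_op j k T) + ?Q k (T - P_op j k T)" if k: "k \<in> a" for k
    proof -
      have "(\<Sum>i\<in>a - {k}. P_op j i (?Q k T)) = (\<Sum>i\<in>a - {k}. ?Q k (P_op j i T))"
        using k by (intro sum.cong) (auto simp: PQ)
      thus ?thesis using k by (simp add: PS_def split[OF k] PQ minus flip: lin_sum[OF lin_Q])
    qed
    hence "PS j a ?A = (\<Sum>k\<in>a. ?Q j (P_op j k T) + ?Q k (T - P_op j k T))"
      by (simp add: QS_def lin_sum[OF lin_PS])
    also have "\<dots> = ?Q j (PS j a T) + (?A - f j)"
      by (simp add: PS_def QS_def f_def lin_sum[OF lin_Q] lin_diff[OF lin_Q] sum.distrib sum_subtractf)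
    finally show ?thesis by (simp add: garnir[OF j] q_def)
  qed
  have F2: "PS j a ?B = ?B - q + f j"
  proof -
    have *: "PS j a (?Q j' T) = ?Q j' T" if "j' \<in> b - {j}" for j'
    proof -
      have "P_op j i (?Q j' T) = ?Q j' (P_op j i T)" if "i \<in> a" for i
        using that \<open>j' \<in> b - {j}\<close> j disj sub by (intro P_Q_comm) auto
      hence "PS j a (?Q j' T) = ?Q j' (PS j a T)" by (simp add: PS_def lin_sum[OF lin_Q])
      thus ?thesis by (simp add: garnir[OF j])
    qed
    have "P_op j i (?Q j T) = ?Q i (P_op j i T)" if "i \<in> a" for i
    proof -
      have "j \<noteq> r" "i \<noteq> r" using that j disj by auto
      moreover have "P_op j i (?Q j T) = Q_op N n (Transposition.transpose j i r) (Transposition.transpose j i j) (P_op j i T)"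
        using that j sub by (intro P_Q) auto
      ultimately show ?thesis by simp
    qed
    hence "PS j a (?Q j T) = f j" by (simp add: PS_def f_def)
    moreover have "?B = ?Q j T + (\<Sum>j'\<in>b - {j}. ?Q j' T)" unfolding QS_def using sum.remove[OF fin(2) j] .
    ultimately show ?thesis
      by (simp add: lin_add[OF lin_PS] lin_sum[OF lin_PS] * q_def)
  qed
  have F3: "QS N n r a ?B = (\<Sum>j'\<in>b. f j')"
  proof -
    have "?Q k (?Q j' T) = ?Q k (P_op j' k T)" if "k \<in> a" "j' \<in> b" for k j'
    proof -
      have "k \<noteq> j'" "r \<noteq> k" "r \<noteq> j'" using that disj by auto
      hence "?Q k (?Q j' T) = ?Q k (P_op k j' T)" using that sub by (intro Q_Q) auto
      thus ?thesis by (simp only: P_sym[of k j'])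
    qed
    hence "(\<Sum>k\<in>a. \<Sum>j'\<in>b. ?Q k (?Q j' T)) = (\<Sum>k\<in>a. \<Sum>j'\<in>b. ?Q k (P_op j' k T))"
      by (intro sum.cong refl)
    also have "\<dots> = (\<Sum>j'\<in>b. f j')" unfolding f_def by (rule sum.swap)
    finally show ?thesis by (simp only: QS_def lin_sum[OF lin_Q])
  qed
  have F4: "PS j a (f j) = tscale (- (?p - 1)) (f j) + tscale ?p q"
  proof -
    have "PS j a (?Q k (P_op j k T)) = q + tscale (- (?p - 1)) (?Q k (P_op j k T))" if k: "k \<in> a" for k
    proof -
      have "P_op j i (?Q k (P_op j k T)) = - ?Q k (P_op j k T)" if i: "i \<in> a - {k}" for i
      proof -
        have "P_op j i (P_op j k T) = P_op j k (P_op i k T)" using i k j disj by (intro P_cycle) auto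
        moreover have "P_op i k T = - T" using i k by (intro alternatingD[OF alt(1)]) auto
        ultimately show ?thesis using i k by (simp add: PQ lin_minus[OF lin_P] lin_minus[OF lin_Q])
      qed
      hence "(\<Sum>i\<in>a - {k}. P_op j i (?Q k (P_op j k T))) = (\<Sum>i\<in>a - {k}. - ?Q k (P_op j k T))"
        by (intro sum.cong) auto
      also have "\<dots> = tscale (- (?p - 1)) (?Q k (P_op j k T))"
        by (simp only: card_minus[OF fin(1) k, symmetric]) (simp add: pointwise)
      finally have "(\<Sum>i\<in>a - {k}. P_op j i (?Q k (P_op j k T))) = tscale (- (?p - 1)) (?Q k (P_op j k T))" .
      moreover have "P_op j k (?Q k (P_op j k T)) = q" using k by (simp add: PQ q_def)
      ultimately show ?thesis by (simp only: PS_def split[OF k])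
    qed
    thus ?thesis unfolding f_def
      by (simp add: lin_sum[OF lin_PS] sum.distrib tensor.scale_sum_right) (simp add: pointwise)
  qed
  have F5: "PS j a (f j') = f j' + f j - q" if j': "j' \<in> b - {j}" for j'
  proof -
    have "PS j a (?Q k (P_op j' k T)) = ?Q k (P_op j' k T) + ?Q k (P_op j k T) - ?Q j (P_op j' k T)"
      if k: "k \<in> a" for k
    proof -
      have "P_op j i (P_op j' k T) = P_op j' k (P_op j i T)" if "i \<in> a - {k}" for i
        using that k j j' disj by (intro P_comm) auto
      hence "(\<Sum>i\<in>a - {k}. P_op j i (?Q k (P_op j' k T))) = (\<Sum>i\<in>a - {k}. ?Q k (P_op j' k (P_op j i T)))"
        using k by (intro sum.cong) (auto simp: PQ)
      also have "\<dots> = ?Q k (P_op j' k (T - P_op j k T))"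
        by (simp add: minus[OF k] flip: lin_sum[OF lin_Q] lin_sum[OF lin_P])
      also have "P_op j' k (T - P_op j k T) = P_op j' k T + P_op j k T"
      proof -
        have "P_op k j' (P_op k j T) = P_op k j (P_op j' j T)" using k j j' disj by (intro P_cycle) auto
        moreover have "P_op j' j T = - T" using j j' by (intro alternatingD[OF alt(2)]) auto
        ultimately show ?thesis
          by (simp add: lin_diff[OF lin_P] lin_minus[OF lin_P] P_sym[of j' k] P_sym[of j k])
      qed
      finally have "(\<Sum>i\<in>a - {k}. P_op j i (?Q k (P_op j' k T))) = ?Q k (P_op j' k T) + ?Q k (P_op j k T)"
        by (simp add: lin_add[OF lin_Q])
      moreover have "P_op j k (?Q k (P_op j' k T)) = - ?Q j (P_op j' k T)"
      proof -
        have "P_op k j (P_op k j' T) = P_op k j' (P_op j j' T)" using k j j' disj by (intro P_cycle) auto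
        moreover have "P_op j j' T = - T" using j j' by (intro alternatingD[OF alt(2)]) auto
        ultimately have "P_op j k (P_op j' k T) = - P_op j' k T"
          by (simp add: lin_minus[OF lin_P] P_sym[of j' k] P_sym[of j k])
        thus ?thesis by (simp add: PQ[OF k k] lin_minus[OF lin_Q])
      qed
      ultimately show ?thesis unfolding PS_def split[OF k] by (simp only: uminus_add_conv_diff)
    qed
    hence "PS j a (f j') = f j' + f j - (\<Sum>k\<in>a. ?Q j (P_op j' k T))"
      unfolding f_def by (simp add: lin_sum[OF lin_PS] sum.distrib sum_subtractf)
    also have "(\<Sum>k\<in>a. ?Q j (P_op j' k T)) = ?Q j (PS j' a T)"
      by (simp add: PS_def lin_sum[OF lin_Q])
    also have "\<dots> = q" using garnir[of j'] j' by (simp add: q_def)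
    finally show ?thesis .
  qed
  let ?S = "\<Sum>j'\<in>b. f j'"
  have S: "?S = f j + (\<Sum>j'\<in>b - {j}. f j')" using sum.remove[OF fin(2) j] .
  have PS: "PS j a ?S = ?S + tscale (?q - ?p - 1) (f j - q)"
  proof -
    have "(\<Sum>j'\<in>b - {j}. PS j a (f j')) = (\<Sum>j'\<in>b - {j}. f j') + tscale (?q - 1) (f j - q)"
    proof -
      have "(\<Sum>j'\<in>b - {j}. PS j a (f j')) = (\<Sum>j'\<in>b - {j}. f j' + (f j - q))"
        by (intro sum.cong) (auto simp: F5)
      thus ?thesis by (simp add: sum.distrib) (simp add: pointwise card_minus[OF fin(2) j])
    qed
    thus ?thesis
      by (simp add: S lin_add[OF lin_PS] lin_sum[OF lin_PS] F4) (simp add: pointwise algebra_simps)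
  qed
  have U: "trace_op N n w r a (trace_op N n w' r b T)
      = T - tscale (1 / w') ?B - tscale (1 / w) (?A - tscale (1 / w') ?S)"
    by (simp add: trace_op_def lin_diff[OF lin_QS] lin_scale[OF lin_QS] F3)
  \<comment> \<open>The total coefficient of \<open>f j - q\<close>. It vanishes precisely because
    w' - w = 1 + card a - card b.\<close>
  have coeff: "(- (1 / w') + 1 / w + (?q - ?p - 1) / (w * w')) = 0"
    using w(1,2) by (simp add: divide_simps) (simp add: w(3) algebra_simps)
  have "PS j a (trace_op N n w r a (trace_op N n w' r b T)) x - trace_op N n w r a (trace_op N n w' r b T) x
      = (- (1 / w') + 1 / w + (?q - ?p - 1) / (w * w')) * (f j x - q x)" for x
    unfolding U lin_diff[OF lin_PS] lin_scale[OF lin_PS] F1 F2 PS garnir[OF j]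
    by (simp add: pointwise algebra_simps diff_divide_distrib add_divide_distrib)
  thus ?thesis unfolding coeff by (simp add: fun_eq_iff)
qed

text \<open>
  While the factors below the top \<open>r\<close> of the column \<open>b\<close> are being applied, the tensor remains
  antisymmetric in \<open>r\<close> and the remaining factors, so that their contractions with \<open>r\<close> vanish.
\<close>

lemma trace_ops_column_pair:
  assumes fin: "finite a" and dist: "distinct (r # ls)" and disj: "a \<inter> set (r # ls) = {}"
    and sub: "a \<union> set (r # ls) \<subseteq> {1..n}"
    and alt: "alternating a T" "alternating (set (r # ls)) T" and garnir: "PS r a T = T"
  shows "PS r a (foldr (\<lambda>l. trace_op N n (W l) l a) (r # ls) T) = foldr (\<lambda>l. trace_op N n (W l) l a) (r # ls) T"
proof -
  let ?F = "\<lambda>ls. foldr (\<lambda>l. trace_op N n (W l) l a) ls T"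
  have inv: "alternating a (?F ms) \<and> alternating (set (r # ls) - set ms) (?F ms) \<and> PS r a (?F ms) = ?F ms"
    if "set ms \<subseteq> set ls" "distinct ms" for ms
    using that
  proof (induction ms)
    case (Cons l ms)
    let ?Y = "?F ms" and ?Q = "\<lambda>k. Q_op N n l k"
    have IH: "alternating a ?Y" "alternating (set (r # ls) - set ms) ?Y" "PS r a ?Y = ?Y"
      using Cons by auto
    have lr: "l \<noteq> r" "l \<notin> a" "r \<notin> a" using Cons.prems dist disj by auto
    have "alternating a (trace_op N n (W l) l a ?Y)"
      by (rule commutes_on_alternating[OF commutes_on_trace_op IH(1)]) (use sub lr in auto)
    moreover have "alternating (set (r # ls) - set (l # ms)) (trace_op N n (W l) l a ?Y)"
    proof (rule commutes_on_alternating[OF commutes_on_trace_op])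
      show "alternating (set (r # ls) - set (l # ms)) ?Y" by (rule alternating_mono[OF IH(2)]) auto
    qed (use sub disj in auto)
    moreover have "PS r a (trace_op N n (W l) l a ?Y) = trace_op N n (W l) l a ?Y"
    proof -
      have Qr: "?Q r ?Y = 0"
      proof (rule Q_eq_0)
        show "P_op l r ?Y = - ?Y" using Cons.prems dist lr by (intro alternatingD[OF IH(2)]) auto
      qed
      have PQ: "P_op r k (?Q k' ?Y) = ?Q (Transposition.transpose r k k') (P_op r k ?Y)" if "k \<in> a" "k' \<in> a" for k k'
      proof -
        have "P_op r k (?Q k' ?Y) = Q_op N n (Transposition.transpose r k l) (Transposition.transpose r k k') (P_op r k ?Y)"
          using that sub by (intro P_Q) auto
        moreover have "Transposition.transpose r k l = l" using lr that by (auto simp: Transposition.transpose_def)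
        ultimately show ?thesis by simp
      qed
      have "PS r a (?Q k' ?Y) = ?Q k' ?Y + ?Q r (P_op r k' ?Y)" if k': "k' \<in> a" for k'
      proof -
        have "(\<Sum>k\<in>a - {k'}. P_op r k (?Q k' ?Y)) = (\<Sum>k\<in>a - {k'}. ?Q k' (P_op r k ?Y))"
          using k' lr by (intro sum.cong) (auto simp: PQ Transposition.transpose_def)
        also have "\<dots> = ?Q k' (\<Sum>k\<in>a - {k'}. P_op r k ?Y)" by (simp add: lin_sum[OF lin_Q])
        also have "(\<Sum>k\<in>a - {k'}. P_op r k ?Y) = ?Y - P_op r k' ?Y"
          using IH(3) fin k' by (simp add: PS_def sum_diff1)
        finally have "(\<Sum>k\<in>a - {k'}. P_op r k (?Q k' ?Y)) = ?Q k' ?Y - ?Q k' (P_op r k' ?Y)"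
          by (simp add: lin_diff[OF lin_Q])
        moreover have "?Q k' (P_op r k' ?Y) = 0"
        proof -
          have "P_op r k' (?Q r ?Y) = ?Q k' (P_op r k' ?Y)"
          proof -
            have "P_op r k' (?Q r ?Y) = Q_op N n (Transposition.transpose r k' l) (Transposition.transpose r k' r) (P_op r k' ?Y)"
              using k' sub by (intro P_Q) auto
            moreover have "Transposition.transpose r k' l = l" using lr k' by (auto simp: Transposition.transpose_def)
            ultimately show ?thesis by simp
          qed
          thus ?thesis using Qr by (simp add: lin_zero[OF lin_P])
        qed
        ultimately show ?thesis using k' lr
          by (simp add: PS_def sum.remove[OF fin k'] PQ add.commute)
      qed
      hence "PS r a (QS N n l a ?Y) = QS N n l a ?Y + ?Q r (PS r a ?Y)"
        by (simp add: QS_def lin_sum[OF lin_PS] sum.distrib) (simp add: PS_def lin_sum[OF lin_Q])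
      thus ?thesis
        by (simp add: trace_op_def lin_diff[OF lin_PS] lin_scale[OF lin_PS] IH(3) Qr)
    qed
    ultimately show ?case by simp
  qed (use alt garnir in simp)
  let ?X = "?F ls" and ?Q = "\<lambda>k. Q_op N n r k"
  have X: "alternating a ?X" "PS r a ?X = ?X" using inv[of ls] dist by auto
  \<comment> \<open>The term for (k, k') equals Q_kk' P_rk X. As X is antisymmetric in a and Q_kk'
    absorbs the exchange of k and k', it changes its sign when k and k' are interchanged.\<close>
  have "(\<Sum>k\<in>a. \<Sum>k'\<in>a - {k}. P_op r k (?Q k' ?X)) = 0"
  proof -
    define h where "h k k' = (if k = k' then 0 else P_op r k (?Q k' ?X))" for k k'
    have h: "h k' k = - h k k'" if k: "k \<in> a" "k' \<in> a" for k k'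
    proof (cases "k = k'")
      case False
      have rk: "r \<noteq> k" "r \<noteq> k'" using k disj by auto
      have e: "P_op r i (?Q i' ?X) = Q_op N n i i' (P_op r i ?X)" if "i \<in> a" "i' \<in> a" "i \<noteq> i'" for i i'
      proof -
        have "P_op r i (?Q i' ?X) = Q_op N n (Transposition.transpose r i r) (Transposition.transpose r i i') (P_op r i ?X)"
          using that sub by (intro P_Q) auto
        moreover have "Transposition.transpose r i i' = i'" using that disj by (auto simp: Transposition.transpose_def)
        ultimately show ?thesis by simp
      qed
      have "Q_op N n k k' (P_op r k' ?X) = Q_op N n k k' (P_op k k' (P_op r k' ?X))"
        by (simp add: Q_P)
      also have "P_op k k' (P_op r k' ?X) = P_op r k (P_op k k' ?X)"
        using False rk P_conj[of k k' r k' ?X] by (simp add: Transposition.transpose_def)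
      also have "P_op k k' ?X = - ?X" using k False by (intro alternatingD[OF X(1)])
      finally have "Q_op N n k k' (P_op r k' ?X) = - Q_op N n k k' (P_op r k ?X)"
        by (simp add: lin_minus[OF lin_P] lin_minus[OF lin_Q])
      thus ?thesis using k False by (simp add: h_def e Q_sym[of N n k' k])
    qed (simp add: h_def)
    have "(\<Sum>k\<in>a. \<Sum>k'\<in>a. h k k') = (\<Sum>k'\<in>a. \<Sum>k\<in>a. h k k')" by (rule sum.swap)
    also have "\<dots> = (\<Sum>k\<in>a. \<Sum>k'\<in>a. - h k k')" by (intro sum.cong refl h)
    finally have "(\<Sum>k\<in>a. \<Sum>k'\<in>a. h k k') = - (\<Sum>k\<in>a. \<Sum>k'\<in>a. h k k')" by (simp add: sum_negf)
    hence "(\<Sum>k\<in>a. \<Sum>k'\<in>a. h k k') = 0" by (simp add: pointwise)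
    moreover have "(\<Sum>k'\<in>a - {k}. P_op r k (?Q k' ?X)) = (\<Sum>k'\<in>a. h k k')" if "k \<in> a" for k
      using that fin by (subst sum.remove[OF fin that]) (auto simp: h_def intro!: sum.cong)
    ultimately show ?thesis by simp
  qed
  moreover have "P_op r k (?Q k ?X) = ?Q k ?X" if "k \<in> a" for k
  proof -
    have "P_op r k (?Q k ?X) = Q_op N n k r (P_op r k ?X)" using that sub P_Q[of r n k N r k ?X] by auto
    thus ?thesis by (simp add: Q_sym[of N n k r] Q_P)
  qed
  ultimately have "PS r a (QS N n r a ?X) = QS N n r a ?X"
  proof -
    assume 1: "(\<Sum>k\<in>a. \<Sum>k'\<in>a - {k}. P_op r k (?Q k' ?X)) = 0"
      and 2: "\<And>k. k \<in> a \<Longrightarrow> P_op r k (?Q k ?X) = ?Q k ?X"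
    have "PS r a (QS N n r a ?X) = (\<Sum>k\<in>a. \<Sum>k'\<in>a. P_op r k (?Q k' ?X))"
      by (simp add: PS_def QS_def lin_sum[OF lin_P])
    also have "\<dots> = (\<Sum>k\<in>a. ?Q k ?X + (\<Sum>k'\<in>a - {k}. P_op r k (?Q k' ?X)))"
      by (intro sum.cong refl) (subst sum.remove[OF fin], auto simp: 2)
    also have "\<dots> = QS N n r a ?X" by (simp add: sum.distrib 1 QS_def)
    finally show ?thesis .
  qed
  thus ?thesis by (simp add: trace_op_def lin_diff[OF lin_PS] lin_scale[OF lin_PS] X)
qed

section \<open>Rearranging the ordered product of contraction factors\<close>

lemma foldr_commute:
  "(\<And>x T. x \<in> set xs \<Longrightarrow> F (f x T) = f x (F T)) \<Longrightarrow> F (foldr f xs T) = foldr f xs (F T)"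
  by (induction xs) auto

lemma foldr_zip:
  assumes "distinct L" "\<And>l l' T. l \<in> set L \<Longrightarrow> l' \<in> set L \<Longrightarrow> l \<noteq> l' \<Longrightarrow> g l (h l' T) = h l' (g l T)"
  shows "foldr g L (foldr h L T) = foldr (\<lambda>l T. g l (h l T)) L T"
  using assms
proof (induction L)
  case (Cons l L)
  have "foldr g L (h l S) = h l (foldr g L S)" for S
    by (rule foldr_commute[symmetric], rule Cons.prems(2)[symmetric]) (use Cons.prems(1) in auto)
  thus ?case using Cons by simp
qed simp

text \<open>Reading a rectangle of factors by columns instead of rows preserves the order of any two
  factors in one row or one column. So only factors that differ in both indices have to
  commute.\<close>

lemma foldr_swap:
  assumes "distinct K" "distinct L"
    and "\<And>k k' l l' T. k \<in> set K \<Longrightarrow> k' \<in> set K \<Longrightarrow> l \<in> set L \<Longrightarrow> l' \<in> set L \<Longrightarrow> k \<noteq> k' \<Longrightarrow> l \<noteq> l' \<Longrightarrow>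
      f k l (f k' l' T) = f k' l' (f k l T)"
  shows "foldr (\<lambda>k. foldr (f k) L) K T = foldr (\<lambda>l. foldr (\<lambda>k. f k l) K) L T"
  using assms(1,3)
proof (induction K)
  case Nil
  have "foldr (\<lambda>l T. T) L T = T" by (induction L) auto
  thus ?case by (simp add: id_def)
next
  case (Cons k K)
  have "foldr (\<lambda>k. foldr (f k) L) (k # K) T = foldr (f k) L (foldr (\<lambda>l. foldr (\<lambda>k. f k l) K) L T)"
    using Cons by simp
  also have "\<dots> = foldr (\<lambda>l T. f k l (foldr (\<lambda>k. f k l) K T)) L T"
    by (rule foldr_zip[OF assms(2)], rule foldr_commute, rule Cons.prems(2)) (use Cons.prems(1) in auto)
  finally show ?case by (simp add: comp_def)
qed

text \<open>As pairs within a column are left out of F, the first column contributes a full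
  rectangle of factors, which may be read along either side.\<close>

primrec Grec :: "nat \<Rightarrow> nat \<Rightarrow> (nat \<Rightarrow> complex) \<Rightarrow> nat list list \<Rightarrow> tensor \<Rightarrow> tensor" where
  "Grec N n y [] = (\<lambda>T. T)"
| "Grec N n y (c # cs) = (\<lambda>T. foldr (\<lambda>k. foldr (Rb N n y k) (concat cs)) c (Grec N n y cs T))"

fun nonzero_sums :: "(nat \<Rightarrow> complex) \<Rightarrow> nat list list \<Rightarrow> bool" where
  "nonzero_sums y [] \<longleftrightarrow> True"
| "nonzero_sums y (c # cs) \<longleftrightarrow>
    (\<forall>k\<in>set c. \<forall>l\<in>set (concat cs). y k + y l \<noteq> 0) \<and> nonzero_sums y cs"

lemma commutes_on_Grec:
  assumes "B \<inter> set (concat cs) = {}" "B \<subseteq> {1..n}" shows "commutes_on B (Grec N n y cs)"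
  using assms(1)
proof (induction cs)
  case Nil thus ?case by (simp add: commutes_on_id)
next
  case (Cons c cs)
  have "commutes_on B (foldr (\<lambda>k. foldr (Rb N n y k) (concat cs)) c)"
  proof (rule commutes_on_foldr)
    fix k assume "k \<in> set c"
    thus "commutes_on B (foldr (Rb N n y k) (concat cs))" using Cons.prems
      by (intro commutes_on_foldr commutes_on_Rb assms) auto
  qed
  moreover have "commutes_on B (Grec N n y cs)" using Cons by auto
  ultimately show ?case by (simp add: commutes_on_def lin_def)
qed

lemma commutes_on_row:
  "k \<notin> B \<Longrightarrow> B \<inter> set L = {} \<Longrightarrow> B \<subseteq> {1..n} \<Longrightarrow> commutes_on B (foldr (Rb N n y k) L)"
  by (rule commutes_on_foldr, rule commutes_on_Rb) auto

text \<open>The relation with b writes T as the sum of the exchanges of r with positions of b, and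
  there \<open>PS_PS_garnir\<close> gives the relation with c. So it is enough to compare
  neighbouring columns.\<close>

lemma garnir_chain:
  assumes "garnir (b # cs) T" "\<And>r. r \<in> set b \<Longrightarrow> PS r (set c) T = T"
    and "set c \<inter> set (concat (b # cs)) = {}" "set b \<inter> set (concat cs) = {}" "r \<in> set (concat cs)"
  shows "PS r (set c) T = T"
proof -
  have "PS r (set c) (PS r (set b) T) = PS r (set b) T"
    using assms by (intro PS_PS_garnir) auto
  thus ?thesis using assms by simp
qed

lemma good_colsD:
  assumes "good_cols y u (c # cs)"
  shows "c \<noteq> []" "distinct c" "\<And>i. i < length c \<Longrightarrow> y (c ! i) = u - of_nat i"
    "y (hd c) = u" "y (last c) = u + 1 - of_nat (card (set c))"
    "set c \<inter> set (concat cs) = {}" "good_cols y (u + 1) cs"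
proof -
  show c: "c \<noteq> []" "distinct c" "\<And>i. i < length c \<Longrightarrow> y (c ! i) = u - of_nat i"
    "set c \<inter> set (concat cs) = {}" "good_cols y (u + 1) cs" using assms by auto
  show "y (hd c) = u" using c(1) c(3)[of 0] by (simp add: hd_conv_nth)
  have "Suc (length c - 1) = length c" using c(1) by simp
  hence "of_nat (length c - 1) = of_nat (length c) - (1 :: complex)" by (metis of_nat_Suc add_diff_cancel_left')
  thus "y (last c) = u + 1 - of_nat (card (set c))"
    using c(1) c(3)[of "length c - 1"] distinct_card[OF c(2)] by (simp add: last_conv_nth)
qed

lemma distinct_concat_good_cols: "good_cols y u cs \<Longrightarrow> distinct (concat cs)"
  by (induction cs arbitrary: u) auto

text \<open>The two products telescope to the denominators at the bottoms of c and b. Their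
  difference is 1 plus the length of c minus the length of b, the condition in
  \<open>trace_op_two_columns\<close>.\<close>

lemma two_columns_step:
  fixes N :: nat
  assumes good: "good_cols y u (c # b # cs)" and sub: "insert k (set c \<union> set b) \<subseteq> {1..n}"
    and k: "k \<notin> set c" "k \<notin> set b" and nz: "\<And>l. l \<in> set c \<union> set b \<Longrightarrow> y k + y l \<noteq> 0"
    and T: "alternating (set c) T" "alternating (set b) T" "\<And>r. r \<in> set b \<Longrightarrow> PS r (set c) T = T"
  defines "U \<equiv> foldr (Rb N n y k) c (foldr (Rb N n y k) b T)"
  shows "alternating (set c) U" "alternating (set b) U" "\<And>r. r \<in> set b \<Longrightarrow> PS r (set c) U = U"
proof -
  note c = good_colsD[OF good] and b = good_colsD[OF good_colsD(7)[OF good]]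
  let ?w = "y k + y (last c)" and ?w' = "y k + y (last b)"
  define V where "V = foldr (Rb N n y k) b T"
  have V: "V = trace_op N n ?w' k (set b) T" unfolding V_def
    by (rule column_telescope_Q) (use T k sub b nz in auto)
  have comm: "commutes_on (set c) (foldr (Rb N n y k) b)" "commutes_on (set b) (foldr (Rb N n y k) c)"
    using k sub c(6) by (auto intro!: commutes_on_row)
  have Vc: "alternating (set c) V" unfolding V_def using commutes_on_alternating[OF comm(1) T(1)] .
  have Vb: "alternating (set b) V" unfolding V
    by (rule commutes_on_alternating[OF commutes_on_trace_op T(2)]) (use k sub in auto)
  have U: "U = trace_op N n ?w k (set c) V" unfolding U_def V_def[symmetric]
    by (rule column_telescope_Q) (use Vc k sub c nz in auto)
  show "alternating (set c) U" unfolding U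
    by (rule commutes_on_alternating[OF commutes_on_trace_op Vc]) (use k sub in auto)
  show "alternating (set b) U" unfolding U_def V_def[symmetric]
    using commutes_on_alternating[OF comm(2) Vb] .
  show "PS r (set c) U = U" if "r \<in> set b" for r unfolding U V
  proof (rule trace_op_two_columns[of _ "set b"])
    show "?w' = ?w + 1 + of_nat (card (set c)) - of_nat (card (set b))"
      by (simp add: c(5) b(5))
  qed (use that T k sub c(1,6) b(1) nz in auto)
qed

lemma garnir_row:
  assumes "good_cols y u cs" "garnir cs T" "k \<notin> set (concat cs)" "insert k (set (concat cs)) \<subseteq> {1..n}"
    and "\<And>l. l \<in> set (concat cs) \<Longrightarrow> y k + y l \<noteq> 0"
  shows "garnir cs (foldr (Rb N n y k) (concat cs) T)"
  using assms
proof (induction cs arbitrary: u)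
  case (Cons b cs)
  note b = good_colsD[OF Cons.prems(1)]
  let ?L = "concat cs"
  define T1 where "T1 = foldr (Rb N n y k) ?L T"
  define U where "U = foldr (Rb N n y k) b T1"
  have U: "foldr (Rb N n y k) (concat (b # cs)) T = U" by (simp add: U_def T1_def)
  have T1: "garnir cs T1" unfolding T1_def by (rule Cons.IH[of "u + 1"]) (use Cons.prems in auto)
  have T1b: "alternating (set b) T1" unfolding T1_def
    by (rule commutes_on_alternating[OF commutes_on_row]) (use Cons.prems in auto)
  have Ub: "alternating (set b) U"
  proof -
    have "U = trace_op N n (y k + y (last b)) k (set b) T1" unfolding U_def
      by (rule column_telescope_Q) (use Cons.prems b T1b in auto)
    thus ?thesis
      using commutes_on_alternating[OF commutes_on_trace_op T1b] Cons.prems by auto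
  qed
  have Ucs: "garnir cs U" unfolding U_def
    by (rule commutes_on_garnir[OF commutes_on_row T1]) (use Cons.prems in auto)
  have "PS r (set b) U = U" if r: "r \<in> set (concat cs)" for r
  proof (cases cs)
    case Nil thus ?thesis using r by simp
  next
    case (Cons b' cs')
    note prems = Cons.prems[unfolded Cons]
    \<comment> \<open>The factors with the columns after b' are applied first and commute with all
      permutations of b and b', so \<open>two_columns_step\<close> can start from
      \<open>T2\<close>.\<close>
    define T2 where "T2 = foldr (Rb N n y k) (concat cs') T"
    have comm: "commutes_on (set b \<union> set b') (foldr (Rb N n y k) (concat cs'))"
      by (rule commutes_on_row) (use prems in auto)
    have "U = foldr (Rb N n y k) b (foldr (Rb N n y k) b' T2)"
      by (simp add: U_def T1_def T2_def Cons)
    moreover have "PS r (set b) (foldr (Rb N n y k) b (foldr (Rb N n y k) b' T2))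
        = foldr (Rb N n y k) b (foldr (Rb N n y k) b' T2)" if "r \<in> set b'" for r
    proof (rule two_columns_step(3)[OF prems(1)])
      show "alternating (set b) T2" "alternating (set b') T2" unfolding T2_def
        using prems(2) by (auto intro: commutes_on_alternating[OF commutes_on_mono[OF comm]])
      show "PS r (set b) T2 = T2" if "r \<in> set b'" for r unfolding T2_def
        using prems(2) that commutes_on_PS_apply[OF comm, of r "set b" T] by auto
    qed (use that prems in auto)
    ultimately have "PS r (set b) U = U" if "r \<in> set b'" for r using that by simp
    moreover have "PS r (set b) U = U" if "r \<in> set (concat cs')"
      by (rule garnir_chain[of b' cs']) (use Ucs Cons calculation that prems in auto)
    ultimately show ?thesis using r Cons by auto
  qed
  thus ?case using Ub Ucs unfolding U by simp
qed simp

lemma foldr_invariant: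
  "(\<And>x T. x \<in> set xs \<Longrightarrow> I T \<Longrightarrow> I (f x T)) \<Longrightarrow> I T \<Longrightarrow> I (foldr f xs T)"
  by (induction xs) auto

lemma foldr_cong_invariant:
  assumes "\<And>x T. x \<in> set xs \<Longrightarrow> I T \<Longrightarrow> I (f x T)" "\<And>x T. x \<in> set xs \<Longrightarrow> I T \<Longrightarrow> f x T = g x T" "I T"
  shows "foldr f xs T = foldr g xs T"
  using assms
proof (induction xs)
  case (Cons x xs)
  have IH: "foldr f xs T = foldr g xs T" by (rule Cons.IH) (use Cons.prems in \<open>blast intro: list.set_intros\<close>)+
  have "I (foldr f xs T)" by (rule foldr_invariant) (use Cons.prems in \<open>blast intro: list.set_intros\<close>)+
  hence "f x (foldr f xs T) = g x (foldr f xs T)" by (rule Cons.prems(2)[rotated]) simp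
  thus ?case by (simp only: foldr.simps comp_apply IH)
qed simp

lemma garnir_Grec:
  assumes "good_cols y u cs" "nonzero_sums y cs" "set (concat cs) \<subseteq> {1..n}" "garnir cs T"
  shows "garnir cs (Grec N n y cs T)"
  using assms
proof (induction cs arbitrary: u)
  case (Cons c cs)
  note c = good_colsD[OF Cons.prems(1)]
  let ?R = "Rb N n y" and ?L = "concat cs"
  have dL: "distinct ?L" using distinct_concat_good_cols[OF c(7)] .
  have nz: "y k + y l \<noteq> 0" if "k \<in> set c" "l \<in> set ?L" for k l using Cons.prems(2) that by auto
  define T1 where "T1 = Grec N n y cs T"
  define U where "U = foldr (\<lambda>k. foldr (?R k) ?L) c T1"
  have T1: "garnir cs T1" unfolding T1_def by (rule Cons.IH[of "u + 1"]) (use Cons.prems in auto)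
  have T1c: "alternating (set c) T1" unfolding T1_def
    by (rule commutes_on_alternating[OF commutes_on_Grec]) (use Cons.prems in auto)
  have Ucs: "garnir cs U" unfolding U_def
  proof (rule foldr_invariant[of _ "garnir cs"])
    fix k S assume "k \<in> set c" "garnir cs S"
    thus "garnir cs (foldr (?R k) ?L S)"
      by (intro garnir_row[of y "u + 1"]) (use Cons.prems in auto)
  qed (rule T1)
  have swap: "foldr (\<lambda>k. foldr (?R k) L) K S = foldr (\<lambda>l. foldr (\<lambda>k. ?R k l) K) L S"
    if "distinct K" "distinct L" "set K \<inter> set L = {}" "set K \<union> set L \<subseteq> {1..n}" for K L S
    by (rule foldr_swap[OF that(1,2)], rule Rb_comm) (use that(3,4) in auto)
  have col: "foldr (\<lambda>k. ?R k l) K = foldr (?R l) K" for K l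
  proof -
    have "(\<lambda>k. ?R k l) = ?R l" by (rule ext) (rule Rb_sym)
    thus ?thesis by simp
  qed
  have tel: "alternating (set c) (foldr (?R l) c S)
      \<and> foldr (?R l) c S = trace_op N n (y l + y (last c)) l (set c) S"
    if "alternating (set c) S" "l \<in> set ?L" for S l
  proof -
    have eq: "foldr (?R l) c S = trace_op N n (y l + y (last c)) l (set c) S"
    proof (rule column_telescope_Q)
      show "y l + y k \<noteq> 0" if "k \<in> set c" for k
        using nz[OF that \<open>l \<in> set ?L\<close>] by (simp add: add.commute)
    qed (use that c Cons.prems in auto)
    have "alternating (set c) (trace_op N n (y l + y (last c)) l (set c) S)"
      by (rule commutes_on_alternating[OF commutes_on_trace_op that(1)]) (use that c(6) Cons.prems in auto)
    thus ?thesis using eq by simp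
  qed
  \<comment> \<open>Alternation in c is seen by reading the rectangle the other way: for a fixed l
    the product over c telescopes.\<close>
  have Uc: "alternating (set c) U"
  proof -
    have "U = foldr (\<lambda>l. foldr (?R l) c) ?L T1" unfolding U_def
      using Cons.prems(3) c(2,6) dL by (subst swap) (auto simp: col)
    moreover have "alternating (set c) (foldr (\<lambda>l. foldr (?R l) c) ?L T1)"
      by (rule foldr_invariant[of _ "alternating (set c)"]) (use tel T1c in blast)+
    ultimately show ?thesis by simp
  qed
  have "PS r (set c) U = U" if r: "r \<in> set ?L" for r
  proof (cases cs)
    case Nil thus ?thesis using r by simp
  next
    case (Cons b cs')
    note prems = Cons.prems[unfolded Cons]
    note b = good_colsD[OF c(7)[unfolded Cons]]
    let ?M = "concat cs'"
    have L: "?L = b @ ?M" by (simp add: Cons)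
    define T2 where "T2 = Grec N n y cs' T"
    \<comment> \<open>All factors joining c or b to the later columns are collected in V. What
      remains is the rectangle between c and b, where \<open>trace_ops_column_pair\<close> gives the
      relation for the top of b; alternation in b carries it to the rest of b.\<close>
    define V where "V = foldr (\<lambda>k. foldr (?R k) ?M) (c @ b) T2"
    have dist: "distinct c" "distinct b" "distinct ?M" "set c \<inter> set b = {}" "set c \<inter> set ?M = {}"
      "set b \<inter> set ?M = {}" using c(2,6) dL by (auto simp: L)
    have sub: "set c \<subseteq> {1..n}" "set b \<subseteq> {1..n}" "set ?M \<subseteq> {1..n}" using prems(3) by auto
    define J where "J S \<longleftrightarrow> alternating (set c) S \<and> alternating (set b) S \<and> (\<forall>r\<in>set b. PS r (set c) S = S)" for S
    have UV: "U = foldr (\<lambda>k. foldr (?R k) b) c V"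
    proof -
      have "U = foldr (\<lambda>k T. foldr (?R k) b (foldr (?R k) ?M T)) c T1"
      proof -
        have "foldr (?R k) ?L = (\<lambda>T. foldr (?R k) b (foldr (?R k) ?M T))" for k
          by (rule ext) (simp add: L)
        thus ?thesis by (simp only: U_def)
      qed
      also have "\<dots> = foldr (\<lambda>k. foldr (?R k) b) c (foldr (\<lambda>k. foldr (?R k) ?M) c T1)"
      proof (rule foldr_zip[symmetric, OF dist(1)])
        fix k k' S assume k: "k \<in> set c" "k' \<in> set c" "k \<noteq> k'"
        show "foldr (?R k) b (foldr (?R k') ?M S) = foldr (?R k') ?M (foldr (?R k) b S)"
        proof (rule foldr_commute)
          fix m S assume m: "m \<in> set ?M"
          show "foldr (?R k) b (?R k' m S) = ?R k' m (foldr (?R k) b S)"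
          proof (rule foldr_commute[symmetric])
            fix l S assume l: "l \<in> set b"
            have "k' \<noteq> l" "m \<noteq> k" "m \<noteq> l" using k m l dist(4-6) by auto
            moreover have "k' \<in> {1..n}" "m \<in> {1..n}" "k \<in> {1..n}" "l \<in> {1..n}"
              using k m l sub by auto
            ultimately show "?R k' m (?R k l S) = ?R k l (?R k' m S)"
              using k(3) by (intro Rb_comm) auto
          qed
        qed
      qed
      also have "T1 = foldr (\<lambda>k. foldr (?R k) ?M) b T2" by (simp add: T1_def T2_def Cons)
      finally show ?thesis by (simp add: V_def)
    qed
    have "J T2"
    proof -
      have comm: "commutes_on (set c \<union> set b) (Grec N n y cs')"
        by (rule commutes_on_Grec) (use dist sub in auto)
      have "PS r (set c) T2 = T2" if "r \<in> set b" for r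
      proof -
        have "PS r (set c) T = T" using prems(4) that by auto
        with commutes_on_PS_apply[OF comm, of r "set c" T] that show ?thesis
          unfolding T2_def by simp
      qed
      moreover have "alternating (set c) T2" "alternating (set b) T2" unfolding T2_def
        using prems(4) by (auto intro: commutes_on_alternating[OF commutes_on_mono[OF comm]])
      ultimately show ?thesis by (simp add: J_def)
    qed
    moreover have "V = foldr (\<lambda>l. foldr (?R l) (c @ b)) ?M T2" unfolding V_def
    proof -
      have "distinct (c @ b)" "set (c @ b) \<inter> set ?M = {}" "set (c @ b) \<union> set ?M \<subseteq> {1..n}"
        using dist sub by auto
      from swap[OF this(1) dist(3) this(2,3), of T2]
      show "foldr (\<lambda>k. foldr (?R k) ?M) (c @ b) T2 = foldr (\<lambda>l. foldr (?R l) (c @ b)) ?M T2"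
        by (simp only: col)
    qed
    moreover have "J (foldr (?R l) (c @ b) S)" if "J S" "l \<in> set ?M" for l S
    proof -
      have nz': "y l + y k \<noteq> 0" if "k \<in> set c \<union> set b" for k
        using prems(2) that \<open>l \<in> set ?M\<close> by (auto simp: add.commute[of "y l"])
      have "insert l (set c \<union> set b) \<subseteq> {1..n}" "l \<notin> set c" "l \<notin> set b" using that dist sub by auto
      from two_columns_step[OF prems(1) this nz'] that(1) show ?thesis by (simp add: J_def)
    qed
    ultimately have V: "J V" using foldr_invariant[of ?M J] by metis
    have U: "U = foldr (\<lambda>l. trace_op N n (y l + y (last c)) l (set c)) b V"
    proof -
      have "U = foldr (\<lambda>l. foldr (?R l) c) b V" unfolding UV
        using swap[OF dist(1,2,4), of V] sub by (simp add: col)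
      also have "\<dots> = foldr (\<lambda>l. trace_op N n (y l + y (last c)) l (set c)) b V"
      proof (rule foldr_cong_invariant[of b "alternating (set c)"])
        fix l S assume "l \<in> set b" "alternating (set c) S"
        thus "alternating (set c) (foldr (?R l) c S)"
          "foldr (?R l) c S = trace_op N n (y l + y (last c)) l (set c) S"
          using tel[of S l] unfolding L by auto
      qed (use V in \<open>simp add: J_def\<close>)
      finally show ?thesis .
    qed
    have bU: "PS r (set c) U = U" if r: "r \<in> set b" for r
    proof -
      obtain r0 ls where b0: "b = r0 # ls" using b(1) by (cases b) auto
      have "PS r0 (set c) U = U" unfolding U b0
        by (rule trace_ops_column_pair) (use V dist sub in \<open>auto simp: J_def b0\<close>)
      moreover have "P_op r r0 U = - U" if "r \<noteq> r0"
        using Ucs r that b0 by (auto intro: alternatingD simp: Cons)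
      moreover have "P_op r r0 (PS r0 (set c) U) = PS r (set c) (P_op r r0 U)"
      proof -
        have "Transposition.transpose r r0 ` set c = set c"
          using r b0 dist(4) by (intro transpose_image_same) auto
        thus ?thesis by (simp add: P_PS)
      qed
      ultimately show ?thesis by (cases "r = r0") (auto simp: lin_minus[OF lin_PS])
    qed
    show ?thesis
    proof (cases "r \<in> set b")
      case False
      hence "r \<in> set ?M" using r L by auto
      thus ?thesis using Ucs bU dist Cons L by (intro garnir_chain[of b cs' U c r]) auto
    qed (rule bU)
  qed
  thus ?case using Ucs Uc unfolding U_def T1_def by simp
qed simp

text \<open>Since Q^2 = N Q, this contraction annihilates the leftmost factor 1 - Q/N.\<close>

lemma Q_hd_Grec:
  assumes "c \<noteq> []" "b \<noteq> []" "hd c \<in> {1..n}" "hd b \<in> {1..n}" "y (hd c) + y (hd b) = of_nat N" "1 \<le> N"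
  shows "Q_op N n (hd c) (hd b) (Grec N n y (c # b # cs) T) = 0"
proof -
  have "\<exists>S. Grec N n y (c # b # cs) T = Rb N n y (hd c) (hd b) S"
    using assms(1,2) by (cases c; cases b) (auto simp: comp_def)
  then obtain S where "Grec N n y (c # b # cs) T = Rb N n y (hd c) (hd b) S" ..
  thus ?thesis using assms
    by (simp add: Rb_def lin_diff[OF lin_Q] lin_scale[OF lin_Q] Q_Q_same)
qed

text \<open>Permutations within c and b act by signs, so the contraction of the tops controls all
  pairs between c and b. For the other pairs l is moved by a relation: if U is the sum of P_lm U
  over m in a column, then Q_kl U is the sum of P_lm Q_km U. This column is b when k is in c, and c
  when neither k nor l is in c.\<close>

lemma Q_garnir_eq_0:
  assumes "garnir (c # b # cs) U" "good_cols y u (c # b # cs)" "set (concat (c # b # cs)) \<subseteq> {1..n}"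
    and 0: "Q_op N n (hd c) (hd b) U = 0"
    and kl: "k \<in> set (concat (c # b # cs))" "l \<in> set (concat (c # b # cs))" "k \<noteq> l"
  shows "Q_op N n k l U = 0"
proof -
  note c = good_colsD[OF assms(2)] and b = good_colsD[OF good_colsD(7)[OF assms(2)]]
  let ?S = "set (concat (c # b # cs))"
  have P: "P_op i j U = - U" if "i \<in> set c \<and> j \<in> set c \<or> i \<in> set b \<and> j \<in> set b" "i \<noteq> j" for i j
    using assms(1) that by (auto intro: alternatingD)
  have PQ: "Q_op N n (Transposition.transpose i j k) (Transposition.transpose i j l) (P_op i j U) = 0"
    if "Q_op N n k l U = 0" "i \<in> ?S" "j \<in> ?S" for i j k l
  proof -
    have "P_op i j (Q_op N n k l U) = 0" using that by (simp add: lin_zero[OF lin_P])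
    thus ?thesis using that assms(3) by (subst (asm) P_Q) auto
  qed
  have cb: "Q_op N n k l U = 0" if k: "k \<in> set c" and l: "l \<in> set b" for k l
  proof -
    have hd: "hd c \<in> set c" "hd b \<in> set b" using c(1) b(1) by auto
    have "Q_op N n k (hd b) U = 0"
    proof (cases "k = hd c")
      case False
      have "Transposition.transpose k (hd c) (hd b) = hd b" using hd k c(6) by (auto simp: Transposition.transpose_def)
      moreover have "P_op k (hd c) U = - U" using k hd False by (intro P) auto
      ultimately show ?thesis using PQ[OF 0, of k "hd c"] k hd
        by (auto simp: lin_minus[OF lin_Q])
    qed (use 0 in simp)
    note 1 = this
    show ?thesis
    proof (cases "l = hd b")
      case False
      have "Transposition.transpose l (hd b) k = k" using hd k l c(6) by (auto simp: Transposition.transpose_def)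
      moreover have "P_op l (hd b) U = - U" using l hd False by (intro P) auto
      ultimately show ?thesis using PQ[OF 1, of l "hd b"] l hd
        by (auto simp: lin_minus[OF lin_Q])
    qed (use 1 in simp)
  qed
  have exch: "Q_op N n k l U = 0"
    if B: "finite B" "PS l B U = U" "l \<notin> B" "k \<noteq> l" "k \<notin> B" "insert k (insert l B) \<subseteq> ?S"
      and 0: "\<And>m. m \<in> B \<Longrightarrow> Q_op N n k m U = 0" for k l B
  proof -
    have "Q_op N n k l (P_op l m U) = 0" if "m \<in> B" for m
    proof -
      have "P_op l m (Q_op N n k m U) = Q_op N n k l (P_op l m U)"
      proof -
        have "P_op l m (Q_op N n k m U) = Q_op N n (Transposition.transpose l m k) (Transposition.transpose l m m) (P_op l m U)"
          by (rule P_Q) (use that B(6) assms(3) in blast)+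
        moreover have "Transposition.transpose l m k = k" using that B by (auto simp: Transposition.transpose_def)
        ultimately show ?thesis by simp
      qed
      thus ?thesis using 0[OF that] by (simp add: lin_zero[OF lin_P])
    qed
    hence "Q_op N n k l (PS l B U) = 0" by (simp add: PS_def lin_sum[OF lin_Q])
    thus ?thesis using B by simp
  qed
  have ct: "Q_op N n k l U = 0" if k: "k \<in> set c" and l: "l \<in> set (concat (b # cs))" for k l
  proof (cases "l \<in> set b")
    case False
    hence "l \<in> set (concat cs)" using l by auto
    show ?thesis
    proof (rule exch[of "set b"])
      show "Q_op N n k m U = 0" if "m \<in> set b" for m using cb k that .
      show "PS l (set b) U = U" using assms(1) \<open>l \<in> set (concat cs)\<close> by simp
    qed (use k l c(6) False in auto)
  qed (use cb k in auto)
  have tt: "Q_op N n k l U = 0" if k: "k \<in> set (concat (b # cs))" and l: "l \<in> set (concat (b # cs))" and "k \<noteq> l" for k l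
  proof (rule exch[of "set c"])
    show "Q_op N n k m U = 0" if "m \<in> set c" for m using ct[OF that k] by (simp only: Q_sym[of N n k m])
  qed (use that assms(1) c(6) in auto)
  have cc: "Q_op N n k l U = 0" if "k \<in> set c" "l \<in> set c" "k \<noteq> l" for k l
    using that by (intro Q_eq_0 P) auto
  consider "k \<in> set c" "l \<in> set c" | "k \<in> set c" "l \<in> set (concat (b # cs))"
    | "l \<in> set c" "k \<in> set (concat (b # cs))" | "k \<in> set (concat (b # cs))" "l \<in> set (concat (b # cs))"
    using kl by auto
  thus ?thesis
  proof cases
    case 3
    thus ?thesis using ct[OF 3] by (simp only: Q_sym[of N n k l])
  qed (use cc ct tt kl(3) in blast)+
qed

subsection \<open>Words and columns\<close>

lemma sum_nat_set_ge:
  fixes A :: "nat set"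
  assumes "finite A"
  shows "\<Sum>{..<card A} \<le> \<Sum>A \<and> (\<Sum>A = \<Sum>{..<card A} \<longrightarrow> A = {..<card A})"
  using assms
proof (induction "card A" arbitrary: A)
  case (Suc m)
  define M where "M = Max A"
  have M: "M \<in> A" using Suc.hyps(2) Suc.prems by (auto simp: M_def intro!: Max_in)
  have "A \<subseteq> {..M}" using Suc.prems by (auto simp: M_def)
  hence mM: "m \<le> M" using card_mono[of "{..M}" A] Suc.hyps(2) by simp
  have card: "card (A - {M}) = m" using M Suc.hyps(2) by simp
  have sum: "\<Sum>A = M + \<Sum>(A - {M})" using M Suc.prems by (simp add: sum.remove)
  have IH: "\<Sum>{..<m} \<le> \<Sum>(A - {M})" "\<Sum>(A - {M}) = \<Sum>{..<m} \<Longrightarrow> A - {M} = {..<m}"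
    using Suc.hyps(1)[of "A - {M}"] card Suc.prems by auto
  have tri: "\<Sum>{..<card A} = m + \<Sum>{..<m}" by (simp flip: Suc.hyps(2) add: lessThan_Suc)
  show ?case
  proof
    show "\<Sum>{..<card A} \<le> \<Sum>A" using IH(1) mM by (simp add: tri sum)
    show "\<Sum>A = \<Sum>{..<card A} \<longrightarrow> A = {..<card A}"
    proof
      assume "\<Sum>A = \<Sum>{..<card A}"
      hence "M = m" "\<Sum>(A - {M}) = \<Sum>{..<m}" using IH(1) mM by (auto simp: tri sum)
      thus "A = {..<card A}" using IH(2) M by (auto simp flip: Suc.hyps(2) simp: lessThan_Suc)
    qed
  qed
qed auto

text \<open>The least letter sum of a word without repetitions in any column; for the columns of
  \<lambda> it is n(\<lambda>), the sum of (i - 1) \<lambda>_i.\<close>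

definition min_sum :: "nat list list \<Rightarrow> nat" where
  "min_sum cs = (\<Sum>c\<leftarrow>cs. \<Sum>{..<length c})"

lemma sum_concat_Cons:
  fixes g :: "nat \<Rightarrow> 'a :: comm_monoid_add"
  assumes "distinct (concat (c # cs))"
  shows "(\<Sum>k\<in>set (concat (c # cs)). g k) = (\<Sum>k\<in>set c. g k) + (\<Sum>k\<in>set (concat cs). g k)"
  using assms by (simp add: sum.union_disjoint)

lemma min_sum_le:
  assumes "distinct (concat cs)" "\<And>c. c \<in> set cs \<Longrightarrow> inj_on x (set c)"
  shows "min_sum cs \<le> (\<Sum>k\<in>set (concat cs). x k)
    \<and> ((\<Sum>k\<in>set (concat cs). x k) = min_sum cs \<longrightarrow> (\<forall>c\<in>set cs. x ` set c = {..<length c}))"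
  using assms
proof (induction cs)
  case (Cons c cs)
  have inj: "inj_on x (set c)" using Cons.prems(2)[of c] by simp
  have c: "(\<Sum>k\<in>set c. x k) = \<Sum>(x ` set c)" "card (x ` set c) = length c"
    using inj Cons.prems(1) by (auto simp: sum.reindex card_image distinct_card)
  have IH: "min_sum cs \<le> (\<Sum>k\<in>set (concat cs). x k)"
      "(\<Sum>k\<in>set (concat cs). x k) = min_sum cs \<Longrightarrow> \<forall>c\<in>set cs. x ` set c = {..<length c}"
    using Cons by auto
  have A: "\<Sum>{..<length c} \<le> \<Sum>(x ` set c)" "\<Sum>(x ` set c) = \<Sum>{..<length c} \<Longrightarrow> x ` set c = {..<length c}"
    using sum_nat_set_ge[of "x ` set c"] c(2) by auto
  have ms: "min_sum (c # cs) = \<Sum>{..<length c} + min_sum cs" by (simp add: min_sum_def)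
  show ?case unfolding sum_concat_Cons[OF Cons.prems(1)] c(1) ms
  proof (intro conjI impI)
    assume "\<Sum>(x ` set c) + (\<Sum>k\<in>set (concat cs). x k) = \<Sum>{..<length c} + min_sum cs"
    hence "\<Sum>(x ` set c) = \<Sum>{..<length c}" "(\<Sum>k\<in>set (concat cs). x k) = min_sum cs"
      using IH(1) A(1) by linarith+
    thus "\<forall>d\<in>set (c # cs). x ` set d = {..<length d}" using IH(2) A(2) by auto
  qed (use IH(1) A(1) in linarith)
qed (simp add: min_sum_def)

lemma alternating_inj_on: "alternating A T \<Longrightarrow> T x \<noteq> 0 \<Longrightarrow> inj_on x A"
proof (rule inj_onI, rule ccontr)
  fix k l assume *: "alternating A T" "T x \<noteq> 0" "k \<in> A" "l \<in> A" "x k = x l" "k \<noteq> l"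
  have "x \<circ> Transposition.transpose k l = x"
    using *(5) by (auto simp: fun_eq_iff Transposition.transpose_def)
  hence "P_op k l T x = T x" by (simp add: P_op_def)
  thus False using alternatingD[OF *(1,3,4,6)] *(2) by (simp add: pointwise)
qed

lemma alternating_min_sum:
  assumes "distinct (concat cs)" "\<And>c. c \<in> set cs \<Longrightarrow> alternating (set c) T" "T x \<noteq> 0"
  shows "min_sum cs \<le> (\<Sum>k\<in>set (concat cs). x k)"
    and "(\<Sum>k\<in>set (concat cs). x k) = min_sum cs \<Longrightarrow> c \<in> set cs \<Longrightarrow> x ` set c = {..<length c}"
proof -
  have "inj_on x (set c)" if "c \<in> set cs" for c
    using assms(2)[OF that] assms(3) by (rule alternating_inj_on[of "set c" T x])
  from min_sum_le[OF assms(1) this]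
  show "min_sum cs \<le> (\<Sum>k\<in>set (concat cs). x k)"
    and "(\<Sum>k\<in>set (concat cs). x k) = min_sum cs \<Longrightarrow> c \<in> set cs \<Longrightarrow> x ` set c = {..<length c}"
    by blast+
qed

text \<open>Exchanges inside the columns lead from x to z, each one reducing the set of positions
  where the words differ, and the value of T only changes its sign.\<close>

lemma alternating_zero_permute:
  assumes dist: "distinct (concat cs)" and alt: "\<And>c. c \<in> set cs \<Longrightarrow> alternating (set c) T"
    and z: "\<And>c. c \<in> set cs \<Longrightarrow> inj_on z (set c)" "T z = 0"
    and x: "\<And>c. c \<in> set cs \<Longrightarrow> x ` set c = z ` set c" "\<And>k. k \<notin> set (concat cs) \<Longrightarrow> x k = z k"
  shows "T x = 0"
  using x
proof (induction "card {k. x k \<noteq> z k}" arbitrary: x rule: less_induct)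
  case less
  have fin: "finite {k. x k \<noteq> z k}"
    by (rule finite_subset[of _ "set (concat cs)"]) (use less.prems(2) in auto)
  show ?case
  proof (cases "x = z")
    case False
    then obtain k where k: "x k \<noteq> z k" by (auto simp: fun_eq_iff)
    then obtain c where c: "c \<in> set cs" "k \<in> set c" using less.prems(2)[of k] by (auto simp: set_concat)
    have "z k \<in> x ` set c" using less.prems(1)[OF c(1)] c(2) by simp
    then obtain l where l: "l \<in> set c" "x l = z k" by auto
    have kl: "k \<noteq> l" using k l by auto
    define y where "y = x \<circ> Transposition.transpose k l"
    have "{m. y m \<noteq> z m} \<subset> {m. x m \<noteq> z m}"
    proof
      show "{m. y m \<noteq> z m} \<subseteq> {m. x m \<noteq> z m}"
      proof
        fix m assume m: "m \<in> {m. y m \<noteq> z m}"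
        consider "m = k" | "m = l" | "m \<noteq> k" "m \<noteq> l" by blast
        thus "m \<in> {m. x m \<noteq> z m}"
        proof cases
          case 2 thus ?thesis using l kl z(1)[OF c(1)] c(2) by (auto simp: inj_on_def)
        qed (use m k in \<open>auto simp: y_def\<close>)
      qed
      have "k \<in> {m. x m \<noteq> z m}" "k \<notin> {m. y m \<noteq> z m}" using k l by (auto simp: y_def)
      thus "{m. y m \<noteq> z m} \<noteq> {m. x m \<noteq> z m}" by blast
    qed
    hence "card {m. y m \<noteq> z m} < card {m. x m \<noteq> z m}" using fin by (intro psubset_card_mono)
    hence "T y = 0"
    proof (rule less.hyps)
      fix d assume d: "d \<in> set cs"
      have "k \<in> set d \<longleftrightarrow> l \<in> set d"
      proof (cases "d = c")
        case False
        hence "set d \<inter> set c = {}" using dist c(1) d by (auto simp: distinct_concat_iff)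
        thus ?thesis using c(2) l(1) by auto
      qed (use c l in auto)
      hence "y ` set d = x ` set d" unfolding y_def image_comp[symmetric] by (simp add: transpose_image_same)
      thus "y ` set d = z ` set d" using less.prems(1)[OF d] by simp
    next
      fix m assume m: "m \<notin> set (concat cs)"
      hence "m \<noteq> k" "m \<noteq> l" using c l by (auto simp: set_concat)
      thus "y m = z m" using less.prems(2)[OF m] by (simp add: y_def)
    qed
    moreover have "T y = - T x"
      using alternatingD[OF alt[OF c(1)] c(2) l(1) kl] by (auto simp: y_def P_op_def fun_eq_iff pointwise)
    ultimately show ?thesis by simp
  qed (use z(2) in simp)
qed

subsection \<open>Tensors that are alternating in the columns\<close>

lemma PS_support: "PS k B T x \<noteq> 0 \<Longrightarrow> \<exists>l\<in>B. T (x \<circ> Transposition.transpose k l) \<noteq> 0"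
  by (auto simp: PS_def sum_fun_apply P_op_def elim: sum.not_neutral_contains_not_neutral)

lemma Ant_support:
  assumes "\<And>x. T x \<noteq> 0 \<Longrightarrow> R x"
    and "\<And>k l x. k \<in> set xs \<Longrightarrow> l \<in> set xs \<Longrightarrow> R (x \<circ> Transposition.transpose k l) \<Longrightarrow> R x" "Ant xs T x \<noteq> 0"
  shows "R x"
  using assms(2,3)
proof (induction xs arbitrary: x)
  case (Cons k ks)
  have IH: "R x" if "Ant ks T x \<noteq> 0" for x using Cons that by auto
  have "Ant ks T x \<noteq> 0 \<or> PS k (set ks) (Ant ks T) x \<noteq> 0" using Cons.prems(2) by (auto simp: pointwise)
  thus ?case
  proof
    assume "PS k (set ks) (Ant ks T) x \<noteq> 0"
    then obtain l where l: "l \<in> set ks" "Ant ks T (x \<circ> Transposition.transpose k l) \<noteq> 0"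
      using PS_support by blast
    show ?thesis by (rule Cons.prems(1)[OF _ _ IH[OF l(2)]]) (use l in auto)
  qed (rule IH)
qed (use assms(1) in auto)

text \<open>As z has no repetitions on \<open>xs\<close>, any permutation other than the identity
  moves a letter of z to a place where T requires a different one.\<close>

lemma Ant_at_injective:
  assumes "\<And>x. T x \<noteq> 0 \<Longrightarrow> \<forall>k\<in>set xs. x k = z k" "inj_on z (set xs)" "distinct xs"
  shows "Ant xs T z = T z"
  using assms
proof (induction xs)
  case (Cons k ks)
  have IH: "Ant ks T z = T z" by (rule Cons.IH) (use Cons.prems in auto)
  have "P_op k l (Ant ks T) z = 0" if l: "l \<in> set ks" for l
  proof (rule ccontr)
    assume "P_op k l (Ant ks T) z \<noteq> 0"
    hence "Ant ks T (z \<circ> Transposition.transpose k l) \<noteq> 0" by (simp add: P_op_def)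
    hence "(z \<circ> Transposition.transpose k l) k = z k"
    proof (rule Ant_support[rotated 2, where R = "\<lambda>x. x k = z k"])
      fix i j x assume "i \<in> set ks" "j \<in> set ks" "(x \<circ> Transposition.transpose i j) k = z k"
      moreover have "k \<notin> set ks" using Cons.prems by simp
      ultimately show "x k = z k" by (auto simp: Transposition.transpose_def split: if_splits)
    qed (use Cons.prems in auto)
    thus False using l Cons.prems by (auto simp: inj_on_def)
  qed
  thus ?case by (simp add: pointwise PS_def IH)
qed simp

definition delta :: "(nat \<Rightarrow> nat) \<Rightarrow> tensor" where
  "delta z = (\<lambda>x. if x = z then 1 else 0)"

text \<open>For z injective on the columns, this is a product of wedges of basis vectors, one wedge
  for each column. For a \<open>row_word\<close> it serves as the highest weight vector.\<close>

definition col_tensor :: "nat list list \<Rightarrow> (nat \<Rightarrow> nat) \<Rightarrow> tensor" where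
  "col_tensor cs z = foldr Ant cs (delta z)"

lemma col_tensor_Cons: "col_tensor (c # cs) z = Ant c (col_tensor cs z)"
  by (simp add: col_tensor_def)

lemma alternating_col_tensor:
  "distinct (concat cs) \<Longrightarrow> c \<in> set cs \<Longrightarrow> alternating (set c) (col_tensor cs z)"
proof (induction cs)
  case (Cons d cs)
  show ?case
  proof (cases "c = d")
    case False
    hence c: "c \<in> set cs" using Cons.prems by simp
    hence "set c \<inter> set d = {}" using Cons.prems by (auto simp: set_concat)
    moreover have "alternating (set c) (col_tensor cs z)" using Cons c by simp
    ultimately show ?thesis unfolding col_tensor_Cons
      by (intro commutes_on_alternating[OF commutes_on_Ant])
  qed (use Cons.prems in \<open>simp add: col_tensor_Cons alternating_Ant\<close>)
qed simp

lemma sum_transpose: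
  fixes x :: "nat \<Rightarrow> nat"
  assumes "k \<in> A \<longleftrightarrow> l \<in> A" shows "(\<Sum>m\<in>A. (x \<circ> Transposition.transpose k l) m) = (\<Sum>m\<in>A. x m)"
proof -
  have "(\<Sum>m\<in>A. (x \<circ> Transposition.transpose k l) m) = (\<Sum>m\<in>Transposition.transpose k l ` A. x m)"
    by (subst sum.reindex) (auto intro: inj_on_subset[OF inj_transpose])
  thus ?thesis using assms by (simp add: transpose_image_same)
qed

lemma col_tensor_support:
  assumes "col_tensor cs z x \<noteq> 0" "set (concat cs) \<subseteq> A"
  shows "(\<forall>k. k \<notin> A \<longrightarrow> x k = z k) \<and> (\<Sum>k\<in>A. x k) = (\<Sum>k\<in>A. z k)"
  using assms
proof (induction cs arbitrary: x)
  case Nil thus ?case by (auto simp: col_tensor_def delta_def split: if_splits)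
next
  case (Cons c cs)
  have c: "set c \<subseteq> A" using Cons.prems by auto
  show ?case
  proof (rule Ant_support[of "col_tensor cs z"
        "\<lambda>x. (\<forall>k. k \<notin> A \<longrightarrow> x k = z k) \<and> (\<Sum>k\<in>A. x k) = (\<Sum>k\<in>A. z k)" c])
    fix k l x assume kl: "k \<in> set c" "l \<in> set c"
      and *: "(\<forall>m. m \<notin> A \<longrightarrow> (x \<circ> Transposition.transpose k l) m = z m) \<and>
        (\<Sum>m\<in>A. (x \<circ> Transposition.transpose k l) m) = (\<Sum>m\<in>A. z m)"
    have "x m = z m" if m: "m \<notin> A" for m
    proof -
      have "m \<noteq> k" "m \<noteq> l" using m kl c by auto
      moreover have "(x \<circ> Transposition.transpose k l) m = z m" using * m by blast
      ultimately show ?thesis by simp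
    qed
    moreover have "(\<Sum>m\<in>A. x m) = (\<Sum>m\<in>A. z m)" using * kl c by (simp only: sum_transpose subset_iff)
    ultimately show "(\<forall>m. m \<notin> A \<longrightarrow> x m = z m) \<and> (\<Sum>m\<in>A. x m) = (\<Sum>m\<in>A. z m)" by blast
  qed (use Cons in \<open>auto simp: col_tensor_Cons\<close>)
qed

lemma col_tensor_at:
  assumes "distinct (concat cs)" "\<And>c. c \<in> set cs \<Longrightarrow> inj_on z (set c)"
  shows "col_tensor cs z z = 1"
  using assms
proof (induction cs)
  case Nil thus ?case by (simp add: col_tensor_def delta_def)
next
  case (Cons c cs)
  have "Ant c (col_tensor cs z) z = col_tensor cs z z"
  proof (rule Ant_at_injective)
    show "\<forall>k\<in>set c. x k = z k" if "col_tensor cs z x \<noteq> 0" for x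
      using col_tensor_support[OF that subset_refl] Cons.prems(1) by auto
  qed (use Cons.prems in auto)
  thus ?case using Cons by (simp add: col_tensor_Cons)
qed

section \<open>Raising operators\<close>

definition replace_op :: "nat set \<Rightarrow> nat \<Rightarrow> nat \<Rightarrow> tensor \<Rightarrow> tensor" where
  "replace_op A a b T = (\<lambda>x. \<Sum>j\<in>{j\<in>A. x j = b}. T (x(j := a)))"

text \<open>On coordinates, \<open>replace_op A a b\<close> is the action of the elementary matrix
  E_ba: the coefficient at letter b is read from letter a. For b < a this matrix is strictly upper
  triangular.\<close>

definition raised :: "nat set \<Rightarrow> tensor \<Rightarrow> bool" where
  "raised A T \<longleftrightarrow> (\<forall>a b. b < a \<longrightarrow> replace_op A a b T = 0)"

lemma lin_replace_op: "lin (replace_op A a b)"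
  by (rule linI) (auto simp: replace_op_def pointwise sum.distrib sum_distrib_left)

lemma commutes_on_replace_op: "commutes_on A (replace_op A a b)"
  unfolding commutes_on_def
proof (intro conjI ballI allI lin_replace_op ext)
  fix k l T and x :: "nat \<Rightarrow> nat" assume kl: "k \<in> A" "l \<in> A"
  let ?t = "Transposition.transpose k l"
  have "replace_op A a b (P_op k l T) x = (\<Sum>j\<in>{j\<in>A. x j = b}. T ((x \<circ> ?t)(?t j := a)))"
    unfolding replace_op_def P_op_def
    by (intro sum.cong refl arg_cong[of _ _ T]) (auto simp: fun_eq_iff Transposition.transpose_def)
  also have "\<dots> = (\<Sum>j\<in>?t ` {j\<in>A. x j = b}. T ((x \<circ> ?t)(j := a)))"
    by (subst sum.reindex) (auto intro: inj_on_subset[OF inj_transpose])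
  also have "?t ` {j\<in>A. x j = b} = {j\<in>A. (x \<circ> ?t) j = b}"
  proof
    show "{j\<in>A. (x \<circ> ?t) j = b} \<subseteq> ?t ` {j\<in>A. x j = b}"
    proof
      fix j assume "j \<in> {j\<in>A. (x \<circ> ?t) j = b}"
      hence "?t j \<in> {j\<in>A. x j = b}" "j = ?t (?t j)"
        using kl by (auto simp: Transposition.transpose_def)
      thus "j \<in> ?t ` {j\<in>A. x j = b}" by blast
    qed
  qed (use kl in \<open>auto simp: Transposition.transpose_def\<close>)
  finally show "replace_op A a b (P_op k l T) x = P_op k l (replace_op A a b T) x"
    by (simp only: replace_op_def P_op_def)
qed

lemma raised_row_sum_op:
  assumes "raised A T" "k \<in> A" "B \<subseteq> A" shows "raised A (row_sum_op d B k T)"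
  unfolding raised_def
proof (intro allI impI)
  fix a b :: nat assume "b < a"
  hence 0: "replace_op A a b T = 0" using assms(1) by (simp add: raised_def)
  have "replace_op A a b (PS k B T) = 0"
    using commutes_on_PS_apply[OF commutes_on_replace_op assms(2,3)] by (simp add: 0 lin_zero[OF lin_PS])
  thus "replace_op A a b (row_sum_op d B k T) = 0"
    by (simp add: row_sum_op_def lin_diff[OF lin_replace_op] lin_scale[OF lin_replace_op] 0)
qed

lemma sum_fun_upd_nat:
  fixes x :: "nat \<Rightarrow> nat"
  assumes "finite A" "j \<in> A" shows "(\<Sum>k\<in>A. (x(j := a)) k) + x j = (\<Sum>k\<in>A. x k) + a"
  using sum.remove[OF assms, of x] sum.remove[OF assms, of "x(j := a)"]
  by (simp add: sum.cong[of "A - {j}" "A - {j}" "x(j := a)" x])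

text \<open>A raising operator lowers the letter sum and preserves alternation, but below
  \<open>min_sum\<close> there are no tensors alternating in the columns.\<close>

lemma raised_min_sum:
  assumes dist: "distinct (concat cs)" and alt: "\<And>c. c \<in> set cs \<Longrightarrow> alternating (set c) T"
    and min: "\<And>x. T x \<noteq> 0 \<Longrightarrow> (\<Sum>k\<in>set (concat cs). x k) = min_sum cs"
  shows "raised (set (concat cs)) T"
  unfolding raised_def
proof (intro allI impI ext, rule ccontr)
  let ?A = "set (concat cs)"
  fix a b :: nat and y assume "b < a" and *: "replace_op ?A a b T y \<noteq> 0 y"
  have alt': "alternating (set c) (replace_op ?A a b T)" if "c \<in> set cs" for c
    by (rule commutes_on_alternating[OF commutes_on_mono[OF commutes_on_replace_op] alt[OF that]])
      (use that in \<open>auto simp: set_concat\<close>)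
  have ge: "min_sum cs \<le> (\<Sum>k\<in>?A. y k)"
    using alternating_min_sum(1)[OF dist alt'] * by (simp add: pointwise)
  from * obtain j where j: "j \<in> ?A" "y j = b" "T (y(j := a)) \<noteq> 0"
    by (auto simp: replace_op_def pointwise elim: sum.not_neutral_contains_not_neutral)
  have "(\<Sum>k\<in>?A. (y(j := a)) k) + b = (\<Sum>k\<in>?A. y k) + a"
    using sum_fun_upd_nat[of ?A j y a] j by simp
  thus False using min[OF j(3)] ge \<open>b < a\<close> by simp
qed

subsection \<open>Highest weight vectors among the tensors satisfying the column relations\<close>

text \<open>The sum of all exchanges acts like the Casimir element of \<open>gl\<^sub>N\<close>.\<close>

definition casimir :: "nat set \<Rightarrow> tensor \<Rightarrow> tensor" where
  "casimir A T = (\<Sum>k\<in>A. PS k (A - {k}) T)"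

definition equal_pairs :: "nat set \<Rightarrow> (nat \<Rightarrow> nat) \<Rightarrow> nat" where
  "equal_pairs A x = (\<Sum>k\<in>A. card {l\<in>A - {k}. x l = x k})"

lemma transpose_upd: "k \<noteq> l \<Longrightarrow> x \<circ> Transposition.transpose k l = x(k := x l, l := x k)"
  by (auto simp: fun_eq_iff Transposition.transpose_def)

text \<open>This is the vanishing of the raising operator from the letter \<open>x k\<close> to b,
  evaluated at the word with b in place k: that place contributes \<open>T x\<close>, and the places
  where x has b contribute the exchanges.\<close>

lemma raised_lower_sum:
  assumes "raised A T" "finite A" "k \<in> A" "b < x k"
  shows "(\<Sum>l\<in>{l\<in>A. x l = b}. T (x \<circ> Transposition.transpose k l)) = - T x"
proof -
  let ?y = "x(k := b)" and ?B = "{l\<in>A. x l = b}"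
  have eq: "{j\<in>A. ?y j = b} = insert k ?B" using assms(3) by auto
  have k: "k \<notin> ?B" "finite ?B" using assms by auto
  have "replace_op A (x k) b T ?y = 0" using assms(1,4) by (simp add: raised_def pointwise)
  hence "T (?y(k := x k)) + (\<Sum>l\<in>?B. T (?y(l := x k))) = 0"
    unfolding replace_op_def eq using k by (simp only: sum.insert not_False_eq_True)
  moreover have "(\<Sum>l\<in>?B. T (?y(l := x k))) = (\<Sum>l\<in>?B. T (x \<circ> Transposition.transpose k l))"
  proof (rule sum.cong)
    fix l assume l: "l \<in> ?B"
    hence "k \<noteq> l" using k by auto
    thus "T (?y(l := x k)) = T (x \<circ> Transposition.transpose k l)" using l by (simp add: transpose_upd)
  qed simp
  ultimately show ?thesis by (simp add: eq_neg_iff_add_eq_0 add.commute)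
qed

text \<open>Exchanges of equal letters fix x. For fixed k, each of the \<open>x k\<close> letters
  below \<open>x k\<close> contributes \<open>- T x\<close> by \<open>raised_lower_sum\<close>. The
  exchanges with larger letters are the same pairs seen from the other side, whence the factor
  2.\<close>

lemma casimir_raised:
  assumes "raised A T" "finite A"
  shows "casimir A T x = (of_nat (equal_pairs A x) - 2 * of_nat (\<Sum>k\<in>A. x k)) * T x"
proof -
  define E where "E k = {l\<in>A - {k}. x l = x k}" for k
  define L where "L k = {l\<in>A. x l < x k}" for k
  define G where "G k = {l\<in>A. x k < x l}" for k
  let ?f = "\<lambda>k l. T (x \<circ> Transposition.transpose k l)"
  have split: "PS k (A - {k}) T x = (\<Sum>l\<in>E k. ?f k l) + (\<Sum>l\<in>L k. ?f k l) + (\<Sum>l\<in>G k. ?f k l)" for k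
  proof -
    have "A - {k} = (E k \<union> L k) \<union> G k" by (auto simp: E_def L_def G_def)
    moreover have "E k \<inter> L k = {}" "(E k \<union> L k) \<inter> G k = {}" "finite (E k)" "finite (L k)" "finite (G k)"
      using assms(2) by (auto simp: E_def L_def G_def)
    ultimately show ?thesis by (simp add: PS_def sum_fun_apply P_op_def sum.union_disjoint plus_fun_apply)
  qed
  have E: "(\<Sum>l\<in>E k. ?f k l) = of_nat (card (E k)) * T x" for k
  proof -
    have "?f k l = T x" if "l \<in> E k" for l
    proof -
      have "x l = x k" using that by (simp add: E_def)
      hence "x \<circ> Transposition.transpose k l = x"
        by (auto simp: fun_eq_iff Transposition.transpose_def)
      thus ?thesis by simp
    qed
    thus ?thesis by simp
  qed
  have L: "(\<Sum>l\<in>L k. ?f k l) = - of_nat (x k) * T x" if k: "k \<in> A" for k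
  proof -
    have "(\<Sum>l\<in>L k. ?f k l) = (\<Sum>b<x k. \<Sum>l\<in>{l\<in>L k. x l = b}. ?f k l)"
      using assms(2) by (intro sum.group[symmetric]) (auto simp: L_def)
    also have "\<dots> = (\<Sum>b<x k. - T x)"
    proof (rule sum.cong)
      fix b assume b: "b \<in> {..<x k}"
      hence "{l\<in>L k. x l = b} = {l\<in>A. x l = b}" by (auto simp: L_def)
      thus "(\<Sum>l\<in>{l\<in>L k. x l = b}. ?f k l) = - T x"
        using raised_lower_sum[OF assms k, of b x] b by simp
    qed simp
    finally show ?thesis by simp
  qed
  have G: "(\<Sum>k\<in>A. \<Sum>l\<in>G k. ?f k l) = (\<Sum>k\<in>A. \<Sum>l\<in>L k. ?f k l)"
  proof -
    have "(\<Sum>k\<in>A. \<Sum>l\<in>G k. ?f k l) = (\<Sum>k\<in>A. \<Sum>l\<in>A. if x k < x l then ?f k l else 0)"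
      unfolding G_def by (rule sum.cong, rule refl) (simp add: sum.inter_filter assms(2))
    also have "\<dots> = (\<Sum>l\<in>A. \<Sum>k\<in>A. if x k < x l then ?f k l else 0)" by (rule sum.swap)
    also have "\<dots> = (\<Sum>l\<in>A. \<Sum>k\<in>A. if x k < x l then ?f l k else 0)"
      by (intro sum.cong refl) (simp add: transpose_commute)
    also have "\<dots> = (\<Sum>k\<in>A. \<Sum>l\<in>L k. ?f k l)"
      unfolding L_def by (rule sum.cong, rule refl) (simp add: sum.inter_filter assms(2))
    finally show ?thesis .
  qed
  have "casimir A T x = (\<Sum>k\<in>A. \<Sum>l\<in>E k. ?f k l) + 2 * (\<Sum>k\<in>A. \<Sum>l\<in>L k. ?f k l)"
    by (simp add: casimir_def sum_fun_apply split sum.distrib G)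
  also have "(\<Sum>k\<in>A. \<Sum>l\<in>E k. ?f k l) = of_nat (equal_pairs A x) * T x"
  proof -
    have "equal_pairs A x = (\<Sum>k\<in>A. card (E k))" by (simp only: equal_pairs_def E_def)
    thus ?thesis by (simp only: E of_nat_sum sum_distrib_right)
  qed
  also have "(\<Sum>k\<in>A. \<Sum>l\<in>L k. ?f k l) = (\<Sum>k\<in>A. - of_nat (x k) * T x)"
    by (rule sum.cong[OF refl L])
  also have "\<dots> = - of_nat (\<Sum>k\<in>A. x k) * T x" by (simp add: sum_distrib_right sum_negf)
  finally show ?thesis by (simp add: algebra_simps)
qed

text \<open>Each position of a later column can share its letter with at most one position of c; as
  pairs are ordered, it counts twice.\<close>

primrec pair_bound :: "nat list list \<Rightarrow> nat" where
  "pair_bound [] = 0"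
| "pair_bound (c # cs) = 2 * length (concat cs) + pair_bound cs"

lemma equal_pairs_le:
  assumes "distinct (concat cs)" "\<And>c. c \<in> set cs \<Longrightarrow> inj_on x (set c)"
  shows "equal_pairs (set (concat cs)) x \<le> pair_bound cs"
  using assms
proof (induction cs)
  case (Cons c cs)
  let ?C = "set c" and ?B = "set (concat cs)"
  have inj: "inj_on x ?C" using Cons.prems(2)[of c] by simp
  have disj: "?C \<inter> ?B = {}" using Cons.prems(1) by auto
  have le1: "card {k\<in>?C. x k = x l} \<le> 1" for l
  proof -
    have "card {k\<in>?C. x k = x l} \<le> Suc 0"
      by (subst card_le_Suc0_iff_eq) (use inj in \<open>auto simp: inj_on_def\<close>)
    thus ?thesis by simp
  qed
  have C: "card {l\<in>set (concat (c # cs)) - {k}. x l = x k} = card {l\<in>?B. x l = x k}" if "k \<in> ?C" for k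
  proof -
    have "{l\<in>set (concat (c # cs)) - {k}. x l = x k} = {l\<in>?B. x l = x k}"
      using that inj disj by (auto simp: inj_on_def)
    thus ?thesis by simp
  qed
  have B: "card {l\<in>set (concat (c # cs)) - {k}. x l = x k}
      = card {l\<in>?C. x l = x k} + card {l\<in>?B - {k}. x l = x k}" if "k \<in> ?B" for k
  proof -
    have "{l\<in>set (concat (c # cs)) - {k}. x l = x k} = {l\<in>?C. x l = x k} \<union> {l\<in>?B - {k}. x l = x k}"
      using that disj by auto
    thus ?thesis using disj by (subst card_Un_disjoint[symmetric]) auto
  qed
  have swap: "(\<Sum>k\<in>?C. card {l\<in>?B. x l = x k}) = (\<Sum>l\<in>?B. card {k\<in>?C. x k = x l})"
  proof -
    have "(\<Sum>k\<in>?C. card {l\<in>?B. x l = x k}) = (\<Sum>k\<in>?C. \<Sum>l\<in>?B. if x l = x k then 1 else 0)"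
      by (simp only: card_eq_sum sum.inter_filter finite_set)
    also have "\<dots> = (\<Sum>l\<in>?B. \<Sum>k\<in>?C. if x l = x k then 1 else 0)" by (rule sum.swap)
    also have "\<dots> = (\<Sum>l\<in>?B. card {k\<in>?C. x k = x l})"
      by (simp only: card_eq_sum sum.inter_filter finite_set eq_commute)
    finally show ?thesis .
  qed
  have len: "(\<Sum>l\<in>?B. card {k\<in>?C. x k = x l}) \<le> length (concat cs)"
  proof -
    have "(\<Sum>l\<in>?B. card {k\<in>?C. x k = x l}) \<le> (\<Sum>l\<in>?B. 1)" by (intro sum_mono le1)
    thus ?thesis using Cons.prems(1) by (simp add: distinct_card)
  qed
  have "equal_pairs (set (concat (c # cs))) x
      = (\<Sum>k\<in>?C. card {l\<in>?B. x l = x k}) + ((\<Sum>k\<in>?B. card {l\<in>?C. x l = x k}) + equal_pairs ?B x)"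
    unfolding equal_pairs_def sum_concat_Cons[OF Cons.prems(1)]
    by (simp only: C B sum.distrib cong: sum.cong)
  also have "\<dots> \<le> 2 * length (concat cs) + pair_bound cs" using len swap Cons by simp
  finally show ?case by simp
qed (simp add: equal_pairs_def)

lemma sum_constant_tensor: "(\<Sum>k\<in>A. T) = tscale (of_nat (card A)) T"
  by (simp add: pointwise)

text \<open>Within a column of length p the exchanges add up to -p (p - 1), and each position of a
  later column contributes 1 for c, once in either order. For a tableau the eigenvalue is twice the
  sum of the contents.\<close>

lemma casimir_garnir:
  assumes "garnir cs T" "distinct (concat cs)"
  shows "casimir (set (concat cs)) T = tscale (of_nat (pair_bound cs) - 2 * of_nat (min_sum cs)) T"
  using assms
proof (induction cs)
  case Nil thus ?case by (simp add: casimir_def min_sum_def pointwise)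
next
  case (Cons c cs)
  let ?C = "set c" and ?B = "set (concat cs)"
  have disj: "?C \<inter> ?B = {}" using Cons.prems(2) by auto
  have alt: "alternating ?C T" and ex: "\<And>r. r \<in> ?B \<Longrightarrow> PS r ?C T = T" using Cons.prems(1) by auto
  have cC: "PS k (set (concat (c # cs)) - {k}) T = PS k (?C - {k}) T + PS k ?B T" if "k \<in> ?C" for k
  proof -
    have "set (concat (c # cs)) - {k} = (?C - {k}) \<union> ?B" using that disj by auto
    thus ?thesis using disj by (simp only:) (intro PS_union, auto)
  qed
  have cB: "PS k (set (concat (c # cs)) - {k}) T = PS k ?C T + PS k (?B - {k}) T" if "k \<in> ?B" for k
  proof -
    have "set (concat (c # cs)) - {k} = ?C \<union> (?B - {k})" using that disj by auto
    thus ?thesis using disj by (simp only:) (intro PS_union, auto)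
  qed
  have inner: "(\<Sum>k\<in>?C. PS k (?C - {k}) T) = tscale (- 2 * of_nat (\<Sum>{..<length c})) T"
  proof -
    have "PS k (?C - {k}) T = tscale (- (of_nat (length c) - 1)) T" if k: "k \<in> ?C" for k
    proof -
      have "PS k (?C - {k}) T = (\<Sum>l\<in>?C - {k}. - T)" unfolding PS_def
        using k by (intro sum.cong refl alternatingD[OF alt]) auto
      moreover have "Suc (card (?C - {k})) = length c"
        using k Cons.prems(2) card_Suc_Diff1[of ?C k] by (simp add: distinct_card)
      hence "of_nat (card (?C - {k})) = of_nat (length c) - (1 :: complex)" by (metis add_diff_cancel_left' of_nat_Suc)
      ultimately show ?thesis by (simp only: sum_constant_tensor) (simp add: pointwise algebra_simps)
    qed
    hence "(\<Sum>k\<in>?C. PS k (?C - {k}) T) = (\<Sum>k\<in>?C. tscale (- (of_nat (length c) - 1)) T)"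
      by (intro sum.cong refl)
    also have "\<dots> = tscale (- (of_nat (length c) * (of_nat (length c) - 1))) T"
      using Cons.prems(2) by (simp only: sum_constant_tensor) (simp add: pointwise distinct_card algebra_simps)
    finally have "(\<Sum>k\<in>?C. PS k (?C - {k}) T) = tscale (- (of_nat (length c) * (of_nat (length c) - 1))) T" .
    moreover have "2 * of_nat (\<Sum>{..<m}) = of_nat m * (of_nat m - 1 :: complex)" for m
      by (induction m) (auto simp: lessThan_Suc algebra_simps)
    ultimately show ?thesis by simp
  qed
  have outer: "(\<Sum>k\<in>?B. PS k ?C T) = tscale (of_nat (length (concat cs))) T"
    using Cons.prems(2) by (simp add: ex pointwise distinct_card)
  have outer': "(\<Sum>k\<in>?C. PS k ?B T) = (\<Sum>k\<in>?B. PS k ?C T)"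
    unfolding PS_def by (subst sum.swap) (simp add: P_sym)
  have "casimir (set (concat (c # cs))) T
      = (\<Sum>k\<in>?C. PS k (set (concat (c # cs)) - {k}) T) + (\<Sum>k\<in>?B. PS k (set (concat (c # cs)) - {k}) T)"
    unfolding casimir_def by (rule sum_concat_Cons[OF Cons.prems(2)])
  also have "\<dots> = (\<Sum>k\<in>?C. PS k (?C - {k}) T + PS k ?B T) + (\<Sum>k\<in>?B. PS k ?C T + PS k (?B - {k}) T)"
    by (intro arg_cong2[of _ _ _ _ "(+)"] sum.cong refl cC cB)
  also have "\<dots> = (\<Sum>k\<in>?C. PS k (?C - {k}) T) + (\<Sum>k\<in>?B. PS k ?C T)
      + ((\<Sum>k\<in>?B. PS k ?C T) + casimir ?B T)"
    by (simp only: sum.distrib outer' casimir_def)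
  also have "casimir ?B T = tscale (of_nat (pair_bound cs) - 2 * of_nat (min_sum cs)) T"
    using Cons by auto
  finally show ?case unfolding inner outer
    by (simp add: pointwise min_sum_def algebra_simps)
qed

text \<open>Comparing the two Casimir values at x: \<open>equal_pairs\<close> is at most
  \<open>pair_bound\<close> and the letter sum at least \<open>min_sum\<close>, so equality of the
  values forces both bounds to be attained.\<close>

lemma raised_garnir_min_sum:
  assumes "garnir cs T" "distinct (concat cs)" "raised (set (concat cs)) T" "T x \<noteq> 0"
  shows "(\<Sum>k\<in>set (concat cs). x k) = min_sum cs"
proof -
  let ?S = "\<Sum>k\<in>set (concat cs). x k"
  have alt: "alternating (set c) T" if "c \<in> set cs" for c using garnir_alternating[OF assms(1) that] .
  have "(of_nat (equal_pairs (set (concat cs)) x) - 2 * of_nat ?S) * T x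
      = (of_nat (pair_bound cs) - 2 * of_nat (min_sum cs)) * T x"
    using fun_cong[OF casimir_garnir[OF assms(1,2)], of x]
    by (simp only: casimir_raised[OF assms(3) finite_set] tscale_apply)
  hence h: "of_nat (equal_pairs (set (concat cs)) x) - 2 * of_nat ?S
      = (of_nat (pair_bound cs) - 2 * of_nat (min_sum cs) :: complex)"
    using assms(4) mult_cancel_right by blast
  have aux: "a - 2 * b = c - 2 * d \<Longrightarrow> a + 2 * d = c + 2 * b" for a b c d :: complex
  proof -
    assume e: "a - 2 * b = c - 2 * d"
    have "a + 2 * d = (a - 2 * b) + 2 * b + 2 * d" by simp
    thus ?thesis by (simp add: e)
  qed
  have "of_nat (equal_pairs (set (concat cs)) x + 2 * min_sum cs) = (of_nat (pair_bound cs + 2 * ?S) :: complex)"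
    using aux[OF h] by (simp only: of_nat_add of_nat_mult of_nat_numeral)
  hence "equal_pairs (set (concat cs)) x + 2 * min_sum cs = pair_bound cs + 2 * ?S"
    by (simp only: of_nat_eq_iff)
  moreover have "equal_pairs (set (concat cs)) x \<le> pair_bound cs"
    by (rule equal_pairs_le[OF assms(2)]) (rule alternating_inj_on[of _ T x], rule alt, use assms(4) in auto)
  moreover have "min_sum cs \<le> ?S" by (rule alternating_min_sum(1)[OF assms(2) alt assms(4)])
  ultimately show ?thesis by linarith
qed

definition row_word :: "nat list list \<Rightarrow> (nat \<Rightarrow> nat) \<Rightarrow> bool" where
  "row_word cs z \<longleftrightarrow> (\<forall>c\<in>set cs. \<forall>i<length c. z (c ! i) = i)"

lemma row_word_image:
  assumes "row_word cs z" "c \<in> set cs"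
  shows "z ` set c = {..<length c}" "inj_on z (set c)"
proof -
  have z: "z (c ! i) = i" if "i < length c" for i using assms that by (auto simp: row_word_def)
  show "z ` set c = {..<length c}" by (auto simp: set_conv_nth z image_iff) (metis z)
  show "inj_on z (set c)" by (rule inj_onI) (metis in_set_conv_nth z)
qed

lemma row_word_sum: "row_word cs z \<Longrightarrow> distinct (concat cs) \<Longrightarrow> (\<Sum>k\<in>set (concat cs). z k) = min_sum cs"
proof (induction cs)
  case (Cons c cs)
  have "(\<Sum>k\<in>set c. z k) = \<Sum>(z ` set c)"
    using row_word_image(2)[OF Cons.prems(1), of c] by (simp add: sum.reindex)
  also have "\<dots> = \<Sum>{..<length c}" using row_word_image(1)[OF Cons.prems(1), of c] by simp
  finally have "(\<Sum>k\<in>set c. z k) = \<Sum>{..<length c}" .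
  moreover have "(\<Sum>k\<in>set (concat cs). z k) = min_sum cs"
    using Cons by (auto simp: row_word_def)
  ultimately show ?case unfolding sum_concat_Cons[OF Cons.prems(2)] by (simp add: min_sum_def)
qed (simp add: min_sum_def)

text \<open>In the least degree every column of length p carries exactly the letters below p, so
  each word of the support is a column permutation of z. The difference of both sides vanishes at z,
  hence everywhere.\<close>

lemma eq_scale_col_tensor:
  assumes dist: "distinct (concat cs)" and alt: "\<And>c. c \<in> set cs \<Longrightarrow> alternating (set c) T"
    and supp: "\<And>x. T x \<noteq> 0 \<Longrightarrow>
      (\<forall>k. k \<notin> set (concat cs) \<longrightarrow> x k = z k) \<and> (\<Sum>k\<in>set (concat cs). x k) = min_sum cs"
    and z: "row_word cs z"
  shows "T = tscale (T z) (col_tensor cs z)"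
proof
  fix x
  let ?D = "T - tscale (T z) (col_tensor cs z)"
  have z': "inj_on z (set c)" if "c \<in> set cs" for c using row_word_image(2)[OF z that] .
  have alt_tau: "alternating (set c) (col_tensor cs z)" if "c \<in> set cs" for c
    by (rule alternating_col_tensor[OF dist that])
  have "?D x = 0"
  proof (rule ccontr)
    assume "?D x \<noteq> 0"
    hence *: "T x \<noteq> 0 \<or> col_tensor cs z x \<noteq> 0" by (auto simp: pointwise)
    hence x: "(\<forall>k. k \<notin> set (concat cs) \<longrightarrow> x k = z k) \<and> (\<Sum>k\<in>set (concat cs). x k) = min_sum cs"
      using supp[of x] col_tensor_support[OF _ subset_refl, of cs z x] row_word_sum[OF z dist] by auto
    have "x ` set c = z ` set c" if c: "c \<in> set cs" for c
      using * alternating_min_sum(2)[OF dist alt _ conjunct2[OF x] c]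
        alternating_min_sum(2)[OF dist alt_tau _ conjunct2[OF x] c] row_word_image(1)[OF z c] by auto
    moreover have "alternating (set c) ?D" if "c \<in> set cs" for c
      using alt[OF that] alt_tau[OF that]
      by (auto simp: alternating_def lin_diff[OF lin_P] lin_scale[OF lin_P] pointwise)
    ultimately have "?D x = 0" using x z' dist
      by (intro alternating_zero_permute[of cs ?D z x]) (auto simp: pointwise col_tensor_at)
    thus False using \<open>?D x \<noteq> 0\<close> by simp
  qed
  thus "T x = tscale (T z) (col_tensor cs z) x" by (simp add: pointwise)
qed

subsection \<open>The operator \<open>E\<^sub>\<Omega>\<close> does not vanish\<close>

text \<open>Bilinear, in contrast to \<open>herm\<close>: exchanges are symmetric for it, so
  transposing a product of row factors reverses their order and keeps their coefficients.\<close>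

definition pairing :: "nat \<Rightarrow> nat \<Rightarrow> tensor \<Rightarrow> tensor \<Rightarrow> complex" where
  "pairing N n S T = (\<Sum>x\<in>midx N n. S x * T x)"

lemma finite_midx: "finite (midx N n)"
  by (auto simp: midx_def intro: finite_PiE)

lemma pairing_lin:
  "pairing N n S (T - T') = pairing N n S T - pairing N n S T'"
  "pairing N n (S - S') T = pairing N n S T - pairing N n S' T"
  "pairing N n S (tscale c T) = c * pairing N n S T"
  "pairing N n (tscale c S) T = c * pairing N n S T"
  "pairing N n S (- T) = - pairing N n S T"
  "pairing N n (- S) T = - pairing N n S T"
  "pairing N n S 0 = 0"
  by (simp_all add: pairing_def pointwise algebra_simps sum_subtractf sum_distrib_left sum_negf)

lemma pairing_sum:
  "pairing N n S (sum f A) = (\<Sum>a\<in>A. pairing N n S (f a))"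
  "pairing N n (sum g A) T = (\<Sum>a\<in>A. pairing N n (g a) T)"
  by (simp_all add: pairing_def sum_fun_apply sum_distrib_left sum_distrib_right sum.swap[of _ A])

lemma sum_midx_transpose:
  fixes g :: "(nat \<Rightarrow> nat) \<Rightarrow> complex"
  assumes "k \<in> {1..n}" "l \<in> {1..n}"
  shows "(\<Sum>x\<in>midx N n. g (x \<circ> Transposition.transpose k l)) = (\<Sum>x\<in>midx N n. g x)"
  by (rule sum.reindex_bij_witness[of _ "\<lambda>x. x \<circ> Transposition.transpose k l"
        "\<lambda>x. x \<circ> Transposition.transpose k l"])
    (use midx_comp_transpose[OF assms] in \<open>auto simp: comp_assoc\<close>)

lemma pairing_P:
  assumes "k \<in> {1..n}" "l \<in> {1..n}"
  shows "pairing N n (P_op k l S) T = pairing N n S (P_op k l T)"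
proof -
  have "pairing N n (P_op k l S) T
      = (\<Sum>x\<in>midx N n. S (x \<circ> Transposition.transpose k l \<circ> Transposition.transpose k l)
          * T (x \<circ> Transposition.transpose k l))"
    unfolding pairing_def P_op_def
    by (rule sum_midx_transpose[OF assms, of "\<lambda>x. S (x \<circ> Transposition.transpose k l) * T x", symmetric])
  thus ?thesis by (simp add: pairing_def P_op_def comp_assoc)
qed

lemma pairing_PS:
  assumes "insert k B \<subseteq> {1..n}" shows "pairing N n (PS k B S) T = pairing N n S (PS k B T)"
  unfolding PS_def pairing_sum using assms by (intro sum.cong refl pairing_P) auto

lemma pairing_foldr_row_sum_op:
  assumes "set ks \<union> B \<subseteq> {1..n}"
  shows "pairing N n (foldr (row_sum_op d B) (rev ks) S) T = pairing N n S (foldr (row_sum_op d B) ks T)"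
  using assms
proof (induction ks arbitrary: S)
  case (Cons k ks)
  have "pairing N n (row_sum_op d B k S) U = pairing N n S (row_sum_op d B k U)" for U
    using Cons.prems by (simp add: row_sum_op_def pairing_lin pairing_PS)
  thus ?case using Cons by simp
qed simp

lemma pairing_Ant:
  assumes "distinct xs" "set xs \<subseteq> {1..n}" "alternating (set xs) S"
  shows "pairing N n S (Ant xs T) = fact (length xs) * pairing N n S T"
  using assms
proof (induction xs)
  case (Cons x xs)
  let ?U = "Ant xs T"
  have "pairing N n S (P_op x l ?U) = - pairing N n S ?U" if "l \<in> set xs" for l
  proof -
    have "P_op x l S = - S" using Cons.prems that by (intro alternatingD[OF Cons.prems(3)]) auto
    moreover have "pairing N n (P_op x l S) ?U = pairing N n S (P_op x l ?U)"
      using Cons.prems that by (intro pairing_P) auto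
    ultimately show ?thesis by (simp add: pairing_lin)
  qed
  hence "pairing N n S (PS x (set xs) ?U) = - of_nat (length xs) * pairing N n S ?U"
    using Cons.prems(1) by (simp add: PS_def pairing_sum distinct_card)
  moreover have "alternating (set xs) S" using Cons.prems(3) by (rule alternating_mono) auto
  hence "pairing N n S ?U = fact (length xs) * pairing N n S T" using Cons by auto
  ultimately show ?case by (simp add: pairing_lin algebra_simps)
qed simp

lemma pairing_col_tensor:
  assumes "distinct (concat cs)" "set (concat cs) \<subseteq> {1..n}" "\<And>c. c \<in> set cs \<Longrightarrow> alternating (set c) S"
    and "z \<in> midx N n"
  shows "pairing N n S (col_tensor cs z) = (\<Prod>c\<leftarrow>cs. fact (length c)) * S z"
  using assms
proof (induction cs)
  case Nil
  thus ?case by (simp add: pairing_def col_tensor_def delta_def finite_midx if_distrib cong: if_cong)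
next
  case (Cons c cs)
  have "pairing N n S (Ant c (col_tensor cs z)) = fact (length c) * pairing N n S (col_tensor cs z)"
    using Cons.prems by (intro pairing_Ant) auto
  thus ?case using Cons by (simp add: col_tensor_Cons)
qed

text \<open>
  At the word \<open>w\<close>, which decreases down the column \<open>c\<close>, the exchanges of a factor with smaller
  letters cancel against the exchanges within \<open>c\<close>, and those with larger letters vanish.
\<close>

lemma PS_at_reversed_word:
  assumes dist: "distinct (concat (c # cs))" and m: "m < length c"
    and w: "\<And>i. i < length c \<Longrightarrow> w (c ! i) = length c - 1 - i" "row_word cs w"
    and T: "raised (set (concat (c # cs))) T" "alternating (set (drop m c)) T"
      "\<And>b. b \<in> set cs \<Longrightarrow> alternating (set b) T"
  defines "B \<equiv> set (concat cs)" and "k \<equiv> c ! m"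
  shows "PS k B T w = of_nat (card {l\<in>B. w l = w k}) * T w"
proof -
  let ?f = "\<lambda>l. T (w \<circ> Transposition.transpose k l)"
  have dc: "distinct c" and dB: "distinct (concat cs)" and disj: "set c \<inter> B = {}"
    using dist by (auto simp: B_def)
  have k: "k \<in> set c" using m by (simp add: k_def)
  hence kB: "k \<notin> B" using disj by auto
  note k = k kB
  have wk: "w k = length c - 1 - m" using w(1)[OF m] by (simp add: k_def)
  define E where "E = {l\<in>B. w l = w k}"
  define L where "L = {l\<in>B. w l < w k}"
  define G where "G = {l\<in>B. w k < w l}"
  have fin: "finite B" by (simp add: B_def)
  have "B = (E \<union> L) \<union> G" by (auto simp: E_def L_def G_def)
  moreover have "E \<inter> L = {}" "(E \<union> L) \<inter> G = {}" "finite E" "finite L" "finite G"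
    using fin by (auto simp: E_def L_def G_def)
  ultimately have "PS k B T w = (\<Sum>l\<in>E. ?f l) + (\<Sum>l\<in>L. ?f l) + (\<Sum>l\<in>G. ?f l)"
    by (simp add: PS_def P_op_def sum.union_disjoint pointwise)
  moreover have "(\<Sum>l\<in>E. ?f l) = of_nat (card E) * T w"
  proof -
    have "?f l = T w" if "l \<in> E" for l
    proof -
      have "w l = w k" using that by (simp add: E_def)
      hence "w \<circ> Transposition.transpose k l = w"
        by (auto simp: fun_eq_iff Transposition.transpose_def)
      thus ?thesis by simp
    qed
    thus ?thesis by simp
  qed
  \<comment> \<open>Such an exchange puts a smaller letter into the later columns, whose letter sum
    under w is already the least possible.\<close>
  moreover have "(\<Sum>l\<in>G. ?f l) = 0"
  proof (rule sum.neutral, rule ballI, rule ccontr)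
    fix l assume l: "l \<in> G" and nz: "?f l \<noteq> 0"
    hence lB: "l \<in> B" and lt: "w k < w l" and kl: "k \<noteq> l" using k by (auto simp: G_def)
    have "min_sum cs \<le> (\<Sum>j\<in>B. (w \<circ> Transposition.transpose k l) j)"
      unfolding B_def
      by (rule alternating_min_sum(1)[where T = T and x = "w \<circ> Transposition.transpose k l", OF dB _ nz])
        (rule T(3))
    also have "(\<Sum>j\<in>B. (w \<circ> Transposition.transpose k l) j) = (\<Sum>j\<in>B. (w(l := w k)) j)"
      using k kl by (intro sum.cong) (auto simp: transpose_upd)
    also have "\<dots> < (\<Sum>j\<in>B. w j)" using sum_fun_upd_nat[OF fin lB, of w "w k"] lt by linarith
    also have "\<dots> = min_sum cs" unfolding B_def by (rule row_word_sum[OF w(2) dB])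
    finally show False by simp
  qed
  moreover have "(\<Sum>l\<in>L. ?f l) = 0"
  proof -
    have "(\<Sum>l\<in>L. ?f l) = (\<Sum>b<w k. \<Sum>l\<in>{l\<in>L. w l = b}. ?f l)"
      using fin by (intro sum.group[symmetric]) (auto simp: L_def)
    also have "\<dots> = 0"
    proof (rule sum.neutral, rule ballI)
      fix b assume "b \<in> {..<w k}"
      hence b: "b < w k" by simp
      \<comment> \<open>The place in c below m that carries b. Alternation in c makes its exchange
        equal to \<open>- T w\<close>, which by \<open>raised_lower_sum\<close> is also the sum over
        all places with b; so the places in B contribute nothing.\<close>
      define j where "j = length c - 1 - b"
      have j: "j < length c" "m < j" "w (c ! j) = b" using b wk w(1)[of j] by (auto simp: j_def)
      have only: "i = j" if "i < length c" "w (c ! i) = b" for i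
        using w(1)[OF that(1)] that b wk by (auto simp: j_def)
      have eq: "{l\<in>set (concat (c # cs)). w l = b} = insert (c ! j) {l\<in>L. w l = b}"
      proof
        show "{l\<in>set (concat (c # cs)). w l = b} \<subseteq> insert (c ! j) {l\<in>L. w l = b}"
          using only b by (auto simp: L_def B_def in_set_conv_nth[of _ c])
      qed (use j in \<open>auto simp: L_def B_def\<close>)
      have cj: "c ! j \<notin> {l\<in>L. w l = b}" "finite {l\<in>L. w l = b}"
        using nth_mem[OF j(1)] disj fin by (auto simp: L_def)
      have "P_op k (c ! j) T = - T"
      proof (rule alternatingD[OF T(2)])
        show "k \<in> set (drop m c)" using m by (auto simp: k_def in_set_conv_nth intro!: exI[of _ 0])
        show "c ! j \<in> set (drop m c)" using j by (auto simp: in_set_conv_nth intro!: exI[of _ "j - m"])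
        show "k \<noteq> c ! j" using j(1,2) m dc by (simp add: k_def nth_eq_iff_index_eq)
      qed
      hence "?f (c ! j) = - T w" by (auto simp: P_op_def fun_eq_iff pointwise)
      moreover have "(\<Sum>l\<in>{l\<in>set (concat (c # cs)). w l = b}. ?f l) = - T w"
        by (rule raised_lower_sum[OF T(1)]) (use k b in auto)
      ultimately show "(\<Sum>l\<in>{l\<in>L. w l = b}. ?f l) = 0"
        using sum.insert[OF cj(2,1), of ?f] unfolding eq by simp
    qed
    finally show ?thesis .
  qed
  ultimately show ?thesis by (simp add: E_def)
qed

text \<open>By \<open>PS_at_reversed_word\<close>, the factor of place m multiplies the value at w
  by 1 + M/(m + 1), where M counts equal letters in the later columns; this is not zero. Only
  alternation in the places from m on is used, and the factors of the places above preserve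
  it.\<close>

lemma foldr_row_sum_op_at_reversed_word:
  assumes dist: "distinct (concat (c # cs))"
    and w: "\<And>i. i < length c \<Longrightarrow> w (c ! i) = length c - 1 - i" "row_word cs w"
    and T: "raised (set (concat (c # cs))) T" "\<And>b. b \<in> set (c # cs) \<Longrightarrow> alternating (set b) T"
    and d: "\<And>i. i < length c \<Longrightarrow> d (c ! i) = - of_nat (Suc i)" and m: "m \<le> length c"
  shows "\<exists>\<kappa>. \<kappa> \<noteq> 0 \<and> foldr (row_sum_op d (set (concat cs))) (rev (take m c)) T w = \<kappa> * T w"
  using m
proof (induction m)
  case 0 show ?case by (auto intro: exI[of _ 1])
next
  case (Suc m)
  let ?B = "set (concat cs)"
  let ?U = "foldr (row_sum_op d ?B) (rev (take m c)) T" and ?k = "c ! m"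
  let ?M = "card {l\<in>?B. w l = w ?k}"
  have m: "m < length c" using Suc.prems by simp
  have disj: "set c \<inter> ?B = {}" and dc: "distinct c" using dist by auto
  obtain \<kappa> where \<kappa>: "\<kappa> \<noteq> 0" "?U w = \<kappa> * T w" using Suc by auto
  have sub: "set (take m c) \<subseteq> set c" by (rule set_take_subset)
  have comm: "commutes_on A (foldr (row_sum_op d ?B) (rev (take m c)))"
    if "A \<inter> set (take m c) = {}" "A \<subseteq> ?B \<or> A \<inter> ?B = {}" for A
    by (rule commutes_on_foldr, rule commutes_on_row_sum_op) (use that in auto)
  have "raised (set (concat (c # cs))) ?U"
    by (rule foldr_invariant[where I = "raised (set (concat (c # cs)))"])
      (use T(1) sub in \<open>auto intro!: raised_row_sum_op\<close>)
  moreover have "alternating (set (drop m c)) ?U"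
  proof (rule commutes_on_alternating[OF comm])
    show "set (drop m c) \<inter> set (take m c) = {}" using dc set_take_disj_set_drop_if_distinct[of c m m] by auto
    show "set (drop m c) \<subseteq> ?B \<or> set (drop m c) \<inter> ?B = {}" using disj set_drop_subset[of m c] by auto
    show "alternating (set (drop m c)) T" by (rule alternating_mono[OF T(2)[of c]]) (auto dest: in_set_dropD)
  qed
  moreover have "alternating (set b) ?U" if b: "b \<in> set cs" for b
  proof (rule commutes_on_alternating[OF comm])
    have "set b \<subseteq> ?B" using b by (auto simp: set_concat)
    thus "set b \<inter> set (take m c) = {}" "set b \<subseteq> ?B \<or> set b \<inter> ?B = {}" using disj sub by auto
  qed (use T(2) b in simp)
  ultimately have "PS ?k ?B ?U w = of_nat ?M * ?U w"
    by (intro PS_at_reversed_word[OF dist m w]) auto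
  hence "row_sum_op d ?B ?k ?U w = ?U w - 1 / (- of_nat (Suc m)) * (of_nat ?M * ?U w)"
    by (simp only: row_sum_op_def[of d _ ?k] minus_apply tscale_apply d[OF m])
  also have "\<dots> = (1 + of_nat ?M / of_nat (Suc m)) * (\<kappa> * T w)"
    unfolding \<kappa>(2) by (simp del: of_nat_Suc add: algebra_simps)
  finally have "row_sum_op d ?B ?k ?U w = (1 + of_nat ?M / of_nat (Suc m)) * (\<kappa> * T w)" .
  moreover have "foldr (row_sum_op d ?B) (rev (take (Suc m) c)) T = row_sum_op d ?B ?k ?U"
    using m by (simp add: take_Suc_conv_app_nth)
  moreover have "1 + of_nat ?M / of_nat (Suc m) \<noteq> (0 :: complex)"
  proof -
    have "(1 + of_nat ?M / of_nat (Suc m) :: complex) = of_nat (Suc m + ?M) / of_nat (Suc m)"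
      using of_nat_neq_0[of m, where 'a = complex] by (simp only: of_nat_add add_divide_distrib divide_self not_False_eq_True)
    moreover have "(of_nat (Suc m + ?M) :: complex) \<noteq> 0" "(of_nat (Suc m) :: complex) \<noteq> 0"
      by (simp_all only: of_nat_eq_0_iff)
    ultimately show ?thesis by (simp only: divide_eq_0_iff) simp
  qed
  ultimately show ?case using \<kappa>(1) by (intro exI[of _ "(1 + of_nat ?M / of_nat (Suc m)) * \<kappa>"]) simp
qed

section \<open>Closure of the space of tensors under the operators\<close>

lemma tensors_delta: "z \<in> midx N n \<Longrightarrow> delta z \<in> tensors N n"
  by (auto simp: tensors_def delta_def)

lemma tensors_diff: "S \<in> tensors N n \<Longrightarrow> T \<in> tensors N n \<Longrightarrow> S - T \<in> tensors N n"
  and tensors_scale: "T \<in> tensors N n \<Longrightarrow> tscale c T \<in> tensors N n"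
  and tensors_add: "S \<in> tensors N n \<Longrightarrow> T \<in> tensors N n \<Longrightarrow> S + T \<in> tensors N n"
  and tensors_0: "0 \<in> tensors N n"
  by (auto simp: tensors_def pointwise)

lemma tensors_sum: "(\<And>a. a \<in> A \<Longrightarrow> f a \<in> tensors N n) \<Longrightarrow> sum f A \<in> tensors N n"
  by (induction A rule: infinite_finite_induct) (auto intro: tensors_add tensors_0)

lemma tensors_P: "k \<in> {1..n} \<Longrightarrow> l \<in> {1..n} \<Longrightarrow> T \<in> tensors N n \<Longrightarrow> P_op k l T \<in> tensors N n"
  using midx_comp_transpose[of k n l] by (auto simp: tensors_def P_op_def)

lemma tensors_PS: "insert k B \<subseteq> {1..n} \<Longrightarrow> T \<in> tensors N n \<Longrightarrow> PS k B T \<in> tensors N n"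
  unfolding PS_def by (intro tensors_sum tensors_P) auto

lemma tensors_Ant: "set xs \<subseteq> {1..n} \<Longrightarrow> T \<in> tensors N n \<Longrightarrow> Ant xs T \<in> tensors N n"
  by (induction xs) (auto intro!: tensors_diff tensors_PS)

lemma tensors_row_op:
  assumes "insert k (set (concat cs)) \<subseteq> {1..n}" "T \<in> tensors N n"
  shows "row_op x k cs T \<in> tensors N n"
  unfolding row_op_def
proof (rule foldr_invariant[where I = "\<lambda>T. T \<in> tensors N n"])
  fix b T assume "b \<in> set cs" "T \<in> tensors N n"
  thus "T - tscale (1 / (x k - x (hd b))) (PS k (set b) T) \<in> tensors N n"
    using assms(1) by (intro tensors_diff tensors_scale tensors_PS) (auto simp: set_concat)
qed (rule assms(2))

lemma tensors_Erec:
  "set (concat cs) \<subseteq> {1..n} \<Longrightarrow> T \<in> tensors N n \<Longrightarrow> Erec x cs T \<in> tensors N n"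
proof (induction cs)
  case (Cons c cs)
  have "foldr (\<lambda>k. row_op x k cs) c (Erec x cs T) \<in> tensors N n"
  proof (rule foldr_invariant[where I = "\<lambda>T. T \<in> tensors N n"])
    fix k T assume "k \<in> set c" "T \<in> tensors N n"
    thus "row_op x k cs T \<in> tensors N n" using Cons.prems(1) by (intro tensors_row_op) auto
  qed (use Cons in auto)
  hence "Ant c (foldr (\<lambda>k. row_op x k cs) c (Erec x cs T)) \<in> tensors N n"
    by (rule tensors_Ant[rotated]) (use Cons.prems(1) in auto)
  thus ?case by simp
qed simp

lemma tensors_col_tensor:
  "set (concat cs) \<subseteq> {1..n} \<Longrightarrow> z \<in> midx N n \<Longrightarrow> col_tensor cs z \<in> tensors N n"
proof (induction cs)
  case (Cons c cs)
  have "set c \<subseteq> {1..n}" "col_tensor cs z \<in> tensors N n" using Cons by auto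
  thus ?case unfolding col_tensor_Cons by (rule tensors_Ant)
qed (simp add: col_tensor_def tensors_delta)

lemma lin_row_op: "lin (row_op x k cs)"
proof -
  have "lin (\<lambda>T. foldr (\<lambda>b T. T - tscale (1 / (x k - x (hd b))) (PS k (set b) T)) cs T)"
    by (rule lin_foldr) (intro lin_subtract lin_id lin_scaled lin_PS)
  thus ?thesis by (simp add: lin_def row_op_def)
qed

lemma lin_Erec: "lin (Erec x cs)"
proof (induction cs)
  case Nil show ?case by (simp add: lin_id)
next
  case (Cons c cs)
  have "lin (foldr (\<lambda>k. row_op x k cs) c)" by (rule lin_foldr) (rule lin_row_op)
  thus ?case using Cons by (simp add: lin_def lin_add[OF lin_Ant] lin_scale[OF lin_Ant])
qed

lemma sum_column: "distinct c \<Longrightarrow> (\<Sum>k\<in>set c. g k) = (\<Sum>i<length c. g (c ! i))"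
  for g :: "nat \<Rightarrow> nat"
  by (simp add: sum_list_distinct_conv_sum_set[symmetric] sum_list_sum_nth atLeast0LessThan)

lemma row_sum_op_support:
  assumes "\<And>x. T x \<noteq> 0 \<Longrightarrow> R x"
    and "\<And>k l x. k \<in> A \<Longrightarrow> l \<in> A \<Longrightarrow> R (x \<circ> Transposition.transpose k l) \<Longrightarrow> R x"
    and "k \<in> A" "B \<subseteq> A" "row_sum_op d B k T x \<noteq> 0"
  shows "R x"
proof -
  have "T x \<noteq> 0 \<or> PS k B T x \<noteq> 0" using assms(5) by (auto simp: row_sum_op_def pointwise)
  thus ?thesis
  proof
    assume "PS k B T x \<noteq> 0"
    then obtain l where l: "l \<in> B" "T (x \<circ> Transposition.transpose k l) \<noteq> 0" using PS_support by blast
    show ?thesis by (rule assms(2)[OF assms(3) _ assms(1)[OF l(2)]]) (use l(1) assms(4) in auto)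
  qed (rule assms(1))
qed

text \<open>The tensor U obtained from the induction hypothesis lies in the least degree, so it is a
  multiple of the wanted tensor. To see that it does not vanish, it is paired with the latter: the
  antisymmetrizer contributes a factorial, the row factors move to the other side, and pairing with
  the tensor for the later columns reads off the value at the word w'. The hypothesis is applied to
  w', which is w reversed down c, because the row factors can be evaluated there.\<close>

lemma ex_Erec_eq_col_tensor:
  assumes "good_cols ct u cs" "set (concat cs) \<subseteq> {1..n}" "w \<in> midx N n" "row_word cs w"
  shows "\<exists>T\<in>tensors N n. Erec ct cs T = col_tensor cs w"
  using assms
proof (induction cs arbitrary: u w)
  case Nil
  thus ?case by (auto simp: col_tensor_def intro: tensors_delta)
next
  case (Cons c cs)
  note c = good_colsD[OF Cons.prems(1)]
  have dist: "distinct (concat (c # cs))" by (rule distinct_concat_good_cols[OF Cons.prems(1)])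
  let ?B = "set (concat cs)" and ?A = "set (concat (c # cs))" and ?p = "length c"
  have disj: "set c \<inter> ?B = {}" using c(6) .
  define w' where "w' = (\<lambda>k. if k \<in> set c then ?p - 1 - w k else w k)"
  have wc: "w (c ! i) = i" if "i < ?p" for i using Cons.prems(4) that by (auto simp: row_word_def)
  have w'c: "w' (c ! i) = ?p - 1 - i" if "i < ?p" for i using that by (simp add: w'_def wc)
  have w'_midx: "w' \<in> midx N n"
  proof -
    have "w' k < N" if k: "k \<in> {1..n}" for k
    proof (cases "k \<in> set c")
      case True
      then obtain i where i: "i < ?p" "k = c ! i" by (metis in_set_conv_nth)
      have "w' k = w (c ! (?p - 1 - i))" using i wc[of "?p - 1 - i"] w'c by simp
      moreover have "c ! (?p - 1 - i) \<in> set c" using i by simp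
      hence "c ! (?p - 1 - i) \<in> {1..n}" using Cons.prems(2) by auto
      ultimately show ?thesis using midx_lt[OF Cons.prems(3)] by simp
    next
      case False
      thus ?thesis using midx_lt[OF Cons.prems(3) k] by (simp add: w'_def)
    qed
    moreover have "w' k = undefined" if "k \<notin> {1..n}" for k
    proof -
      have "k \<notin> set c" using that Cons.prems(2) by auto
      thus ?thesis using Cons.prems(3) that by (auto simp: w'_def midx_def PiE_def extensional_def)
    qed
    ultimately show ?thesis by (auto simp: midx_def PiE_def extensional_def)
  qed
  have w'_row: "row_word cs w'"
    unfolding row_word_def
  proof (intro ballI allI impI)
    fix b i assume b: "b \<in> set cs" "i < length b"
    hence "b ! i \<in> ?B" by (auto simp: set_concat intro!: bexI[of _ b])
    thus "w' (b ! i) = i" using b disj Cons.prems(4) by (auto simp: w'_def row_word_def)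
  qed
  have w'_c: "inj_on w' (set c)" "w' ` set c = {..<?p}"
  proof -
    show inj: "inj_on w' (set c)"
    proof (rule inj_onI)
      fix k l assume "k \<in> set c" "l \<in> set c" and eq: "w' k = w' l"
      then obtain i j where "i < ?p" "k = c ! i" "j < ?p" "l = c ! j" by (metis in_set_conv_nth)
      thus "k = l" using eq w'c[of i] w'c[of j] by (cases "i = j") auto
    qed
    have "w' ` set c \<subseteq> {..<?p}" using c(1) by (auto simp: w'_def)
    moreover have "card (w' ` set c) = card {..<?p}" using c(2) inj by (simp add: card_image distinct_card)
    ultimately show "w' ` set c = {..<?p}" by (intro card_subset_eq) auto
  qed
  have sum_w: "(\<Sum>k\<in>?A. w k) = min_sum (c # cs)" by (rule row_word_sum[OF Cons.prems(4) dist])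
  have sum_w': "(\<Sum>k\<in>?A. w' k) = min_sum (c # cs)"
  proof -
    have "(\<Sum>k\<in>set c. w' k) = (\<Sum>i<?p. ?p - Suc i)"
      unfolding sum_column[OF c(2)] by (intro sum.cong) (auto simp: w'c)
    also have "\<dots> = \<Sum>{..<?p}" by (rule sum.nat_diff_reindex)
    finally have "(\<Sum>k\<in>set c. w' k) = \<Sum>{..<?p}" .
    moreover have "(\<Sum>k\<in>?B. w' k) = min_sum cs"
      using w'_row dist by (intro row_word_sum) auto
    ultimately show ?thesis unfolding sum_concat_Cons[OF dist] by (simp add: min_sum_def)
  qed
  have "\<exists>T\<in>tensors N n. Erec ct cs T = col_tensor cs w'"
    by (rule Cons.IH[OF c(7) _ w'_midx w'_row]) (use Cons.prems(2) in auto)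
  then obtain T where T: "T \<in> tensors N n" "Erec ct cs T = col_tensor cs w'" by auto
  let ?\<tau> = "col_tensor cs w'" and ?d = "\<lambda>k. ct k - (u + 1)"
  let ?Y = "foldr (row_sum_op ?d ?B) c ?\<tau>" and ?\<sigma> = "col_tensor (c # cs) w"
  define U where "U = Erec ct (c # cs) T"
  have d: "?d (c ! i) = - of_nat (Suc i)" if "i < ?p" for i using c(3)[OF that] by simp
  have tau: "garnir cs ?\<tau>" using garnir_Erec[OF c(7), of T] T(2) by simp
  have U: "U = Ant c ?Y"
  proof -
    have "ct k - (u + 1) - of_nat m \<noteq> 0" if k: "k \<in> set c" for k m
    proof -
      obtain i where i: "i < ?p" "k = c ! i" using k by (metis in_set_conv_nth)
      have "ct k - (u + 1) - of_nat m = - of_nat (Suc (i + m))" unfolding i(2) using c(3)[OF i(1)] by simp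
      thus ?thesis by (simp only: neg_equal_0_iff_equal of_nat_neq_0 not_False_eq_True)
    qed
    from row_ops_garnir[OF c(7) tau disj this]
    have "foldr (\<lambda>k. row_op ct k cs) c ?\<tau> = ?Y" by blast
    thus ?thesis by (simp add: U_def T(2))
  qed
  \<comment> \<open>A condition on words that is invariant under all exchanges of positions in the
    columns. It confines the support to the least degree throughout the construction.\<close>
  define R where "R x \<longleftrightarrow> (\<forall>k. k \<notin> ?A \<longrightarrow> x k = w k) \<and> (\<Sum>k\<in>?A. x k) = min_sum (c # cs)" for x
  have R: "R x" if kl: "k \<in> ?A" "l \<in> ?A" and Rx: "R (x \<circ> Transposition.transpose k l)" for k l x
  proof -
    have "x m = w m" if m: "m \<notin> ?A" for m
    proof -
      have "m \<noteq> k" "m \<noteq> l" using m kl by auto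
      moreover have "(x \<circ> Transposition.transpose k l) m = w m" using Rx m unfolding R_def by blast
      ultimately show ?thesis by simp
    qed
    moreover have "(\<Sum>m\<in>?A. (x \<circ> Transposition.transpose k l) m) = (\<Sum>m\<in>?A. x m)"
      using kl by (intro sum_transpose) blast
    ultimately show ?thesis using Rx unfolding R_def by (simp only: simp_thms) blast
  qed
  have R_tau: "R x" if "?\<tau> x \<noteq> 0" for x
  proof -
    have "?B \<subseteq> ?A" by auto
    from col_tensor_support[OF that this] show ?thesis
      unfolding R_def sum_w' by (auto simp: w'_def)
  qed
  have R_Y: "R x" if "?Y x \<noteq> 0" for x
  proof -
    have "\<forall>x. ?Y x \<noteq> 0 \<longrightarrow> R x"
    proof (rule foldr_invariant[where I = "\<lambda>T. \<forall>x. T x \<noteq> 0 \<longrightarrow> R x"])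
      fix k and T :: tensor assume k: "k \<in> set c" and T: "\<forall>x. T x \<noteq> 0 \<longrightarrow> R x"
      show "\<forall>x. row_sum_op ?d ?B k T x \<noteq> 0 \<longrightarrow> R x"
      proof (intro allI impI)
        fix x assume nz: "row_sum_op ?d ?B k T x \<noteq> 0"
        show "R x"
        proof (rule row_sum_op_support[where R = R and A = ?A and T = T, OF _ _ _ _ nz])
          show "R x" if "T x \<noteq> 0" for x using spec[OF T, of x] that by (rule mp)
          show "R x" if "k \<in> ?A" "l \<in> ?A" "R (x \<circ> Transposition.transpose k l)" for k l x
            using that by (rule R)
        qed (use k in simp_all)
      qed
    qed (intro allI impI R_tau)
    from spec[OF this, of x] that show ?thesis by (rule mp)
  qed
  have R_U: "R x" if "U x \<noteq> 0" for x
  proof (rule Ant_support[where R = R and T = ?Y and xs = c])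
    show "Ant c ?Y x \<noteq> 0" using that unfolding U .
    show "R x" if "k \<in> set c" "l \<in> set c" "R (x \<circ> Transposition.transpose k l)" for k l x
      by (rule R[OF _ _ that(3)]) (use that in simp_all)
  qed (rule R_Y)
  have alt_U: "alternating (set b) U" if "b \<in> set (c # cs)" for b
    unfolding U_def by (rule garnir_alternating[OF garnir_Erec[OF Cons.prems(1), of T] that])
  have U_eq: "U = tscale (U w) ?\<sigma>"
    by (rule eq_scale_col_tensor[OF dist alt_U]) (use R_U Cons.prems(4) in \<open>auto simp: R_def\<close>)
  have alt_sigma: "alternating (set b) ?\<sigma>" if "b \<in> set (c # cs)" for b
    by (rule alternating_col_tensor[OF dist that])
  have inj_w: "inj_on w (set b)" if "b \<in> set (c # cs)" for b
    by (rule row_word_image(2)[OF Cons.prems(4) that])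
  have sigma_w: "?\<sigma> w = 1" by (rule col_tensor_at[OF dist inj_w])
  have sigma_w': "?\<sigma> w' \<noteq> 0"
  proof
    assume 0: "?\<sigma> w' = 0"
    have "?\<sigma> w = 0"
    proof (rule alternating_zero_permute[where T = ?\<sigma> and z = w', OF dist alt_sigma _ 0])
      fix b assume b: "b \<in> set (c # cs)"
      show "inj_on w' (set b)"
        using b w'_c(1) row_word_image(2)[OF w'_row] by auto
      show "w ` set b = w' ` set b"
      proof (cases "b = c")
        case True
        thus ?thesis using w'_c(2) row_word_image(1)[OF Cons.prems(4) b] by simp
      next
        case False
        hence "b \<in> set cs" using b by simp
        from row_word_image(1)[OF w'_row this] row_word_image(1)[OF Cons.prems(4) b]
        show ?thesis by simp
      qed
    next
      show "w k = w' k" if "k \<notin> ?A" for k using that by (auto simp: w'_def)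
    qed
    thus False using sigma_w by simp
  qed
  have raised: "raised ?A ?\<sigma>"
  proof (rule raised_min_sum[where T = ?\<sigma>, OF dist alt_sigma])
    show "(\<Sum>k\<in>?A. x k) = min_sum (c # cs)" if "?\<sigma> x \<noteq> 0" for x
      using col_tensor_support[OF that subset_refl] sum_w by simp
  qed
  have Uw: "U w \<noteq> 0"
  proof
    assume "U w = 0"
    hence "U = 0" using U_eq by (auto simp: pointwise)
    let ?V = "foldr (row_sum_op ?d ?B) (rev c) ?\<sigma>"
    obtain \<kappa> where \<kappa>: "\<kappa> \<noteq> 0" "?V w' = \<kappa> * ?\<sigma> w'"
      using foldr_row_sum_op_at_reversed_word[where T = ?\<sigma> and d = ?d,
          OF dist w'c w'_row raised alt_sigma d order_refl]
      unfolding take_all[OF order_refl] by blast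
    have alt_V: "alternating (set b) ?V" if b: "b \<in> set cs" for b
    proof (rule commutes_on_alternating[where T = ?\<sigma> and F = "foldr (row_sum_op ?d ?B) (rev c)"],
        rule commutes_on_foldr, rule commutes_on_row_sum_op)
      have "set b \<subseteq> ?B" using b by (auto simp: set_concat)
      thus "set b \<subseteq> ?B \<or> set b \<inter> ?B = {}" by simp
      show "k \<notin> set b" if "k \<in> set (rev c)" for k using that \<open>set b \<subseteq> ?B\<close> disj by auto
    qed (use alt_sigma b in simp)
    have "0 = pairing N n ?\<sigma> U" using \<open>U = 0\<close> by (simp add: pairing_lin)
    also have "\<dots> = fact ?p * pairing N n ?\<sigma> ?Y" unfolding U
      using c(2) Cons.prems(2) alt_sigma by (intro pairing_Ant) auto
    also have "pairing N n ?\<sigma> ?Y = pairing N n ?V ?\<tau>"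
      using Cons.prems(2) by (intro pairing_foldr_row_sum_op[symmetric]) auto
    also have "pairing N n ?V ?\<tau> = (\<Prod>b\<leftarrow>cs. fact (length b)) * ?V w'"
      by (rule pairing_col_tensor) (use dist Cons.prems(2) alt_V w'_midx in auto)
    finally have "(\<Prod>b\<leftarrow>cs. fact (length b)) * ?V w' = (0 :: complex)" by simp
    moreover have "(\<Prod>b\<leftarrow>cs. fact (length b)) \<noteq> (0 :: complex)" by (auto simp: prod_list_zero_iff)
    ultimately show False using \<kappa> sigma_w' by simp
  qed
  have "Erec ct (c # cs) (tscale (1 / U w) T) = tscale (1 / U w) U"
    unfolding U_def by (rule lin_scale[OF lin_Erec])
  also have "\<dots> = ?\<sigma>" by (subst U_eq) (use Uw in \<open>simp add: pointwise\<close>)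
  finally show ?case using tensors_scale[OF T(1)] by blast
qed

subsection \<open>The action of matrices\<close>

lemma act_apply: "x \<in> midx N n \<Longrightarrow> act N n g T x = (\<Sum>j\<in>midx N n. (\<Prod>k\<in>{1..n}. g $$ (x k, j k)) * T j)"
  by (simp add: act_def)

lemma lin_act: "lin (act N n g)"
  by (rule linI) (auto simp: act_def pointwise sum.distrib sum_distrib_left algebra_simps)

lemma tensors_act: "act N n g T \<in> tensors N n"
  by (auto simp: tensors_def act_def)

lemma prod_transpose:
  fixes f :: "nat \<Rightarrow> complex"
  assumes "k \<in> A" "l \<in> A" shows "(\<Prod>m\<in>A. f (Transposition.transpose k l m)) = (\<Prod>m\<in>A. f m)"
proof -
  have "(\<Prod>m\<in>A. f (Transposition.transpose k l m)) = (\<Prod>m\<in>Transposition.transpose k l ` A. f m)"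
    by (subst prod.reindex) (auto intro: inj_on_subset[OF inj_transpose])
  thus ?thesis using assms by (simp add: transpose_image_same)
qed

lemma act_P:
  assumes "k \<in> {1..n}" "l \<in> {1..n}"
  shows "act N n g (P_op k l T) = P_op k l (act N n g T)"
proof
  fix x :: "nat \<Rightarrow> nat"
  let ?t = "Transposition.transpose k l"
  have "(\<Sum>j\<in>midx N n. (\<Prod>m\<in>{1..n}. g $$ (x m, j m)) * T (j \<circ> ?t))
      = (\<Sum>j\<in>midx N n. (\<Prod>m\<in>{1..n}. g $$ (x m, (j \<circ> ?t) m)) * T j)"
    using sum_midx_transpose[OF assms, of "\<lambda>j. (\<Prod>m\<in>{1..n}. g $$ (x m, (j \<circ> ?t) m)) * T j" N]
    by (simp add: comp_def)
  also have "\<dots> = (\<Sum>j\<in>midx N n. (\<Prod>m\<in>{1..n}. g $$ ((x \<circ> ?t) m, j m)) * T j)"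
    using prod_transpose[OF assms, of "\<lambda>m. g $$ ((x \<circ> ?t) m, j m)" for j] by simp
  finally show "act N n g (P_op k l T) x = P_op k l (act N n g T) x"
    using midx_comp_transpose[OF assms, of x N] by (simp add: act_def P_op_def)
qed

lemma commutes_on_act: "commutes_on {1..n} (act N n g)"
  by (simp add: commutes_on_def lin_act act_P)

lemma garnir_act:
  assumes "set (concat cs) \<subseteq> {1..n}" "garnir cs T" shows "garnir cs (act N n g T)"
  by (rule commutes_on_garnir[OF commutes_on_mono[OF commutes_on_act assms(1)] assms(2)])

lemma act_mult:
  assumes "g \<in> carrier_mat N N" "h \<in> carrier_mat N N"
  shows "act N n (g * h) T = act N n g (act N n h T)"
proof
  fix x
  show "act N n (g * h) T x = act N n g (act N n h T) x"
  proof (cases "x \<in> midx N n")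
    case True
    have "(\<Prod>k\<in>{1..n}. (g * h) $$ (x k, y k))
        = (\<Sum>j\<in>midx N n. (\<Prod>k\<in>{1..n}. g $$ (x k, j k)) * (\<Prod>k\<in>{1..n}. h $$ (j k, y k)))"
      if y: "y \<in> midx N n" for y
    proof -
      have "(\<Prod>k\<in>{1..n}. (g * h) $$ (x k, y k)) = (\<Prod>k\<in>{1..n}. \<Sum>a<N. g $$ (x k, a) * h $$ (a, y k))"
      proof (rule prod.cong)
        fix k assume k: "k \<in> {1..n}"
        have "x k < N" "y k < N" using midx_lt[OF True k] midx_lt[OF y k] by auto
        thus "(g * h) $$ (x k, y k) = (\<Sum>a<N. g $$ (x k, a) * h $$ (a, y k))"
          using assms by (auto simp: scalar_prod_def atLeast0LessThan intro!: sum.cong)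
      qed simp
      also have "\<dots> = (\<Sum>j\<in>midx N n. \<Prod>k\<in>{1..n}. g $$ (x k, j k) * h $$ (j k, y k))"
        unfolding midx_def by (rule prod_sum_PiE) auto
      finally show ?thesis by (simp add: prod.distrib)
    qed
    hence "act N n (g * h) T x = (\<Sum>y\<in>midx N n. \<Sum>j\<in>midx N n.
        (\<Prod>k\<in>{1..n}. g $$ (x k, j k)) * ((\<Prod>k\<in>{1..n}. h $$ (j k, y k)) * T y))"
      by (simp add: act_apply[OF True] sum_distrib_right mult.assoc)
    also have "\<dots> = (\<Sum>j\<in>midx N n. \<Sum>y\<in>midx N n.
        (\<Prod>k\<in>{1..n}. g $$ (x k, j k)) * ((\<Prod>k\<in>{1..n}. h $$ (j k, y k)) * T y))" by (rule sum.swap)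
    also have "\<dots> = act N n g (act N n h T) x"
      by (simp add: act_apply[OF True]) (simp add: act_apply sum_distrib_left)
    finally show ?thesis .
  qed (simp add: act_def)
qed

lemma midx_ext: "x \<in> midx N n \<Longrightarrow> y \<in> midx N n \<Longrightarrow> (\<And>k. k \<in> {1..n} \<Longrightarrow> x k = y k) \<Longrightarrow> x = y"
  unfolding midx_def by (rule PiE_ext)

lemma act_diag:
  assumes "x \<in> midx N n" and g: "\<And>i j. i < N \<Longrightarrow> j < N \<Longrightarrow> i \<noteq> j \<Longrightarrow> g $$ (i, j) = 0"
  shows "act N n g T x = (\<Prod>k\<in>{1..n}. g $$ (x k, x k)) * T x"
proof -
  have 0: "(\<Prod>k\<in>{1..n}. g $$ (x k, j k)) * T j = 0" if j: "j \<in> midx N n - {x}" for j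
  proof -
    obtain k where k: "k \<in> {1..n}" "x k \<noteq> j k" using midx_ext[OF assms(1), of j] j by blast
    hence "g $$ (x k, j k) = 0" using midx_lt[OF assms(1) k(1)] midx_lt[of j N n k] j k by (intro g) auto
    thus ?thesis using k(1) by (auto simp: prod_zero_iff)
  qed
  have "(\<Sum>j\<in>midx N n - {x}. (\<Prod>k\<in>{1..n}. g $$ (x k, j k)) * T j) = 0"
    by (rule sum.neutral) (use 0 in blast)
  thus ?thesis unfolding act_apply[OF assms(1)]
    by (subst sum.remove[OF finite_midx assms(1)]) simp
qed

lemma act_one: "T \<in> tensors N n \<Longrightarrow> act N n (1\<^sub>m N) T = T"
proof
  fix x assume T: "T \<in> tensors N n"
  show "act N n (1\<^sub>m N) T x = T x"
  proof (cases "x \<in> midx N n")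
    case True
    have "(\<Prod>k\<in>{1..n}. 1\<^sub>m N $$ (x k, x k)) = (1 :: complex)"
      using midx_lt[OF True] by (intro prod.neutral) auto
    thus ?thesis by (subst act_diag[OF True]) auto
  qed (use T in \<open>auto simp: act_def tensors_def\<close>)
qed

subsection \<open>The Hermitian form\<close>

definition herm :: "nat \<Rightarrow> nat \<Rightarrow> tensor \<Rightarrow> tensor \<Rightarrow> complex" where
  "herm N n S T = (\<Sum>x\<in>midx N n. cnj (S x) * T x)"

lemma herm_lin:
  "herm N n S (T - T') = herm N n S T - herm N n S T'"
  "herm N n (S - S') T = herm N n S T - herm N n S' T"
  "herm N n S (T + T') = herm N n S T + herm N n S T'"
  "herm N n (S + S') T = herm N n S T + herm N n S' T"
  "herm N n S (tscale c T) = c * herm N n S T"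
  "herm N n (tscale c S) T = cnj c * herm N n S T"
  "herm N n S 0 = 0" "herm N n 0 T = 0"
  by (simp_all add: herm_def pointwise algebra_simps sum_subtractf sum.distrib sum_distrib_left)

lemma herm_sum:
  "herm N n S (sum f A) = (\<Sum>a\<in>A. herm N n S (f a))"
  "herm N n (sum g A) T = (\<Sum>a\<in>A. herm N n (g a) T)"
  by (simp_all add: herm_def sum_fun_apply sum_distrib_left sum_distrib_right sum.swap[of _ A])

lemma herm_self: "herm N n T T = of_real (\<Sum>x\<in>midx N n. (cmod (T x))\<^sup>2)"
  by (simp add: herm_def complex_norm_square mult.commute del: of_real_power)

lemma herm_self_eq_0: "T \<in> tensors N n \<Longrightarrow> herm N n T T = 0 \<longleftrightarrow> T = 0"
proof
  assume T: "T \<in> tensors N n" and "herm N n T T = 0"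
  hence "(\<Sum>x\<in>midx N n. (cmod (T x))\<^sup>2) = 0" by (simp only: herm_self of_real_eq_0_iff)
  hence "\<forall>x\<in>midx N n. T x = 0" by (simp add: sum_nonneg_eq_0_iff finite_midx)
  thus "T = 0" using T by (auto simp: pointwise tensors_def)
qed (simp add: herm_lin)

definition adjoint :: "nat \<Rightarrow> complex mat \<Rightarrow> complex mat" where
  "adjoint N g = mat N N (\<lambda>(i, j). cnj (g $$ (j, i)))"

lemma adjoint_carrier [simp]: "adjoint N g \<in> carrier_mat N N"
  by (simp add: adjoint_def)

lemma adjoint_adjoint: "g \<in> carrier_mat N N \<Longrightarrow> adjoint N (adjoint N g) = g"
  by (rule eq_matI) (auto simp: adjoint_def)

lemma adjoint_mult:
  assumes "g \<in> carrier_mat N N" "h \<in> carrier_mat N N"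
  shows "adjoint N (g * h) = adjoint N h * adjoint N g"
  by (rule eq_matI) (use assms in \<open>auto simp: adjoint_def scalar_prod_def mult.commute\<close>)

lemma adjoint_GL: "g \<in> GL_group N \<Longrightarrow> adjoint N g \<in> GL_group N"
proof -
  assume g: "g \<in> GL_group N"
  then obtain h where h: "inverts_mat g h" "inverts_mat h g" and gc: "g \<in> carrier_mat N N"
    by (auto simp: GL_group_def invertible_mat_def)
  have gh: "g * h = 1\<^sub>m N" using h(1) gc by (simp add: inverts_mat_def)
  have hg: "h * g = 1\<^sub>m (dim_row h)" using h(2) by (simp add: inverts_mat_def)
  have "dim_col h = N" using arg_cong[OF gh, of dim_col] by simp
  moreover have "dim_row h = N" using arg_cong[OF hg, of dim_col] gc by simp
  ultimately have hc: "h \<in> carrier_mat N N" by auto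
  have one: "adjoint N (1\<^sub>m N) = 1\<^sub>m N" by (rule eq_matI) (auto simp: adjoint_def)
  have "inverts_mat (adjoint N g) (adjoint N h)" "inverts_mat (adjoint N h) (adjoint N g)"
    using gh hg hc by (simp_all add: inverts_mat_def one flip: adjoint_mult[OF hc gc] adjoint_mult[OF gc hc])
      (simp_all add: adjoint_def)
  thus ?thesis by (auto simp: GL_group_def invertible_mat_def adjoint_def)
qed

lemma herm_act: "herm N n S (act N n g T) = herm N n (act N n (adjoint N g) S) T"
proof -
  have "herm N n S (act N n g T)
      = (\<Sum>x\<in>midx N n. \<Sum>j\<in>midx N n. cnj (S x) * ((\<Prod>k\<in>{1..n}. g $$ (x k, j k)) * T j))"
    by (simp add: herm_def act_apply sum_distrib_left)
  also have "\<dots> = (\<Sum>j\<in>midx N n. \<Sum>x\<in>midx N n. cnj (S x) * ((\<Prod>k\<in>{1..n}. g $$ (x k, j k)) * T j))"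
    by (rule sum.swap)
  also have "\<dots> = (\<Sum>j\<in>midx N n. cnj (act N n (adjoint N g) S j) * T j)"
  proof (rule sum.cong)
    fix j assume j: "j \<in> midx N n"
    have "(\<Prod>k\<in>{1..n}. g $$ (x k, j k)) = cnj (\<Prod>k\<in>{1..n}. adjoint N g $$ (j k, x k))"
      if "x \<in> midx N n" for x
      using midx_lt[OF j] midx_lt[OF that] by (auto simp: adjoint_def intro!: prod.cong)
    thus "(\<Sum>x\<in>midx N n. cnj (S x) * ((\<Prod>k\<in>{1..n}. g $$ (x k, j k)) * T j)) = cnj (act N n (adjoint N g) S j) * T j"
      by (simp add: act_apply[OF j] sum_distrib_left mult_ac)
  qed simp
  finally show ?thesis by (simp add: herm_def)
qed

lemma subspace_tensors: "tensor.subspace (tensors N n)"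
  by (rule tensor.subspaceI) (auto intro: tensors_0 tensors_add tensors_scale)

lemma tensors_span_delta: "tensors N n \<subseteq> tensor.span (delta ` midx N n)"
proof
  fix T assume T: "T \<in> tensors N n"
  have "T = (\<Sum>z\<in>midx N n. tscale (T z) (delta z))"
  proof
    fix x
    have "(\<Sum>z\<in>midx N n. T z * delta z x) = (\<Sum>z\<in>midx N n. if z = x then T x else 0)"
      by (intro sum.cong) (auto simp: delta_def)
    also have "\<dots> = T x" using T by (auto simp: finite_midx tensors_def)
    finally show "T x = (\<Sum>z\<in>midx N n. tscale (T z) (delta z)) x" by (simp add: pointwise)
  qed
  also have "\<dots> \<in> tensor.span (delta ` midx N n)"
    by (intro tensor.span_sum tensor.span_scale tensor.span_base) auto
  finally show "T \<in> tensor.span (delta ` midx N n)" .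
qed

lemma tensors_finite_basis:
  assumes "tensor.subspace U" "U \<subseteq> tensors N n"
  obtains B where "finite B" "B \<subseteq> U" "tensor.span B = U"
proof -
  obtain B where B: "B \<subseteq> U" "tensor.independent B" "U \<subseteq> tensor.span B"
    using tensor.maximal_independent_subset by blast
  have "B \<subseteq> tensor.span (delta ` midx N n)" using B(1) assms(2) tensors_span_delta by blast
  hence "finite B" using tensor.independent_span_bound[OF finite_imageI[OF finite_midx] B(2)] by blast
  moreover have "tensor.span B = U" using B assms(1) tensor.span_minimal by blast
  ultimately show thesis using B(1) that by blast
qed

lemma ex_orthogonal_projection:
  assumes "tensor.subspace U" "U \<subseteq> tensors N n"
  shows "\<exists>u\<in>U. \<forall>v\<in>U. herm N n v (T - u) = 0"
proof -
  obtain B where B: "finite B" "B \<subseteq> U" "tensor.span B = U" using tensors_finite_basis[OF assms] .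
  have "\<exists>u\<in>tensor.span B. \<forall>v\<in>tensor.span B. herm N n v (T - u) = 0"
    if "finite B" "B \<subseteq> tensors N n" for B T
    using that
  proof (induction B arbitrary: T)
    case empty thus ?case by (auto simp: herm_lin)
  next
    case (insert b B)
    have spanB: "tensor.span B \<subseteq> tensors N n"
      using insert.prems by (intro tensor.span_minimal subspace_tensors) auto
    obtain p where p: "p \<in> tensor.span B" "\<forall>v\<in>tensor.span B. herm N n v (b - p) = 0"
      using insert.IH[of b] insert.prems by auto
    obtain q where q: "q \<in> tensor.span B" "\<forall>v\<in>tensor.span B. herm N n v (T - q) = 0"
      using insert.IH[of T] insert.prems by auto
    \<comment> \<open>A Gram-Schmidt step: e is orthogonal to the span of B and spans, together with
      B, the same space as b does. If e = 0, nothing is added to the projection, hence the case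
      distinction in c.\<close>
    define e where "e = b - p"
    have span: "v \<in> tensor.span (insert b B) \<longleftrightarrow> (\<exists>c. v - tscale c e \<in> tensor.span B)" for v
    proof -
      have eq: "v - tscale c e = (v - tscale c b) + tscale c p" for c
        by (simp add: e_def pointwise algebra_simps)
      have iff: "(v - tscale c b) + tscale c p \<in> tensor.span B \<longleftrightarrow> v - tscale c b \<in> tensor.span B" for c
        using p(1) by (meson tensor.span_add_eq2 tensor.span_scale)
      show ?thesis by (simp only: tensor.span_insert mem_Collect_eq eq iff)
    qed
    define c where "c = (if e = 0 then 0 else herm N n e (T - q) / herm N n e e)"
    define u where "u = q + tscale c e"
    have "e \<in> tensors N n" using p(1) spanB insert.prems by (auto simp: e_def intro: tensors_diff)
    hence e: "herm N n e (T - u) = 0"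
      by (auto simp: u_def c_def herm_lin herm_self_eq_0 diff_diff_eq[symmetric])
    have "herm N n v (T - u) = 0" if v: "v \<in> tensor.span (insert b B)" for v
    proof -
      obtain d where d: "v - tscale d e \<in> tensor.span B" using v span by blast
      define w where "w = v - tscale d e"
      have w: "w \<in> tensor.span B" using d by (simp add: w_def)
      have "herm N n w (T - u) = herm N n w (T - q) - c * herm N n w e"
        by (simp add: u_def herm_lin)
      also have "\<dots> = 0" using w p(2) q(2) by (simp add: e_def)
      finally have "herm N n w (T - u) = 0" .
      moreover have "herm N n v (T - u) = herm N n w (T - u) + cnj d * herm N n e (T - u)"
        by (simp add: w_def herm_lin algebra_simps)
      ultimately show ?thesis using e by simp
    qed
    moreover have "u - tscale c e = q" by (simp add: u_def)
    hence "u \<in> tensor.span (insert b B)" unfolding span using q(1) by metis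
    ultimately show ?case by blast
  qed
  from this[OF B(1)] B assms(2) show ?thesis by auto
qed

subsection \<open>Elementary matrices and irreducibility\<close>

definition elem_mat :: "nat \<Rightarrow> nat \<Rightarrow> nat \<Rightarrow> complex \<Rightarrow> complex mat" where
  "elem_mat N a b e = mat N N (\<lambda>(i, j). (if i = j then 1 else 0) + (if i = a \<and> j = b then e else 0))"

lemma elem_mat_carrier [simp]: "elem_mat N a b e \<in> carrier_mat N N"
  by (simp add: elem_mat_def)

lemma elem_mat_mult:
  assumes "a < N" "b < N"
  shows "elem_mat N a b e * elem_mat N a b e' = elem_mat N a b (e + e' + (if a = b then e * e' else 0))"
proof (rule eq_matI)
  fix i j assume "i < dim_row (elem_mat N a b (e + e' + (if a = b then e * e' else 0)))"
    "j < dim_col (elem_mat N a b (e + e' + (if a = b then e * e' else 0)))"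
  hence ij: "i < N" "j < N" by (auto simp: elem_mat_def)
  have "(elem_mat N a b e * elem_mat N a b e') $$ (i, j) = (\<Sum>m<N.
      ((if m = i then 1 else 0) + (if m = b then if i = a then e else 0 else 0)) *
      ((if m = j then 1 else 0) + (if m = a then if j = b then e' else 0 else 0)))"
    using ij by (auto simp: elem_mat_def scalar_prod_def atLeast0LessThan intro!: sum.cong)
  also have "\<dots> = (\<Sum>m<N. (if m = i then if i = j then 1 else 0 else 0)
      + (if m = a then if a = i \<and> j = b then e' else 0 else 0)
      + (if m = b then if b = j \<and> i = a then e else 0 else 0)
      + (if m = a then if a = b \<and> i = a \<and> j = b then e * e' else 0 else 0))"
    by (intro sum.cong) (auto simp: algebra_simps)
  also have "\<dots> = elem_mat N a b (e + e' + (if a = b then e * e' else 0)) $$ (i, j)"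
    using ij assms by (auto simp: sum.distrib elem_mat_def)
  finally show "(elem_mat N a b e * elem_mat N a b e') $$ (i, j) = \<dots>" .
qed (auto simp: elem_mat_def)

lemma elem_mat_0: "elem_mat N a b 0 = 1\<^sub>m N"
  by (rule eq_matI) (auto simp: elem_mat_def)

lemma elem_mat_GL: "a < N \<Longrightarrow> b < N \<Longrightarrow> a \<noteq> b \<or> e \<noteq> -1 \<Longrightarrow> elem_mat N a b e \<in> GL_group N"
proof -
  assume a: "a < N" "b < N" and e: "a \<noteq> b \<or> e \<noteq> -1"
  \<comment> \<open>The inverse is again elementary; in the diagonal case 1 + e' is the inverse of 1
    + e.\<close>
  define e' where "e' = (if a = b then - e / (1 + e) else - e)"
  have "e + e' + (if a = b then e * e' else 0) = 0"
  proof (cases "a = b")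
    case True
    hence "1 + e \<noteq> 0" using e by (metis add.commute add_eq_0_iff minus_equation_iff)
    thus ?thesis using True by (simp add: e'_def divide_simps) (simp add: algebra_simps)
  qed (simp add: e'_def)
  moreover from this have "e' + e + (if a = b then e' * e else 0) = 0" by (simp add: ac_simps split: if_splits)
  ultimately have "elem_mat N a b e * elem_mat N a b e' = 1\<^sub>m N" "elem_mat N a b e' * elem_mat N a b e = 1\<^sub>m N"
    unfolding elem_mat_mult[OF a] by (simp_all only: elem_mat_0)
  hence "inverts_mat (elem_mat N a b e) (elem_mat N a b e')" "inverts_mat (elem_mat N a b e') (elem_mat N a b e)"
    by (simp_all add: inverts_mat_def) (simp_all add: elem_mat_def)
  thus ?thesis by (auto simp: GL_group_def invertible_mat_def elem_mat_def)
qed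

lemma prod_if_const:
  "finite K \<Longrightarrow> (\<Prod>k\<in>K. if P k then e else 0) = (if \<forall>k\<in>K. P k then e ^ card K else (0 :: complex))"
  by (induction K rule: finite_induct) auto

lemma override_midx:
  "x \<in> midx N n \<Longrightarrow> b < N \<Longrightarrow> K \<subseteq> {1..n} \<Longrightarrow> override_on x (\<lambda>_. b) K \<in> midx N n"
  unfolding midx_def by (rule PiE_I) (auto simp: override_on_def dest: PiE_mem PiE_arb)

text \<open>At each place with letter a there is a choice between the identity part and the entry e,
  which reads the letter b instead; K is the set of places with the second choice.\<close>

lemma act_elem:
  assumes x: "x \<in> midx N n" and ab: "a < N" "b < N"
  shows "act N n (elem_mat N a b e) T x
    = (\<Sum>K\<in>Pow {k\<in>{1..n}. x k = a}. e ^ card K * T (override_on x (\<lambda>_. b) K))"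
proof -
  let ?A = "{1..n}" and ?o = "\<lambda>K. override_on x (\<lambda>_. b) K"
  have F: "(\<Prod>k\<in>?A. elem_mat N a b e $$ (x k, j k))
      = (\<Sum>K\<in>Pow ?A. if K \<subseteq> {k\<in>?A. x k = a} \<and> j = ?o K then e ^ card K else 0)"
    if j: "j \<in> midx N n" for j
  proof -
    have "(\<Prod>k\<in>?A. elem_mat N a b e $$ (x k, j k))
        = (\<Prod>k\<in>?A. (if x k = a \<and> j k = b then e else 0) + (if x k = j k then 1 else 0))"
      using midx_lt[OF x] midx_lt[OF j] by (intro prod.cong) (auto simp: elem_mat_def)
    also have "\<dots> = (\<Sum>K\<in>Pow ?A. (\<Prod>k\<in>K. if x k = a \<and> j k = b then e else 0)
        * (\<Prod>k\<in>?A - K. if x k = j k then 1 else 0))" by (rule prod_add) simp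
    also have "\<dots> = (\<Sum>K\<in>Pow ?A. if K \<subseteq> {k\<in>?A. x k = a} \<and> j = ?o K then e ^ card K else 0)"
    proof (rule sum.cong)
      fix K assume K: "K \<in> Pow ?A"
      hence fin: "finite K" "finite (?A - K)" by (auto intro: finite_subset)
      have "(\<forall>k\<in>K. x k = a \<and> j k = b) \<and> (\<forall>k\<in>?A - K. x k = j k) \<longleftrightarrow>
          K \<subseteq> {k\<in>?A. x k = a} \<and> j = ?o K"
      proof
        assume *: "(\<forall>k\<in>K. x k = a \<and> j k = b) \<and> (\<forall>k\<in>?A - K. x k = j k)"
        have "j = ?o K"
        proof (rule midx_ext[OF j])
          show "?o K \<in> midx N n" using x ab K by (intro override_midx) auto
          show "j k = ?o K k" if "k \<in> ?A" for k using * that by (cases "k \<in> K") (auto simp: override_on_def)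
        qed
        thus "K \<subseteq> {k\<in>?A. x k = a} \<and> j = ?o K" using * K by auto
      qed (use K in \<open>auto simp: override_on_def\<close>)
      thus "(\<Prod>k\<in>K. if x k = a \<and> j k = b then e else 0) * (\<Prod>k\<in>?A - K. if x k = j k then 1 else 0)
          = (if K \<subseteq> {k\<in>?A. x k = a} \<and> j = ?o K then e ^ card K else 0)"
        by (simp add: prod_if_const[OF fin(1)] prod_if_const[OF fin(2)] if_distrib cong: if_cong) auto
    qed simp
    finally show ?thesis .
  qed
  have "act N n (elem_mat N a b e) T x = (\<Sum>j\<in>midx N n. \<Sum>K\<in>Pow ?A.
      (if K \<subseteq> {k\<in>?A. x k = a} \<and> j = ?o K then e ^ card K else 0) * T j)"
    unfolding act_apply[OF x] by (intro sum.cong refl) (simp only: F sum_distrib_right)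
  also have "\<dots> = (\<Sum>K\<in>Pow ?A. \<Sum>j\<in>midx N n.
      (if K \<subseteq> {k\<in>?A. x k = a} \<and> j = ?o K then e ^ card K else 0) * T j)" by (rule sum.swap)
  also have "\<dots> = (\<Sum>K\<in>Pow ?A. if K \<subseteq> {k\<in>?A. x k = a} then e ^ card K * T (?o K) else 0)"
  proof (rule sum.cong)
    fix K assume K: "K \<in> Pow ?A"
    show "(\<Sum>j\<in>midx N n. (if K \<subseteq> {k\<in>?A. x k = a} \<and> j = ?o K then e ^ card K else 0) * T j)
        = (if K \<subseteq> {k\<in>?A. x k = a} then e ^ card K * T (?o K) else 0)"
    proof (cases "K \<subseteq> {k\<in>?A. x k = a}")
      case True
      have "(\<Sum>j\<in>midx N n. (if K \<subseteq> {k\<in>?A. x k = a} \<and> j = ?o K then e ^ card K else 0) * T j)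
          = (\<Sum>j\<in>midx N n. if j = ?o K then e ^ card K * T (?o K) else 0)"
        using True by (intro sum.cong) auto
      thus ?thesis using True override_midx[OF x ab(2), of K] K by (simp add: finite_midx)
    qed auto
  qed simp
  also have "\<dots> = (\<Sum>K\<in>Pow {k\<in>?A. x k = a}. if K \<subseteq> {k\<in>?A. x k = a} then e ^ card K * T (?o K) else 0)"
    by (rule sum.mono_neutral_right) auto
  also have "\<dots> = (\<Sum>K\<in>Pow {k\<in>?A. x k = a}. e ^ card K * T (?o K))"
    by (rule sum.cong) auto
  finally show ?thesis .
qed

text \<open>The coefficient of e^m in the action of 1 + e E_ab (\<open>act_elem_series\<close>); for
  different a and b this is the divided power E_ab^m / m!.\<close>

definition sub_op :: "nat \<Rightarrow> nat \<Rightarrow> nat \<Rightarrow> nat \<Rightarrow> nat \<Rightarrow> tensor \<Rightarrow> tensor" where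
  "sub_op N n m a b T = (\<lambda>x. if x \<in> midx N n
     then \<Sum>K\<in>{K. K \<subseteq> {k\<in>{1..n}. x k = a} \<and> card K = m}. T (override_on x (\<lambda>_. b) K) else 0)"

lemma act_elem_series:
  assumes "a < N" "b < N"
  shows "act N n (elem_mat N a b e) T = (\<Sum>m<Suc n. tscale (e ^ m) (sub_op N n m a b T))"
proof
  fix x :: "nat \<Rightarrow> nat"
  show "act N n (elem_mat N a b e) T x = (\<Sum>m<Suc n. tscale (e ^ m) (sub_op N n m a b T)) x"
  proof (cases "x \<in> midx N n")
    case True
    let ?X = "{k\<in>{1..n}. x k = a}"
    have card: "card K < Suc n" if "K \<in> Pow ?X" for K
    proof -
      have "card K \<le> card {1..n}" using that by (intro card_mono) auto
      thus ?thesis by simp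
    qed
    have "act N n (elem_mat N a b e) T x
        = (\<Sum>m<Suc n. \<Sum>K\<in>{K\<in>Pow ?X. card K = m}. e ^ card K * T (override_on x (\<lambda>_. b) K))"
      unfolding act_elem[OF True assms] using card by (intro sum.group[symmetric]) auto
    also have "\<dots> = (\<Sum>m<Suc n. e ^ m * sub_op N n m a b T x)"
      using True by (intro sum.cong refl) (auto simp: sub_op_def sum_distrib_left intro!: sum.cong)
    finally show ?thesis by (simp only: sum_fun_apply tscale_apply)
  next
    case False
    thus ?thesis by (simp only: sum_fun_apply tscale_apply) (simp add: act_def sub_op_def)
  qed
qed

text \<open>The combination p(2k) - 2^d p(k) removes the top coefficient and multiplies the m-th one
  by 2^m - 2^d, which is not zero.\<close>

lemma poly_coeffs_in_subspace:
  assumes "tensor.subspace U" "\<And>k::nat. k > 0 \<Longrightarrow> (\<Sum>m<d. tscale (of_nat k ^ m) (v m)) \<in> U" "m < d"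
  shows "v m \<in> U"
  using assms(2,3)
proof (induction d arbitrary: v m)
  case (Suc d)
  let ?p = "\<lambda>k::nat. \<Sum>m<Suc d. tscale (of_nat k ^ m) (v m)"
  have lower: "v m \<in> U" if "m < d" for m
  proof -
    have "tscale (2 ^ m - 2 ^ d) (v m) \<in> U"
    proof (rule Suc.IH[OF _ that])
      fix k :: nat assume k: "k > 0"
      have "?p (2 * k) - tscale (2 ^ d) (?p k) = (\<Sum>m<Suc d. tscale (of_nat k ^ m) (tscale (2 ^ m - 2 ^ d) (v m)))"
        by (simp only: pointwise sum_distrib_left sum_subtractf[symmetric])
          (auto intro!: sum.cong simp: power_mult_distrib algebra_simps)
      hence "?p (2 * k) - tscale (2 ^ d) (?p k) = (\<Sum>m<d. tscale (of_nat k ^ m) (tscale (2 ^ m - 2 ^ d) (v m)))"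
        by (simp only: sum.lessThan_Suc) (simp add: pointwise)
      moreover have "?p (2 * k) - tscale (2 ^ d) (?p k) \<in> U"
        using Suc.prems(1)[of "2 * k"] Suc.prems(1)[of k] k assms(1)
        by (intro tensor.subspace_diff tensor.subspace_scale) auto
      ultimately show "(\<Sum>m<d. tscale (of_nat k ^ m) (tscale (2 ^ m - 2 ^ d) (v m))) \<in> U" by simp
    qed
    hence "tscale (1 / (2 ^ m - 2 ^ d)) (tscale (2 ^ m - 2 ^ d) (v m)) \<in> U"
      by (rule tensor.subspace_scale[OF assms(1)])
    moreover
    have "(2 ^ m - 2 ^ d :: complex) \<noteq> 0"
    proof -
      have "(2 :: nat) ^ m \<noteq> 2 ^ d" using that by simp
      hence "(of_nat (2 ^ m) :: complex) \<noteq> of_nat (2 ^ d)" by (simp only: of_nat_eq_iff not_False_eq_True)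
      thus ?thesis by simp
    qed
    hence "tscale (1 / (2 ^ m - 2 ^ d)) (tscale (2 ^ m - 2 ^ d) (v m)) = v m"
      by (simp only: tensor.scale_scale) (simp add: pointwise)
    ultimately show ?thesis by metis
  qed
  show ?case
  proof (cases "m = d")
    case True
    have "v d = ?p 1 - (\<Sum>m<d. v m)" by (simp add: tscale_def)
    moreover have "(\<Sum>m<d. v m) \<in> U" using lower by (intro tensor.subspace_sum[OF assms(1)]) simp
    hence "?p 1 - (\<Sum>m<d. v m) \<in> U" using Suc.prems(1)[of 1] by (intro tensor.subspace_diff[OF assms(1)]) simp
    ultimately have "v d \<in> U" by metis
    thus ?thesis using True by (simp only:)
  qed (use lower Suc.prems(2) in auto)
qed simp

lemma sub_op_in_subrep:
  assumes "subrep N n (GL_group N) U" "T \<in> U" "a < N" "b < N" "m \<le> n"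
  shows "sub_op N n m a b T \<in> U"
proof (rule poly_coeffs_in_subspace[where d = "Suc n" and v = "\<lambda>m. sub_op N n m a b T"])
  show "tensor.subspace U" using assms(1) by (simp add: subrep_def)
  show "(\<Sum>m<Suc n. tscale (of_nat k ^ m) (sub_op N n m a b T)) \<in> U" if "k > 0" for k
  proof -
    \<comment> \<open>The parameter must avoid -1, where a diagonal elementary matrix is singular;
      positive integers do and suffice for the interpolation.\<close>
    have "of_nat k \<noteq> (- 1 :: complex)" by (metis of_nat_0_le_iff of_nat_Suc of_nat_neq_0 add.commute neg_eq_iff_add_eq_0)
    hence "elem_mat N a b (of_nat k) \<in> GL_group N" using assms by (intro elem_mat_GL) auto
    hence "act N n (elem_mat N a b (of_nat k)) T \<in> U" using assms(1,2) by (simp add: subrep_def)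
    thus ?thesis by (simp only: act_elem_series[OF assms(3,4)])
  qed
qed (use assms in auto)

lemma sub_op_1:
  assumes "x \<in> midx N n" shows "sub_op N n 1 b a T x = replace_op {1..n} a b T x"
proof -
  have "{K. K \<subseteq> {k\<in>{1..n}. x k = b} \<and> card K = 1} = (\<lambda>k. {k}) ` {k\<in>{1..n}. x k = b}"
    by (auto simp: card_1_singleton_iff)
  moreover have "override_on x (\<lambda>_. a) {k} = x(k := a)" for k
    by (auto simp: override_on_def fun_eq_iff)
  ultimately show ?thesis using assms
    by (simp add: sub_op_def replace_op_def sum.reindex inj_on_def)
qed

section \<open>Irreducibility of the space of tensors with the column relations\<close>

definition garnir_tensors :: "nat \<Rightarrow> nat \<Rightarrow> nat list list \<Rightarrow> tensor set" where
  "garnir_tensors N n cs = {T \<in> tensors N n. garnir cs T}"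

lemma garnir_add_scale:
  "garnir cs 0" "garnir cs S \<Longrightarrow> garnir cs T \<Longrightarrow> garnir cs (S + T)" "garnir cs T \<Longrightarrow> garnir cs (tscale c T)"
proof (induction cs)
  case (Cons b cs)
  {
    case 1 show ?case using Cons(1)
      by (auto simp: alternating_def lin_zero[OF lin_P] lin_zero[OF lin_PS])
  next
    case 2 thus ?case using Cons(2)
      by (auto simp: alternating_def lin_add[OF lin_P] lin_add[OF lin_PS])
  next
    case 3 thus ?case using Cons(3)
      by (auto simp: alternating_def lin_scale[OF lin_P] lin_scale[OF lin_PS])
  }
qed auto

lemma subrep_garnir_tensors:
  "set (concat cs) \<subseteq> {1..n} \<Longrightarrow> subrep N n G (garnir_tensors N n cs)"
  by (auto simp: subrep_def garnir_tensors_def garnir_act tensors_act garnir_add_scale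
      tensors_0 tensors_add tensors_scale intro!: tensor.subspaceI)

text \<open>Take a non-zero element of U whose largest letter sum is least possible. Raising
  operators preserve U (\<open>sub_op\<close> with m = 1) and lower this sum, so they annihilate it,
  and \<open>raised_garnir_min_sum\<close> puts it into the least degree.\<close>

lemma highest_weight_tensor_in_subrep:
  assumes cs: "distinct (concat cs)" "set (concat cs) = {1..n}" and z: "row_word cs z" "z \<in> midx N n"
    and U: "subrep N n (GL_group N) U" "U \<subseteq> garnir_tensors N n cs" "U \<noteq> {0}"
  shows "col_tensor cs z \<in> U"
proof -
  have sub: "tensor.subspace U" using U(1) by (simp add: subrep_def)
  define P where "P m \<longleftrightarrow> (\<exists>u\<in>U. u \<noteq> 0 \<and> (\<forall>x. u x \<noteq> 0 \<longrightarrow> (\<Sum>k\<in>{1..n}. x k) \<le> m))" for m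
  obtain u0 where u0: "u0 \<in> U" "u0 \<noteq> 0" using U(3) tensor.subspace_0[OF sub] by blast
  have "P (n * N)" unfolding P_def
  proof (intro bexI[OF _ u0(1)] conjI u0(2) allI impI)
    fix x assume "u0 x \<noteq> 0"
    hence x: "x \<in> midx N n" using u0(1) U(2) by (auto simp: garnir_tensors_def tensors_def)
    have "(\<Sum>k\<in>{1..n}. x k) \<le> (\<Sum>k\<in>{1..n}. N)" using midx_lt[OF x] by (intro sum_mono) (auto simp: less_imp_le)
    thus "(\<Sum>k\<in>{1..n}. x k) \<le> n * N" by simp
  qed
  hence "P (LEAST m. P m)" by (rule LeastI)
  then obtain u where u: "u \<in> U" "u \<noteq> 0" "\<And>x. u x \<noteq> 0 \<Longrightarrow> (\<Sum>k\<in>{1..n}. x k) \<le> (LEAST m. P m)"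
    unfolding P_def by blast
  have uT: "u \<in> tensors N n" "garnir cs u" using u(1) U(2) by (auto simp: garnir_tensors_def)
  have upd: "x(j := b) \<in> midx N n" if "x(j := a) \<in> midx N n" "j \<in> {1..n}" "b < N" for x :: "nat \<Rightarrow> nat" and j a b
    using midx_upd[OF that(1,2,3)] by simp
  have "replace_op {1..n} a b u = 0" if "b < a" for a b
  proof (rule ccontr)
    assume nz: "replace_op {1..n} a b u \<noteq> 0"
    then obtain x where x: "replace_op {1..n} a b u x \<noteq> 0" by (auto simp: pointwise)
    have witness: "\<exists>j\<in>{1..n}. y j = b \<and> u (y(j := a)) \<noteq> 0" if "replace_op {1..n} a b u y \<noteq> 0" for y
    proof (rule ccontr)
      assume "\<not> ?thesis"
      hence "replace_op {1..n} a b u y = 0" unfolding replace_op_def by (intro sum.neutral) auto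
      thus False using that by simp
    qed
    have mid: "y \<in> midx N n \<and> a < N" if y: "replace_op {1..n} a b u y \<noteq> 0" for y
    proof -
      obtain j where j: "j \<in> {1..n}" "y j = b" "u (y(j := a)) \<noteq> 0" using witness[OF y] by auto
      have ya: "y(j := a) \<in> midx N n" using uT(1) j(3) by (auto simp: tensors_def)
      have "a < N" using midx_lt[OF ya j(1)] by simp
      moreover have "y(j := b) \<in> midx N n" using upd[OF ya j(1), of b] \<open>b < a\<close> \<open>a < N\<close> by simp
      moreover have "y(j := b) = y" using j(2) by auto
      ultimately show ?thesis by simp
    qed
    have a: "a < N" using mid[OF x] by simp
    have "replace_op {1..n} a b u = sub_op N n 1 b a u"
    proof
      fix y show "replace_op {1..n} a b u y = sub_op N n 1 b a u y"
        using mid[of y] sub_op_1[of y N n b a u] by (cases "y \<in> midx N n") (auto simp: sub_op_def)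
    qed
    moreover have "1 \<le> n" using witness[OF x] by auto
    ultimately have "replace_op {1..n} a b u \<in> U"
      using sub_op_in_subrep[OF U(1) u(1), of b a 1] a \<open>b < a\<close> by simp
    moreover have "(\<Sum>k\<in>{1..n}. y k) \<le> (LEAST m. P m) - 1 \<and> 0 < (LEAST m. P m)"
      if y: "replace_op {1..n} a b u y \<noteq> 0" for y
    proof -
      obtain j where j: "j \<in> {1..n}" "y j = b" "u (y(j := a)) \<noteq> 0" using witness[OF y] by auto
      have "(\<Sum>k\<in>{1..n}. (y(j := a)) k) + b = (\<Sum>k\<in>{1..n}. y k) + a"
        using sum_fun_upd_nat[of "{1..n}" j y a] j by simp
      thus ?thesis using u(3)[OF j(3)] \<open>b < a\<close> by linarith
    qed
    ultimately have "P ((LEAST m. P m) - 1)" "0 < (LEAST m. P m)" unfolding P_def using nz x by blast+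
    thus False using not_less_Least[of "(LEAST m. P m) - 1" P] by simp
  qed
  hence raised: "raised (set (concat cs)) u" by (simp add: raised_def cs(2))
  have supp: "(\<forall>k. k \<notin> set (concat cs) \<longrightarrow> x k = z k) \<and> (\<Sum>k\<in>set (concat cs). x k) = min_sum cs"
    if "u x \<noteq> 0" for x
  proof -
    have "x \<in> midx N n" using uT(1) that by (auto simp: tensors_def)
    hence "x k = z k" if "k \<notin> {1..n}" for k
      using that z(2) by (auto simp: midx_def PiE_def extensional_def)
    thus ?thesis using raised_garnir_min_sum[OF uT(2) cs(1) raised that] by (simp add: cs(2))
  qed
  have u_eq: "u = tscale (u z) (col_tensor cs z)"
    by (rule eq_scale_col_tensor[OF cs(1) garnir_alternating[OF uT(2)] supp z(1)])
  have "u x = u z * col_tensor cs z x" for x by (subst u_eq) (rule tscale_apply)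
  hence "u z \<noteq> 0" using u(2) by (metis ext mult_zero_left zero_fun_apply)
  have "tscale (1 / u z) u = tscale (1 / u z) (tscale (u z) (col_tensor cs z))"
    using u_eq by (rule arg_cong)
  also have "\<dots> = col_tensor cs z" using \<open>u z \<noteq> 0\<close> by (simp add: pointwise)
  finally show ?thesis using tensor.subspace_scale[OF sub u(1), of "1 / u z"] by metis
qed

text \<open>For a proper non-zero subrepresentation the orthogonal complement would be non-zero and
  invariant too, as adjoints of invertible matrices are invertible. Both would contain the same
  highest weight tensor, which would be orthogonal to itself.\<close>

lemma irreducible_garnir_tensors:
  assumes cs: "distinct (concat cs)" "set (concat cs) = {1..n}" and z: "row_word cs z" "z \<in> midx N n"
    and T0: "garnir cs (col_tensor cs z)"
  shows "irreducible_subrep N n (GL_group N) (garnir_tensors N n cs)"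
proof -
  let ?V = "garnir_tensors N n cs" and ?T = "col_tensor cs z"
  have V: "subrep N n (GL_group N) ?V" by (rule subrep_garnir_tensors) (simp add: cs)
  have T: "?T \<in> tensors N n" by (rule tensors_col_tensor) (use cs z in auto)
  have Tz: "?T z = 1" by (rule col_tensor_at[OF cs(1) row_word_image(2)[OF z(1)]])
  hence T_nz: "?T \<noteq> 0" by (metis zero_fun_apply zero_neq_one)
  have "?T \<in> ?V" using T T0 by (simp add: garnir_tensors_def)
  hence "?V \<noteq> {0}" using T_nz by auto
  moreover have "U = {0} \<or> U = ?V" if U: "subrep N n (GL_group N) U" "U \<subseteq> ?V" for U
  proof (rule ccontr)
    assume "\<not> (U = {0} \<or> U = ?V)"
    then obtain v where v: "U \<noteq> {0}" "v \<in> ?V" "v \<notin> U" using U(2) by blast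
    have subU: "tensor.subspace U" "U \<subseteq> tensors N n" using U(1) by (auto simp: subrep_def)
    obtain p where p: "p \<in> U" "\<forall>u\<in>U. herm N n u (v - p) = 0"
      using ex_orthogonal_projection[OF subU, of v] by blast
    define W where "W = {w \<in> ?V. \<forall>u\<in>U. herm N n u w = 0}"
    have "tensor.subspace ?V" using V by (simp add: subrep_def)
    have W: "subrep N n (GL_group N) W"
      unfolding subrep_def
    proof (intro conjI ballI)
      show "W \<subseteq> tensors N n" using V by (auto simp: W_def subrep_def)
      show "tensor.subspace W"
        using \<open>tensor.subspace ?V\<close>
        by (auto simp: W_def tensor.subspace_def herm_lin)
      fix g w assume g: "g \<in> GL_group N" and w: "w \<in> W"
      have "herm N n u (act N n g w) = 0" if "u \<in> U" for u
      proof -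
        have "act N n (adjoint N g) u \<in> U" using U(1) that adjoint_GL[OF g] by (simp add: subrep_def)
        thus ?thesis using w by (simp add: herm_act W_def)
      qed
      thus "act N n g w \<in> W" using V w g by (auto simp: W_def subrep_def)
    qed
    have "v - p \<in> W"
      using p v(2) U(2) tensor.subspace_diff[OF \<open>tensor.subspace ?V\<close>] by (auto simp: W_def)
    moreover have "v - p \<noteq> 0" using p(1) v(3) by auto
    ultimately have "W \<noteq> {0}" by auto
    hence "?T \<in> W" by (intro highest_weight_tensor_in_subrep[OF cs z W]) (auto simp: W_def)
    moreover have "?T \<in> U" by (rule highest_weight_tensor_in_subrep[OF cs z U v(1)])
    ultimately have "herm N n ?T ?T = 0" by (simp add: W_def)
    thus False using T_nz herm_self_eq_0[OF T] by simp
  qed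
  ultimately show ?thesis using V by (simp add: irreducible_subrep_def)
qed

subsection \<open>Highest weight vectors\<close>

definition unipotent :: "nat \<Rightarrow> complex mat \<Rightarrow> bool" where
  "unipotent N g \<longleftrightarrow> g \<in> carrier_mat N N \<and> upper_triangular g \<and> (\<forall>a<N. g $$ (a, a) = 1)"

text \<open>An upper triangular matrix can only lower letters, whereas alternation forbids letter
  sums below the minimum. So the result is a multiple of the tensor, and at z only the diagonal
  entries contribute, giving the factor 1.\<close>

lemma unipotent_col_tensor:
  assumes cs: "distinct (concat cs)" "set (concat cs) = {1..n}" and z: "row_word cs z" "z \<in> midx N n"
    and g: "unipotent N g"
  shows "act N n g (col_tensor cs z) = col_tensor cs z"
proof -
  let ?T = "col_tensor cs z"
  have g': "x k \<le> j k" if "(\<Prod>k\<in>{1..n}. g $$ (x k, j k)) \<noteq> 0" "x \<in> midx N n" "k \<in> {1..n}" for x j k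
  proof (rule ccontr)
    assume "\<not> x k \<le> j k"
    hence "g $$ (x k, j k) = 0" using g midx_lt[OF that(2,3)] by (auto simp: unipotent_def upper_triangular_def)
    thus False using that(1,3) by (auto simp: prod_zero_iff)
  qed
  have le: "(\<Sum>k\<in>{1..n}. x k) \<le> min_sum cs \<and> ((\<Sum>k\<in>{1..n}. x k) = min_sum cs \<longrightarrow> j = x)"
    if "x \<in> midx N n" "j \<in> midx N n" "(\<Prod>k\<in>{1..n}. g $$ (x k, j k)) * ?T j \<noteq> 0" for x j
  proof -
    have nz: "(\<Prod>k\<in>{1..n}. g $$ (x k, j k)) \<noteq> 0" "?T j \<noteq> 0" using that(3) by auto
    have s: "(\<Sum>k\<in>{1..n}. j k) = min_sum cs"
      using col_tensor_support[OF nz(2) subset_refl] row_word_sum[OF z(1) cs(1)] by (simp add: cs(2))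
    have xj: "x k \<le> j k" if "k \<in> {1..n}" for k using g'[OF nz(1) \<open>x \<in> midx N n\<close> that] .
    have "(\<Sum>k\<in>{1..n}. x k) \<le> (\<Sum>k\<in>{1..n}. j k)" using xj by (intro sum_mono)
    moreover have "j = x" if "(\<Sum>k\<in>{1..n}. x k) = (\<Sum>k\<in>{1..n}. j k)"
    proof (rule midx_ext[OF \<open>j \<in> midx N n\<close> \<open>x \<in> midx N n\<close>])
      fix k assume k: "k \<in> {1..n}"
      show "j k = x k"
      proof (rule ccontr)
        assume "j k \<noteq> x k"
        hence "x k < j k" using xj[OF k] by simp
        hence "(\<Sum>k\<in>{1..n}. x k) < (\<Sum>k\<in>{1..n}. j k)" using xj k by (intro sum_strict_mono_ex1) auto
        thus False using that by simp
      qed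
    qed
    ultimately show ?thesis using s by simp
  qed
  have alt: "alternating (set c) (act N n g ?T)" if "c \<in> set cs" for c
  proof -
    have "set c \<subseteq> set (concat cs)" using that by (auto simp: set_concat)
    hence "set c \<subseteq> {1..n}" by (simp only: cs(2))
    from commutes_on_alternating[OF commutes_on_mono[OF commutes_on_act this] alternating_col_tensor[OF cs(1) that]]
    show ?thesis .
  qed
  have supp: "(\<forall>k. k \<notin> set (concat cs) \<longrightarrow> x k = z k) \<and> (\<Sum>k\<in>set (concat cs). x k) = min_sum cs"
    if "act N n g ?T x \<noteq> 0" for x
  proof -
    have x: "x \<in> midx N n" using that by (auto simp: act_def split: if_splits)
    have "\<exists>j\<in>midx N n. (\<Prod>k\<in>{1..n}. g $$ (x k, j k)) * ?T j \<noteq> 0"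
    proof (rule ccontr)
      assume "\<not> ?thesis"
      hence "act N n g ?T x = 0" unfolding act_apply[OF x] by (intro sum.neutral) blast
      thus False using that by simp
    qed
    then obtain j where j: "j \<in> midx N n" "(\<Prod>k\<in>{1..n}. g $$ (x k, j k)) * ?T j \<noteq> 0" by blast
    have "min_sum cs \<le> (\<Sum>k\<in>set (concat cs). x k)"
      by (rule alternating_min_sum(1)[where T = "act N n g ?T", OF cs(1) alt that])
    moreover have "x k = z k" if "k \<notin> {1..n}" for k
      using that z(2) x by (auto simp: midx_def PiE_def extensional_def)
    ultimately show ?thesis using le[OF x j] by (simp add: cs(2))
  qed
  have "act N n g ?T = tscale (act N n g ?T z) ?T"
    by (rule eq_scale_col_tensor[where T = "act N n g ?T", OF cs(1) alt supp z(1)])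
  moreover have "act N n g ?T z = 1"
  proof -
    have 0: "(\<Prod>k\<in>{1..n}. g $$ (z k, j k)) * ?T j = 0" if "j \<in> midx N n - {z}" for j
      using le[OF z(2), of j] that row_word_sum[OF z(1) cs(1)] by (auto simp: cs(2))
    have "act N n g ?T z = (\<Prod>k\<in>{1..n}. g $$ (z k, z k)) * ?T z
        + (\<Sum>j\<in>midx N n - {z}. (\<Prod>k\<in>{1..n}. g $$ (z k, j k)) * ?T j)"
      unfolding act_apply[OF z(2)] by (rule sum.remove[OF finite_midx z(2)])
    also have "(\<Sum>j\<in>midx N n - {z}. (\<Prod>k\<in>{1..n}. g $$ (z k, j k)) * ?T j) = 0"
      by (rule sum.neutral) (use 0 in blast)
    finally have "act N n g ?T z = (\<Prod>k\<in>{1..n}. g $$ (z k, z k)) * ?T z" by simp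
    moreover have "(\<Prod>k\<in>{1..n}. g $$ (z k, z k)) = 1"
      using g midx_lt[OF z(2)] by (intro prod.neutral) (auto simp: unipotent_def)
    moreover have "?T z = 1" by (rule col_tensor_at[OF cs(1) row_word_image(2)[OF z(1)]])
    ultimately show ?thesis by simp
  qed
  ultimately show ?thesis by simp
qed

text \<open>The letter a occurs exactly once in every column longer than a.\<close>

lemma prod_concat:
  fixes f :: "nat \<Rightarrow> complex"
  assumes "distinct (concat cs)" "\<And>c. c \<in> set cs \<Longrightarrow> x ` set c = {..<length c} \<and> inj_on x (set c)"
    "\<And>c. c \<in> set cs \<Longrightarrow> length c \<le> N"
  shows "(\<Prod>k\<in>set (concat cs). f (x k)) = (\<Prod>a<N. f a ^ length (filter (\<lambda>c. a < length c) cs))"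
  using assms
proof (induction cs)
  case (Cons c cs)
  have "(\<Prod>k\<in>set c. f (x k)) = (\<Prod>a\<in>x ` set c. f a)"
    using Cons.prems(2)[of c] by (subst prod.reindex) auto
  also have "\<dots> = (\<Prod>a\<in>{..<N} \<inter> {a. a < length c}. f a)"
    using Cons.prems(2)[of c] Cons.prems(3)[of c] by (intro prod.cong) auto
  also have "\<dots> = (\<Prod>a<N. if a < length c then f a else 1)"
    by (subst prod.inter_restrict) auto
  finally have c: "(\<Prod>k\<in>set c. f (x k)) = (\<Prod>a<N. if a < length c then f a else 1)" .
  have "set (concat (c # cs)) = set c \<union> set (concat cs)" "set c \<inter> set (concat cs) = {}"
    using Cons.prems(1) by auto
  hence "(\<Prod>k\<in>set (concat (c # cs)). f (x k)) = (\<Prod>k\<in>set c. f (x k)) * (\<Prod>k\<in>set (concat cs). f (x k))"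
    by (simp only: prod.union_disjoint finite_set)
  also have "(\<Prod>k\<in>set (concat cs). f (x k)) = (\<Prod>a<N. f a ^ length (filter (\<lambda>c. a < length c) cs))"
    using Cons.prems by (intro Cons.IH) auto
  finally show ?case
    by (simp only: c prod.distrib[symmetric]) (auto intro!: prod.cong)
qed simp

lemma highest_weight_col_tensor:
  assumes cs: "distinct (concat cs)" "set (concat cs) = {1..n}" and z: "row_word cs z" "z \<in> midx N n"
    and len: "\<And>c. c \<in> set cs \<Longrightarrow> length c \<le> N"
    and lam: "\<And>a. a < N \<Longrightarrow> length (filter (\<lambda>c. a < length c) cs) = part lam (Suc a)"
  shows "highest_weight_vector N n lam (col_tensor cs z)"
  unfolding highest_weight_vector_def
proof (intro conjI ballI allI impI)
  let ?T = "col_tensor cs z"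
  have T: "?T \<in> tensors N n" by (rule tensors_col_tensor) (use cs z in auto)
  have "?T z = 1" by (rule col_tensor_at[OF cs(1) row_word_image(2)[OF z(1)]])
  thus "?T \<noteq> 0" by (metis zero_fun_apply zero_neq_one)
  show "act N n g ?T = ?T"
    if "g \<in> carrier_mat N N" "upper_triangular g \<and> (\<forall>a<N. g $$ (a, a) = 1)" for g
    using that by (intro unipotent_col_tensor[OF cs z]) (simp add: unipotent_def)
  fix f :: "nat \<Rightarrow> complex"
  show "act N n (mat_diag N f) ?T = tscale (\<Prod>a<N. f a ^ part lam (Suc a)) ?T"
  proof
    fix x
    show "act N n (mat_diag N f) ?T x = tscale (\<Prod>a<N. f a ^ part lam (Suc a)) ?T x"
    proof (cases "?T x = 0 \<or> x \<notin> midx N n")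
      case True
      have "act N n (mat_diag N f) ?T x = (\<Prod>k\<in>{1..n}. mat_diag N f $$ (x k, x k)) * ?T x" if "x \<in> midx N n"
        by (rule act_diag[OF that]) (simp add: mat_diag_def)
      thus ?thesis using True T by (auto simp: tscale_apply tensors_def act_def)
    next
      case False
      hence x: "x \<in> midx N n" and nz: "?T x \<noteq> 0" by auto
      have alt: "alternating (set c) ?T" if "c \<in> set cs" for c by (rule alternating_col_tensor[OF cs(1) that])
      have sum: "(\<Sum>k\<in>set (concat cs). x k) = min_sum cs"
        using col_tensor_support[OF nz subset_refl] row_word_sum[OF z(1) cs(1)] by simp
      have "x ` set c = {..<length c}" if "c \<in> set cs" for c
        by (rule alternating_min_sum(2)[where T = ?T, OF cs(1) alt nz sum that])
      moreover have "inj_on x (set c)" if "c \<in> set cs" for c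
        using alt[OF that] nz by (rule alternating_inj_on)
      ultimately have img: "x ` set c = {..<length c} \<and> inj_on x (set c)" if "c \<in> set cs" for c
        using that by blast
      have "act N n (mat_diag N f) ?T x = (\<Prod>k\<in>{1..n}. mat_diag N f $$ (x k, x k)) * ?T x"
        by (rule act_diag[OF x]) (simp add: mat_diag_def)
      also have "(\<Prod>k\<in>{1..n}. mat_diag N f $$ (x k, x k)) = (\<Prod>k\<in>set (concat cs). f (x k))"
        unfolding cs(2) using midx_lt[OF x] by (intro prod.cong refl) (simp add: mat_diag_def)
      also have "\<dots> = (\<Prod>a<N. f a ^ length (filter (\<lambda>c. a < length c) cs))"
        by (rule prod_concat[OF cs(1) img len])
      also have "\<dots> = (\<Prod>a<N. f a ^ part lam (Suc a))" using lam by (intro prod.cong) auto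
      finally show ?thesis by (simp add: tscale_apply)
    qed
  qed
qed

lemma highest_weight_tensors: "highest_weight_vector N n lam T \<Longrightarrow> T \<in> tensors N n"
proof -
  assume "highest_weight_vector N n lam T"
  moreover have "upper_triangular (1\<^sub>m N :: complex mat)" by (auto simp: upper_triangular_def)
  ultimately have "act N n (1\<^sub>m N) T = T" unfolding highest_weight_vector_def by auto
  thus ?thesis using tensors_act by metis
qed

subsection \<open>Matrix coefficients of highest weight vectors\<close>

text \<open>The right factor v fixes T, and the adjoint moves the left factor onto the other
  argument T, which u fixes as well.\<close>

lemma herm_act_unipotent:
  assumes T: "highest_weight_vector N n lam T" and u: "unipotent N u" "unipotent N v" and g: "g \<in> carrier_mat N N"
  shows "herm N n T (act N n (adjoint N u * (g * v)) T) = herm N n T (act N n g T)"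
proof -
  have T_fixed: "act N n w T = T" if "unipotent N w" for w
    using T that by (simp add: highest_weight_vector_def unipotent_def)
  have c: "u \<in> carrier_mat N N" "v \<in> carrier_mat N N" using u by (auto simp: unipotent_def)
  have "act N n (adjoint N u * (g * v)) T = act N n (adjoint N u) (act N n g T)"
    using c g by (simp add: act_mult[of _ N] T_fixed[OF u(2)])
  thus ?thesis by (simp add: herm_act[of N n T "adjoint N u"] adjoint_adjoint[OF c(1)] T_fixed[OF u(1)])
qed

lemma sum_unipotent_row:
  fixes a :: "nat \<Rightarrow> complex"
  assumes "j < N" "k < N"
  shows "(\<Sum>m\<in>{0..<N}. a m * (if m = j then 1 else if m = k \<and> k < j then e else 0))
    = a j + (if k < j then a k * e else 0)"
proof -
  have "a m * (if m = j then 1 else if m = k \<and> k < j then e else 0)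
      = (if m = j then a m else 0) + (if m = k then if k < j then a k * e else 0 else 0)" for m
    by auto
  thus ?thesis using assms by (simp add: sum.distrib)
qed

text \<open>Its vanishing says that the coefficients of g at S and at T agree after division by the
  squared norms.\<close>

definition coeff_defect :: "nat \<Rightarrow> nat \<Rightarrow> tensor \<Rightarrow> tensor \<Rightarrow> complex mat \<Rightarrow> complex" where
  "coeff_defect N n S T g = herm N n S (act N n g S) * herm N n T T - herm N n T (act N n g T) * herm N n S S"

lemma isCont_herm_act:
  assumes g: "g \<in> carrier_mat N N"
  shows "isCont (\<lambda>t. herm N n S (act N n (mat N N (\<lambda>(i, j). g $$ (i, j) + (if i = k \<and> j = k then 1 else 0) * t)) S)) 0"
proof -
  have "herm N n S (act N n (mat N N (\<lambda>(i, j). g $$ (i, j) + (if i = k \<and> j = k then 1 else 0) * t)) S)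
      = (\<Sum>x\<in>midx N n. cnj (S x) * (\<Sum>j\<in>midx N n.
          (\<Prod>q\<in>{1..n}. g $$ (x q, j q) + (if x q = k \<and> j q = k then 1 else 0) * t) * S j))" for t
    unfolding herm_def
  proof (rule sum.cong[OF refl])
    fix x assume x: "x \<in> midx N n"
    have "(\<Prod>q\<in>{1..n}. mat N N (\<lambda>(i, j). g $$ (i, j) + (if i = k \<and> j = k then 1 else 0) * t) $$ (x q, j q))
        = (\<Prod>q\<in>{1..n}. g $$ (x q, j q) + (if x q = k \<and> j q = k then 1 else 0) * t)" if "j \<in> midx N n" for j
      using midx_lt[OF x] midx_lt[OF that] by (intro prod.cong refl) simp
    thus "cnj (S x) * act N n (mat N N (\<lambda>(i, j). g $$ (i, j) + (if i = k \<and> j = k then 1 else 0) * t)) S x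
      = cnj (S x) * (\<Sum>j\<in>midx N n.
          (\<Prod>q\<in>{1..n}. g $$ (x q, j q) + (if x q = k \<and> j q = k then 1 else 0) * t) * S j)"
      unfolding act_apply[OF x] by (intro arg_cong[of _ _ "\<lambda>y. _ * y"] sum.cong refl) simp
  qed
  thus ?thesis by (simp only:) (intro continuous_intros)
qed

text \<open>Gaussian elimination by unipotent matrices, with a perturbation of vanishing pivots, reduces
  to diagonal matrices, on which the weight determines the coefficient.\<close>

lemma coeff_defect_pivots:
  assumes S: "highest_weight_vector N n lam S" and T: "highest_weight_vector N n lam T"
  shows "g \<in> carrier_mat N N \<Longrightarrow> k \<le> N \<Longrightarrow>
    (\<forall>i<N. \<forall>j<N. i \<noteq> j \<and> (i < k \<or> j < k) \<longrightarrow> g $$ (i, j) = 0) \<Longrightarrow> (\<forall>i<k. g $$ (i, i) \<noteq> 0) \<Longrightarrow>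
    coeff_defect N n S T g = 0"
proof (induction "N - k" arbitrary: k g)
  case 0
  have "g = mat_diag N (\<lambda>a. g $$ (a, a))"
    using 0 by (intro eq_matI) (auto simp: mat_diag_def)
  moreover have "\<forall>a<N. g $$ (a, a) \<noteq> 0" using 0 by auto
  ultimately have "act N n g S = tscale (\<Prod>a<N. (g $$ (a, a)) ^ part lam (Suc a)) S"
    "act N n g T = tscale (\<Prod>a<N. (g $$ (a, a)) ^ part lam (Suc a)) T"
    using S T unfolding highest_weight_vector_def by metis+
  thus ?case by (simp add: coeff_defect_def herm_lin)
next
  case (Suc d)
  have k: "k < N" "d = N - Suc k" using Suc.hyps(2) by auto
  have pivot: "coeff_defect N n S T h = 0"
    if h: "h \<in> carrier_mat N N" and clean: "\<And>i j. i < N \<Longrightarrow> j < N \<Longrightarrow> i \<noteq> j \<Longrightarrow> i < k \<or> j < k \<Longrightarrow> h $$ (i, j) = 0"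
      and diag: "\<And>i. i \<le> k \<Longrightarrow> h $$ (i, i) \<noteq> 0" for h
  proof -
    define p where "p = h $$ (k, k)"
    have p: "p \<noteq> 0" using diag[of k] by (simp add: p_def)
    \<comment> \<open>The right factor v clears the rest of row k. The adjoint of u, a lower
      triangular matrix, clears the rest of column k; the conjugation in u compensates that of the
      adjoint.\<close>
    define u where "u = mat N N (\<lambda>(i, j). if i = j then 1 else if i = k \<and> k < j then cnj (- h $$ (j, k) / p) else 0)"
    define v where "v = mat N N (\<lambda>(i, j). if i = j then 1 else if i = k \<and> k < j then - h $$ (k, j) / p else 0)"
    define w where "w = h * v"
    have uni: "unipotent N u" "unipotent N v" by (auto simp: unipotent_def u_def v_def upper_triangular_def)
    have wc: "w \<in> carrier_mat N N" using h by (simp add: w_def v_def)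
    have w: "w $$ (i, j) = h $$ (i, j) + (if k < j then h $$ (i, k) * (- h $$ (k, j) / p) else 0)"
      if "i < N" "j < N" for i j
    proof -
      have "w $$ (i, j) = (\<Sum>m\<in>{0..<N}. h $$ (i, m) * (if m = j then 1 else if m = k \<and> k < j then - h $$ (k, j) / p else 0))"
        using that h by (simp add: w_def v_def scalar_prod_def)
      thus ?thesis using sum_unipotent_row[OF that(2) k(1)] by simp
    qed
    have au: "(adjoint N u * w) $$ (i, j) = w $$ (i, j) + (if k < i then w $$ (k, j) * (- h $$ (i, k) / p) else 0)"
      if "i < N" "j < N" for i j
    proof -
      have "(adjoint N u * w) $$ (i, j) = (\<Sum>m\<in>{0..<N}. w $$ (m, j) * (if m = i then 1 else if m = k \<and> k < i then - h $$ (i, k) / p else 0))"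
        using that wc by (auto simp: adjoint_def u_def scalar_prod_def intro!: sum.cong)
      thus ?thesis using sum_unipotent_row[OF that(1) k(1)] by simp
    qed
    have wk: "w $$ (k, j) = (if j = k then p else 0)" if "j < N" for j
      using w[OF k(1) that] clean[OF k(1) that] p that by (cases j k rule: linorder_cases) (auto simp: p_def)
    have a: "(adjoint N u * w) $$ (i, j) = 0" if ij: "i < N" "j < N" "i \<noteq> j" "i < Suc k \<or> j < Suc k" for i j
    proof -
      consider "j = k" | "i = k" | "i < k" | "j < k" using ij(4) by linarith
      thus ?thesis
      proof cases
        case 1 thus ?thesis
          using au[OF ij(1,2)] w[OF ij(1,2)] wk[OF k(1)] clean[OF ij(1) k(1)] ij(3) p by (cases "i < k") auto
      next
        case 2 thus ?thesis using au[OF ij(1,2)] wk[OF ij(2)] ij(3) by simp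
      next
        case 3 thus ?thesis
          using au[OF ij(1,2)] w[OF ij(1,2)] clean[OF ij(1,2,3)] clean[OF ij(1) k(1)] by simp
      next
        case 4 thus ?thesis
          using au[OF ij(1,2)] w[OF ij(1,2)] clean[OF ij(1,2,3)] wk[OF ij(2)] by simp
      qed
    qed
    have d: "(adjoint N u * w) $$ (i, i) \<noteq> 0" if "i < Suc k" for i
    proof (cases "i = k")
      case True thus ?thesis using au[of k k] wk[of k] k p by simp
    next
      case False
      hence "i < k" "i < N" using that k by auto
      thus ?thesis using au[of i i] w[of i i] diag[of i] by simp
    qed
    have "coeff_defect N n S T (adjoint N u * w) = 0"
      by (rule Suc.hyps(1)[OF k(2)]) (use a d k mult_carrier_mat[OF adjoint_carrier wc] in auto)
    moreover have "coeff_defect N n S T (adjoint N u * w) = coeff_defect N n S T h"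
      unfolding coeff_defect_def w_def
      by (simp only: herm_act_unipotent[OF S uni h] herm_act_unipotent[OF T uni h])
    ultimately show ?thesis by simp
  qed
  define m where "m t = mat N N (\<lambda>(i, j). g $$ (i, j) + (if i = k \<and> j = k then 1 else 0) * t)" for t
  have m0: "m 0 = g" using Suc.prems(1) by (intro eq_matI) (auto simp: m_def)
  show ?case
  proof (cases "g $$ (k, k) = 0")
    case False
    hence "g $$ (i, i) \<noteq> 0" if "i \<le> k" for i using Suc.prems(4) that by (cases "i = k") auto
    thus ?thesis using Suc.prems(1,3) by (intro pivot) blast+
  next
    case True
    have F: "coeff_defect N n S T (m t) = 0" if "t \<noteq> 0" for t
    proof (rule pivot)
      show "m t \<in> carrier_mat N N" by (simp add: m_def)
      show "m t $$ (i, j) = 0" if "i < N" "j < N" "i \<noteq> j" "i < k \<or> j < k" for i j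
        using that Suc.prems(3) by (auto simp: m_def)
      show "m t $$ (i, i) \<noteq> 0" if "i \<le> k" for i
        using that \<open>t \<noteq> 0\<close> Suc.prems(4) True k by (cases "i = k") (auto simp: m_def)
    qed
    have "isCont (\<lambda>t. coeff_defect N n S T (m t)) 0"
      unfolding coeff_defect_def m_def
      by (intro continuous_diff continuous_mult continuous_const isCont_herm_act Suc.prems(1))
    hence "(\<lambda>t. coeff_defect N n S T (m t)) \<midarrow>0\<rightarrow> coeff_defect N n S T g"
      by (simp only: isCont_def m0)
    moreover have "((\<lambda>t. coeff_defect N n S T (m t)) \<midarrow>0\<rightarrow> coeff_defect N n S T g)
        = ((\<lambda>t. 0) \<midarrow>(0 :: complex)\<rightarrow> coeff_defect N n S T g)"
      by (rule LIM_equal) (use F in auto)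
    ultimately have "(\<lambda>t. 0) \<midarrow>(0 :: complex)\<rightarrow> coeff_defect N n S T g" by (simp only:)
    thus ?thesis by (rule LIM_const_eq[symmetric])
  qed
qed

lemma coeff_defect_eq_0:
  assumes "highest_weight_vector N n lam S" "highest_weight_vector N n lam T" "g \<in> carrier_mat N N"
  shows "coeff_defect N n S T g = 0"
  by (rule coeff_defect_pivots[OF assms, where k = 0]) simp_all

text \<open>The squared norm of a combination of vectors g_i X is expressed by the coefficients of
  the products of the adjoint of g_i with g_j at X. By \<open>coeff_defect_eq_0\<close> these norms
  are proportional for S and T, hence vanish together. The products are arbitrary matrices, so the
  coefficients must be known beyond the invertible upper triangular case.\<close>

lemma linear_relation_transfer:
  assumes S: "highest_weight_vector N n lam S" and T: "highest_weight_vector N n lam T"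
    and g: "\<And>i. i \<in> I \<Longrightarrow> g i \<in> carrier_mat N N"
    and rel: "(\<Sum>i\<in>I. tscale (r i) (act N n (g i) T)) = 0"
  shows "(\<Sum>i\<in>I. tscale (r i) (act N n (g i) S)) = 0"
proof -
  have expand: "herm N n (\<Sum>i\<in>I. tscale (r i) (act N n (g i) X)) (\<Sum>i\<in>I. tscale (r i) (act N n (g i) X))
      = (\<Sum>i\<in>I. \<Sum>j\<in>I. cnj (r i) * r j * herm N n X (act N n (adjoint N (g i) * g j) X))" for X
  proof -
    have hh: "herm N n (act N n (g i) X) (act N n (g j) X) = herm N n X (act N n (adjoint N (g i) * g j) X)"
      if "i \<in> I" "j \<in> I" for i j
      using g[OF that(1)] g[OF that(2)]
      by (simp add: act_mult[of _ N] herm_act[of N n X "adjoint N (g i)"] adjoint_adjoint)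
    have "herm N n (\<Sum>i\<in>I. tscale (r i) (act N n (g i) X)) (\<Sum>i\<in>I. tscale (r i) (act N n (g i) X))
      = (\<Sum>i\<in>I. \<Sum>j\<in>I. cnj (r i) * r j * herm N n (act N n (g i) X) (act N n (g j) X))"
      unfolding herm_sum(2) herm_lin(6) unfolding herm_sum(1) herm_lin(5) sum_distrib_left
      by (simp only: mult.assoc)
    moreover have "(\<Sum>i\<in>I. \<Sum>j\<in>I. cnj (r i) * r j * herm N n (act N n (g i) X) (act N n (g j) X))
      = (\<Sum>i\<in>I. \<Sum>j\<in>I. cnj (r i) * r j * herm N n X (act N n (adjoint N (g i) * g j) X))"
      by (rule sum.cong[OF refl], rule sum.cong[OF refl], rule arg_cong[of _ _ "\<lambda>y. _ * y"], rule hh)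
    ultimately show ?thesis by (rule trans)
  qed
  have coeff: "herm N n S (act N n (adjoint N (g i) * g j) S) * herm N n T T
      = herm N n T (act N n (adjoint N (g i) * g j) T) * herm N n S S" if "i \<in> I" "j \<in> I" for i j
  proof -
    have "adjoint N (g i) * g j \<in> carrier_mat N N" by (rule mult_carrier_mat[OF adjoint_carrier g[OF that(2)]])
    thus ?thesis using coeff_defect_eq_0[OF S T] unfolding coeff_defect_def by simp
  qed
  let ?X = "\<lambda>X. \<Sum>i\<in>I. tscale (r i) (act N n (g i) X)"
  have "herm N n (?X S) (?X S) * herm N n T T = herm N n (?X T) (?X T) * herm N n S S"
    unfolding expand sum_distrib_right
    by (intro sum.cong refl) (simp only: coeff mult.assoc)
  also have "\<dots> = 0" unfolding rel by (simp add: herm_lin)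
  finally have "herm N n (?X S) (?X S) * herm N n T T = 0" .
  moreover have "herm N n T T \<noteq> 0"
    using T herm_self_eq_0[OF highest_weight_tensors[OF T]] by (simp add: highest_weight_vector_def)
  moreover have "?X S \<in> tensors N n" by (intro tensors_sum tensors_scale tensors_act)
  ultimately show ?thesis by (simp add: herm_self_eq_0)
qed

subsection \<open>Equivalence of the copies of an irreducible representation\<close>

lemma GL_iff:
  "g \<in> GL_group N \<longleftrightarrow> g \<in> carrier_mat N N \<and> (\<exists>h\<in>carrier_mat N N. g * h = 1\<^sub>m N \<and> h * g = 1\<^sub>m N)"
proof
  assume "g \<in> GL_group N"
  then obtain h where h: "inverts_mat g h" "inverts_mat h g" and gc: "g \<in> carrier_mat N N"
    by (auto simp: GL_group_def invertible_mat_def)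
  have gh: "g * h = 1\<^sub>m N" using h(1) gc by (simp add: inverts_mat_def)
  have hg: "h * g = 1\<^sub>m (dim_row h)" using h(2) by (simp add: inverts_mat_def)
  have "dim_col h = N" using arg_cong[OF gh, of dim_col] by simp
  moreover have "dim_row h = N" using arg_cong[OF hg, of dim_col] gc by simp
  ultimately show "g \<in> carrier_mat N N \<and> (\<exists>h\<in>carrier_mat N N. g * h = 1\<^sub>m N \<and> h * g = 1\<^sub>m N)"
    using gc gh hg by (intro conjI bexI[of _ h]) auto
qed (auto simp: GL_group_def invertible_mat_def inverts_mat_def)

lemma GL_mult: "g \<in> GL_group N \<Longrightarrow> h \<in> GL_group N \<Longrightarrow> g * h \<in> GL_group N"
proof -
  assume "g \<in> GL_group N" "h \<in> GL_group N"
  then obtain g' h' where c: "g \<in> carrier_mat N N" "h \<in> carrier_mat N N" "g' \<in> carrier_mat N N" "h' \<in> carrier_mat N N"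
    and e: "g * g' = 1\<^sub>m N" "g' * g = 1\<^sub>m N" "h * h' = 1\<^sub>m N" "h' * h = 1\<^sub>m N"
    by (auto simp: GL_iff)
  have "g * h * (h' * g') = g * ((h * h') * g')" "h' * g' * (g * h) = h' * ((g' * g) * h)"
    using c by (simp_all add: assoc_mult_mat[of _ N N _ N _ N])
  hence "g * h * (h' * g') = 1\<^sub>m N" "h' * g' * (g * h) = 1\<^sub>m N" using c e by simp_all
  moreover have "h' * g' \<in> carrier_mat N N" "g * h \<in> carrier_mat N N" using c by auto
  ultimately show ?thesis by (auto simp: GL_iff)
qed

lemma one_GL: "1\<^sub>m N \<in> GL_group N"
  by (auto simp: GL_iff intro!: bexI[of _ "1\<^sub>m N"])

lemma irreducible_span_orbit:
  assumes V: "irreducible_subrep N n (GL_group N) V" and T: "T \<in> V" "T \<noteq> 0"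
  shows "tensor.span ((\<lambda>g. act N n g T) ` GL_group N) = V"
proof -
  let ?B = "(\<lambda>g. act N n g T) ` GL_group N"
  have V': "V \<subseteq> tensors N n" "tensor.subspace V" "\<And>g S. g \<in> GL_group N \<Longrightarrow> S \<in> V \<Longrightarrow> act N n g S \<in> V"
    using V by (auto simp: irreducible_subrep_def subrep_def)
  have sub: "tensor.span ?B \<subseteq> V" by (rule tensor.span_minimal) (use V' T in auto)
  have "subrep N n (GL_group N) (tensor.span ?B)"
    unfolding subrep_def
  proof (intro conjI ballI)
    show "tensor.span ?B \<subseteq> tensors N n" using sub V'(1) by blast
    fix g S assume g: "g \<in> GL_group N" and "S \<in> tensor.span ?B"
    from this(2) show "act N n g S \<in> tensor.span ?B"
    proof (induction rule: tensor.span_induct_alt)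
      case base show ?case by (simp add: lin_zero[OF lin_act] tensor.span_zero)
    next
      case (step c x y)
      then obtain h where h: "h \<in> GL_group N" "x = act N n h T" by auto
      have "g \<in> carrier_mat N N" "h \<in> carrier_mat N N" using g h by (auto simp: GL_group_def)
      hence "act N n g x = act N n (g * h) T" by (simp add: h(2) act_mult)
      hence "act N n g x \<in> tensor.span ?B" using GL_mult[OF g h(1)] by (intro tensor.span_base) simp
      thus ?case using step by (simp add: lin_add[OF lin_act] lin_scale[OF lin_act] tensor.span_add tensor.span_scale)
    qed
  qed (rule tensor.subspace_span)
  moreover have "act N n (1\<^sub>m N) T \<in> tensor.span ?B" by (rule tensor.span_base) (use one_GL in blast)
  hence "T \<in> tensor.span ?B" using act_one[of T N n] T(1) V'(1) by (simp add: subset_iff)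
  hence "tensor.span ?B \<noteq> {0}" using T(2) by blast
  ultimately show ?thesis using V sub by (auto simp: irreducible_subrep_def)
qed

lemma linear_lin: "Vector_Spaces.linear tscale tscale f \<longleftrightarrow> lin f"
  by (auto simp: Vector_Spaces.linear_iff lin_def tensor.vector_space_axioms)

lemma ex_linear_extension:
  fixes f :: "tensor \<Rightarrow> tensor"
  assumes "tensor.independent B" obtains g where "lin g" "\<And>x. x \<in> B \<Longrightarrow> g x = f x"
  using vector_space_pair.linear_independent_extend[OF vector_space_pair.intro, OF tensor.vector_space_axioms
    tensor.vector_space_axioms assms, of f] by (auto simp: linear_lin)

text \<open>The map should send g T to g S. It is prescribed on a basis taken from the orbit of T,
  and \<open>linear_relation_transfer\<close> shows the rule on the whole orbit, which spans U.
  Kernel and image are then subrepresentations, as in Schur's lemma.\<close>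

lemma copies_equivalent:
  assumes V: "irreducible_subrep N n (GL_group N) V" "S \<in> V" "highest_weight_vector N n lam S"
    and U: "irreducible_subrep N n (GL_group N) U" "T \<in> U" "highest_weight_vector N n lam T"
  obtains f where "lin f" "bij_betw f U V" "\<And>g X. g \<in> GL_group N \<Longrightarrow> X \<in> U \<Longrightarrow> f (act N n g X) = act N n g (f X)"
proof -
  let ?G = "GL_group N"
  have nz: "S \<noteq> 0" "T \<noteq> 0" using V(3) U(3) by (auto simp: highest_weight_vector_def)
  have V': "V \<subseteq> tensors N n" "tensor.subspace V" "\<And>g S. g \<in> ?G \<Longrightarrow> S \<in> V \<Longrightarrow> act N n g S \<in> V"
    using V(1) by (auto simp: irreducible_subrep_def subrep_def)
  have U': "U \<subseteq> tensors N n" "tensor.subspace U" "\<And>g S. g \<in> ?G \<Longrightarrow> S \<in> U \<Longrightarrow> act N n g S \<in> U"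
    using U(1) by (auto simp: irreducible_subrep_def subrep_def)
  let ?O = "(\<lambda>g. act N n g T) ` ?G"
  have span: "tensor.span ?O = U" by (rule irreducible_span_orbit[OF U(1,2) nz(2)])
  obtain B where B: "B \<subseteq> ?O" "tensor.independent B" "?O \<subseteq> tensor.span B"
    by (rule tensor.maximal_independent_subset)
  have "\<forall>b\<in>B. \<exists>g. g \<in> ?G \<and> act N n g T = b" using B(1) by blast
  then obtain \<gamma> where \<gamma>: "\<And>b. b \<in> B \<Longrightarrow> \<gamma> b \<in> ?G" "\<And>b. b \<in> B \<Longrightarrow> act N n (\<gamma> b) T = b" by metis
  obtain f where f: "lin f" "\<And>b. b \<in> B \<Longrightarrow> f b = act N n (\<gamma> b) S"
    using ex_linear_extension[OF B(2), of "\<lambda>b. act N n (\<gamma> b) S"] by blast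
  have f_orbit: "f (act N n g T) = act N n g S" if g: "g \<in> ?G" for g
  proof -
    have "act N n g T \<in> tensor.span B" using B(3) g by blast
    then obtain t r where t: "finite t" "t \<subseteq> B" "act N n g T = (\<Sum>b\<in>t. tscale (r b) b)"
      unfolding tensor.span_explicit by blast
    \<comment> \<open>The index \<open>None\<close> stands for g with coefficient -1, so that the
      expansion of g T in the basis becomes a linear relation.\<close>
    let ?I = "insert None (Some ` t)" and ?g = "case_option g \<gamma>" and ?r = "case_option (-1) r"
    have I: "(\<Sum>i\<in>?I. tscale (?r i) (act N n (?g i) X)) = - act N n g X + (\<Sum>b\<in>t. tscale (r b) (act N n (\<gamma> b) X))" for X
      using t(1) by (simp add: sum.reindex)
    have "(\<Sum>b\<in>t. tscale (r b) (act N n (\<gamma> b) T)) = (\<Sum>b\<in>t. tscale (r b) b)"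
      using t(2) \<gamma>(2) by (intro sum.cong refl) (simp add: subset_iff)
    hence "(\<Sum>i\<in>?I. tscale (?r i) (act N n (?g i) T)) = 0" unfolding I by (simp add: t(3))
    moreover have "?g i \<in> carrier_mat N N" if "i \<in> ?I" for i
      using that g \<gamma>(1) t(2) by (auto simp: GL_group_def)
    ultimately have "(\<Sum>i\<in>?I. tscale (?r i) (act N n (?g i) S)) = 0"
      by (intro linear_relation_transfer[OF V(3) U(3)])
    hence "act N n g S = (\<Sum>b\<in>t. tscale (r b) (act N n (\<gamma> b) S))" unfolding I by (simp add: neg_eq_iff_add_eq_0 add_eq_0_iff)
    also have "\<dots> = (\<Sum>b\<in>t. tscale (r b) (f b))"
      using t(2) f(2) by (intro sum.cong refl) (simp add: subset_iff)
    also have "\<dots> = f (act N n g T)" by (simp add: t(3) lin_sum[OF f(1)] lin_scale[OF f(1)])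
    finally show ?thesis by (rule sym)
  qed
  have equi: "f (act N n g X) = act N n g (f X)" if g: "g \<in> ?G" and X: "X \<in> U" for g X
    using X unfolding span[symmetric]
  proof (induction rule: tensor.span_induct_alt)
    case base show ?case by (simp add: lin_zero[OF lin_act] lin_zero[OF f(1)])
  next
    case (step c x y)
    then obtain h where h: "h \<in> ?G" "x = act N n h T" by auto
    have "g \<in> carrier_mat N N" "h \<in> carrier_mat N N" using g h by (auto simp: GL_group_def)
    hence "f (act N n g x) = act N n g (f x)"
      using f_orbit[OF GL_mult[OF g h(1)]] f_orbit[OF h(1)] by (simp add: h(2) act_mult)
    thus ?case using step by (simp add: lin_add[OF lin_act] lin_scale[OF lin_act] lin_add[OF f(1)] lin_scale[OF f(1)])
  qed
  have fV: "f X \<in> V" if "X \<in> U" for X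
    using that unfolding span[symmetric]
  proof (induction rule: tensor.span_induct_alt)
    case base show ?case by (simp add: lin_zero[OF f(1)] tensor.subspace_0[OF V'(2)])
  next
    case (step c x y)
    hence "f x \<in> V" using f_orbit V'(3) V(2) by auto
    thus ?case using step
      by (simp add: lin_add[OF f(1)] lin_scale[OF f(1)] tensor.subspace_add[OF V'(2)] tensor.subspace_scale[OF V'(2)])
  qed
  have fT: "f T = S"
    using f_orbit[OF one_GL] act_one[of T N n] act_one[of S N n] U(2) V(2) U'(1) V'(1) by (auto simp: subset_iff)
  have "subrep N n ?G (f ` U)"
    unfolding subrep_def
  proof (intro conjI ballI)
    show "f ` U \<subseteq> tensors N n" using fV V'(1) by blast
    show "tensor.subspace (f ` U)"
    proof (rule tensor.subspaceI)
      show "0 \<in> f ` U" using lin_zero[OF f(1)] tensor.subspace_0[OF U'(2)] by (metis imageI)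
      show "x + y \<in> f ` U" if xy: "x \<in> f ` U" "y \<in> f ` U" for x y
      proof -
        obtain p q where "p \<in> U" "q \<in> U" "x = f p" "y = f q" using xy by blast
        thus ?thesis using tensor.subspace_add[OF U'(2), of p q] lin_add[OF f(1), of p q] by (metis imageI)
      qed
      show "tscale c x \<in> f ` U" if xy: "x \<in> f ` U" for c x
      proof -
        obtain p where "p \<in> U" "x = f p" using xy by blast
        thus ?thesis using tensor.subspace_scale[OF U'(2), of p c] lin_scale[OF f(1), of c p] by (metis imageI)
      qed
    qed
    show "act N n g X \<in> f ` U" if gX: "g \<in> ?G" "X \<in> f ` U" for g X
    proof -
      obtain p where "p \<in> U" "X = f p" using gX(2) by blast
      thus ?thesis using U'(3)[of g p] equi[of g p] gX(1) by (metis imageI)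
    qed
  qed
  moreover have "f ` U \<subseteq> V" using fV by blast
  moreover have "f ` U \<noteq> {0}" using fT U(2) nz(1) by blast
  ultimately have im: "f ` U = V" using V(1) unfolding irreducible_subrep_def by blast
  let ?K = "{X \<in> U. f X = 0}"
  have "subrep N n ?G ?K"
    unfolding subrep_def
  proof (intro conjI ballI)
    show "?K \<subseteq> tensors N n" using U'(1) by blast
    show "tensor.subspace ?K"
      by (rule tensor.subspaceI) (simp_all add: tensor.subspace_0[OF U'(2)] tensor.subspace_add[OF U'(2)]
          tensor.subspace_scale[OF U'(2)] lin_zero[OF f(1)] lin_add[OF f(1)] lin_scale[OF f(1)])
    show "act N n g X \<in> ?K" if "g \<in> ?G" "X \<in> ?K" for g X
      using that by (simp add: U'(3) equi lin_zero[OF lin_act])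
  qed
  moreover have "?K \<noteq> U" using fT nz(1) U(2) by auto
  ultimately have K: "?K = {0}" using U(1) unfolding irreducible_subrep_def by blast
  have "inj_on f U"
  proof (rule inj_onI)
    fix x y assume "x \<in> U" "y \<in> U" "f x = f y"
    hence "x - y \<in> ?K" using tensor.subspace_diff[OF U'(2)] by (simp add: lin_diff[OF f(1)])
    thus "x = y" unfolding K by simp
  qed
  thus ?thesis using that f(1) im equi by (simp add: bij_betw_def)
qed

subsection \<open>Traceless tensors\<close>

lemma traceless_iff_Q:
  assumes "T \<in> tensors N n"
  shows "T \<in> traceless_tensors N n \<longleftrightarrow> (\<forall>k\<in>{1..n}. \<forall>l\<in>{1..n}. k \<noteq> l \<longrightarrow> Q_op N n k l T = 0)"
proof -
  have "(\<forall>i\<in>midx N n. contract N k l T i = 0) \<longleftrightarrow> Q_op N n k l T = 0"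
    if kl: "k \<in> {1..n}" "l \<in> {1..n}" "k \<noteq> l" for k l
  proof
    assume Q: "Q_op N n k l T = 0"
    show "\<forall>i\<in>midx N n. contract N k l T i = 0"
    proof
      fix i assume i: "i \<in> midx N n"
      let ?i = "i(l := i k)"
      have "?i \<in> midx N n" using midx_upd[OF i kl(2) midx_lt[OF i kl(1)]] .
      hence "contract N k l T ?i = Q_op N n k l T ?i" using kl(3) by (simp add: Q_op_def)
      moreover have "contract N k l T ?i = contract N k l T i"
        unfolding contract_def by (intro sum.cong arg_cong[of _ _ T]) auto
      ultimately show "contract N k l T i = 0" by (simp add: Q zero_fun_apply)
    qed
  qed (auto simp: Q_op_def pointwise)
  thus ?thesis using assms by (simp add: traceless_tensors_def)
qed

text \<open>Reindexing by the involution that interchanges the common letter at k and l with the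
  summation letter.\<close>

lemma sum_diagonal_pairs:
  fixes h :: "(nat \<Rightarrow> nat) \<Rightarrow> nat \<Rightarrow> complex"
  assumes "k \<in> {1..n}" "l \<in> {1..n}" "k \<noteq> l"
  shows "(\<Sum>x\<in>{x\<in>midx N n. x k = x l}. \<Sum>a<N. h x a)
    = (\<Sum>x\<in>{x\<in>midx N n. x k = x l}. \<Sum>a<N. h (x(k := a, l := a)) (x k))"
proof -
  let ?D = "{x\<in>midx N n. x k = x l}" and ?f = "\<lambda>(x, a). (x(k := a, l := a), x k)"
  have *: "?f (?f p) = p \<and> ?f p \<in> ?D \<times> {..<N}" if p: "p \<in> ?D \<times> {..<N}" for p
  proof -
    obtain x a where p: "p = (x, a)" "x \<in> midx N n" "x k = x l" "a < N" using p by (cases p) auto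
    have "x(k := a, l := a) \<in> midx N n" using p assms by (intro midx_upd) auto
    thus ?thesis using p assms(3) midx_lt[OF p(2) assms(1)] by (auto simp: fun_eq_iff)
  qed
  have "(\<Sum>p\<in>?D \<times> {..<N}. case_prod h p) = (\<Sum>p\<in>?D \<times> {..<N}. case_prod h (?f p))"
    by (rule sum.reindex_bij_witness[of _ ?f ?f]) (use * in auto)
  thus ?thesis by (simp only: sum.cartesian_product split_def fst_conv snd_conv)
qed

lemma herm_Q:
  assumes kl: "k \<in> {1..n}" "l \<in> {1..n}" "k \<noteq> l"
  shows "herm N n S (Q_op N n k l T) = herm N n (Q_op N n k l S) T"
proof -
  let ?D = "{x\<in>midx N n. x k = x l}"
  have D: "(\<Sum>x\<in>midx N n. if x k = x l then h x else 0) = (\<Sum>x\<in>?D. h x)" for h :: "_ \<Rightarrow> complex"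
    using sum.inter_restrict[OF finite_midx[of N n], of h "{x. x k = x l}"] by (simp add: Int_def)
  have "herm N n S (Q_op N n k l T) = (\<Sum>x\<in>midx N n. if x k = x l then \<Sum>a<N. cnj (S x) * T (x(k := a, l := a)) else 0)"
    unfolding herm_def by (rule sum.cong[OF refl]) (simp add: Q_op_def contract_def sum_distrib_left)
  also have "\<dots> = (\<Sum>x\<in>?D. \<Sum>a<N. cnj (S (x(k := a, l := a))) * T (x(k := a, l := a, k := x k, l := x k)))"
    unfolding D by (rule sum_diagonal_pairs[OF kl])
  also have "\<dots> = (\<Sum>x\<in>?D. (\<Sum>a<N. cnj (S (x(k := a, l := a)))) * T x)"
  proof (rule sum.cong[OF refl])
    fix x assume "x \<in> ?D"
    hence "x(k := a, l := a, k := x k, l := x k) = x" for a by (auto simp: fun_eq_iff)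
    thus "(\<Sum>a<N. cnj (S (x(k := a, l := a))) * T (x(k := a, l := a, k := x k, l := x k)))
      = (\<Sum>a<N. cnj (S (x(k := a, l := a)))) * T x" by (simp add: sum_distrib_right)
  qed
  also have "\<dots> = herm N n (Q_op N n k l S) T"
    unfolding herm_def D[symmetric] by (rule sum.cong[OF refl]) (simp add: Q_op_def contract_def)
  finally show ?thesis .
qed

lemma herm_Q_self:
  assumes "k \<in> {1..n}" "l \<in> {1..n}" "k \<noteq> l"
  shows "of_nat N * herm N n T (Q_op N n k l T) = herm N n (Q_op N n k l T) (Q_op N n k l T)"
  using herm_Q[OF assms, of N T "Q_op N n k l T"] unfolding Q_Q_same[OF assms(1,2)] herm_lin(5) .

text \<open>This expresses the sum of all contractions through the action of matrices: two places
  with the common letter a are read at the common letter b. An equivariant map commutes with it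
  without being related to a single contraction.\<close>

definition total_trace :: "nat \<Rightarrow> nat \<Rightarrow> tensor \<Rightarrow> tensor" where
  "total_trace N n T = (\<Sum>a<N. \<Sum>b<N. sub_op N n 2 a b T)"

lemma total_trace_eq_sum_Q:
  "total_trace N n T = (\<Sum>(k, l)\<in>{(k, l). k \<in> {1..n} \<and> l \<in> {1..n} \<and> k < l}. Q_op N n k l T)"
proof
  fix x
  let ?L = "{(k, l). k \<in> {1..n} \<and> l \<in> {1..n} \<and> k < l}"
  have fin: "finite ?L" by (rule finite_subset[of _ "{1..n} \<times> {1..n}"]) auto
  show "total_trace N n T x = (\<Sum>(k, l)\<in>?L. Q_op N n k l T) x"
  proof (cases "x \<in> midx N n")
    case True
    have sub: "sub_op N n 2 a b T x
        = (\<Sum>(k, l)\<in>?L. if x k = a \<and> x l = a then T (x(k := b, l := b)) else 0)" for a b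
    proof -
      let ?La = "{p \<in> ?L. x (fst p) = a \<and> x (snd p) = a}"
      have "inj_on (\<lambda>(k, l). {k, l}) ?La" by (rule inj_onI) (auto simp: doubleton_eq_iff)
      moreover have "{K. K \<subseteq> {k\<in>{1..n}. x k = a} \<and> card K = 2} = (\<lambda>(k, l). {k, l}) ` ?La"
      proof (intro equalityI subsetI)
        fix K assume "K \<in> {K. K \<subseteq> {k\<in>{1..n}. x k = a} \<and> card K = 2}"
        then obtain k l where K: "K = {k, l}" "k < l" "{k, l} \<subseteq> {k\<in>{1..n}. x k = a}"
          by (auto simp: card_2_iff) (metis insert_commute linorder_neqE_nat)
        thus "K \<in> (\<lambda>(k, l). {k, l}) ` ?La" by (intro image_eqI[of _ _ "(k, l)"]) auto
      qed (auto simp: card_2_iff)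
      moreover have "override_on x (\<lambda>_. b) {k, l} = x(k := b, l := b)" for k l
        by (auto simp: override_on_def fun_eq_iff)
      ultimately have "sub_op N n 2 a b T x = (\<Sum>p\<in>?La. T (x(fst p := b, snd p := b)))"
        using True by (simp add: sub_op_def sum.reindex split_def)
      also have "\<dots> = (\<Sum>p\<in>?L. if x (fst p) = a \<and> x (snd p) = a then T (x(fst p := b, snd p := b)) else 0)"
        by (rule sum.inter_filter[OF fin])
      finally show ?thesis by (simp only: split_def)
    qed
    have "total_trace N n T x = (\<Sum>a<N. \<Sum>b<N. \<Sum>(k, l)\<in>?L. if x k = a \<and> x l = a then T (x(k := b, l := b)) else 0)"
      by (simp only: total_trace_def sum_fun_apply sub)
    also have "\<dots> = (\<Sum>b<N. \<Sum>a<N. \<Sum>(k, l)\<in>?L. if x k = a \<and> x l = a then T (x(k := b, l := b)) else 0)"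
      by (rule sum.swap)
    also have "\<dots> = (\<Sum>b<N. \<Sum>p\<in>?L. \<Sum>a<N. case p of (k, l) \<Rightarrow> if x k = a \<and> x l = a then T (x(k := b, l := b)) else 0)"
      by (rule sum.cong[OF refl], rule sum.swap)
    also have "\<dots> = (\<Sum>p\<in>?L. \<Sum>b<N. \<Sum>a<N. case p of (k, l) \<Rightarrow> if x k = a \<and> x l = a then T (x(k := b, l := b)) else 0)"
      by (rule sum.swap)
    also have "\<dots> = (\<Sum>(k, l)\<in>?L. Q_op N n k l T x)"
    proof (rule sum.cong[OF refl])
      fix p assume "p \<in> ?L"
      then obtain k l where p: "p = (k, l)" "k \<in> {1..n}" "l \<in> {1..n}" by auto
      have "(\<Sum>a<N. if x k = a \<and> x l = a then c else 0) = (if x k = x l then c else 0)" for c :: complex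
      proof -
        have "(\<Sum>a<N. if x k = a \<and> x l = a then c else 0) = (\<Sum>a<N. if a = x k then if x k = x l then c else 0 else 0)"
          by (rule sum.cong) auto
        thus ?thesis using midx_lt[OF True p(2)] by simp
      qed
      thus "(\<Sum>b<N. \<Sum>a<N. case p of (k, l) \<Rightarrow> if x k = a \<and> x l = a then T (x(k := b, l := b)) else 0)
          = (case p of (k, l) \<Rightarrow> Q_op N n k l T x)"
        using True by (simp add: p(1) Q_op_def contract_def)
    qed
    finally show ?thesis by (simp add: sum_fun_apply split_def)
  qed (simp add: total_trace_def sub_op_def Q_op_def sum_fun_apply split_def)
qed

text \<open>Up to the factor N, pairing T with Q_kl T gives the squared norm of Q_kl T
  (\<open>herm_Q_self\<close>). A vanishing sum of these non-negative numbers forces each of them to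
  vanish.\<close>

lemma traceless_iff_total_trace:
  assumes T: "T \<in> tensors N n" and N: "1 \<le> N"
  shows "T \<in> traceless_tensors N n \<longleftrightarrow> total_trace N n T = 0"
proof
  let ?L = "{(k, l). k \<in> {1..n} \<and> l \<in> {1..n} \<and> k < l}"
  have fin: "finite ?L" by (rule finite_subset[of _ "{1..n} \<times> {1..n}"]) auto
  {
    assume "T \<in> traceless_tensors N n"
    hence "Q_op N n k l T = 0" if "(k, l) \<in> ?L" for k l using that traceless_iff_Q[OF T] by auto
    thus "total_trace N n T = 0" unfolding total_trace_eq_sum_Q by (intro sum.neutral) auto
  next
    assume 0: "total_trace N n T = 0"
    have "(\<Sum>(k, l)\<in>?L. of_nat N * herm N n T (Q_op N n k l T)) = of_nat N * herm N n T (total_trace N n T)"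
      unfolding total_trace_eq_sum_Q herm_sum by (simp add: sum_distrib_left split_def)
    also have "\<dots> = 0" by (simp add: 0 herm_lin)
    also have "(\<Sum>(k, l)\<in>?L. of_nat N * herm N n T (Q_op N n k l T))
        = (\<Sum>(k, l)\<in>?L. herm N n (Q_op N n k l T) (Q_op N n k l T))"
      by (rule sum.cong[OF refl]) (auto simp: herm_Q_self)
    also have "\<dots> = of_real (\<Sum>(k, l)\<in>?L. \<Sum>x\<in>midx N n. (cmod (Q_op N n k l T x))\<^sup>2)"
      by (simp only: herm_self of_real_sum split_def)
    finally have "(\<Sum>p\<in>?L. \<Sum>x\<in>midx N n. (cmod (Q_op N n (fst p) (snd p) T x))\<^sup>2) = 0"
      by (simp only: of_real_eq_0_iff split_def)
    hence "\<forall>p\<in>?L. (\<Sum>x\<in>midx N n. (cmod (Q_op N n (fst p) (snd p) T x))\<^sup>2) = 0"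
      using sum_nonneg_eq_0_iff[OF fin, of "\<lambda>p. \<Sum>x\<in>midx N n. (cmod (Q_op N n (fst p) (snd p) T x))\<^sup>2"]
      by (simp add: sum_nonneg)
    moreover have "herm N n (Q_op N n k l T) (Q_op N n k l T) = 0"
      if "(\<Sum>x\<in>midx N n. (cmod (Q_op N n k l T x))\<^sup>2) = 0" for k l
      using that by (simp only: herm_self of_real_0)
    moreover have "Q_op N n k l T \<in> tensors N n" for k l by (simp add: tensors_def Q_op_def)
    ultimately have Q: "Q_op N n k l T = 0" if "(k, l) \<in> ?L" for k l
      using that herm_self_eq_0 by fastforce
    have "Q_op N n k l T = 0" if "k \<in> {1..n}" "l \<in> {1..n}" "k \<noteq> l" for k l
      using that Q[of k l] Q[of l k] Q_sym[of N n k l] by (cases "k < l") auto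
    thus "T \<in> traceless_tensors N n" by (simp add: traceless_iff_Q[OF T])
  }
qed

text \<open>Coefficients are compared in the equivariance under 1 + k E_ab for all positive integers
  k, by \<open>poly_coeffs_in_subspace\<close> with the zero subspace.\<close>

lemma equivariant_sub_op:
  assumes U: "subrep N n (GL_group N) U" and f: "lin f" "\<And>g X. g \<in> GL_group N \<Longrightarrow> X \<in> U \<Longrightarrow> f (act N n g X) = act N n g (f X)"
    and X: "X \<in> U" and ab: "a < N" "b < N" and m: "m \<le> n"
  shows "f (sub_op N n m a b X) = sub_op N n m a b (f X)"
proof -
  have "f (sub_op N n m a b X) - sub_op N n m a b (f X) \<in> {0}"
  proof (rule poly_coeffs_in_subspace[where d = "Suc n" and v = "\<lambda>m. f (sub_op N n m a b X) - sub_op N n m a b (f X)"])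
    show "tensor.subspace {0}" by (rule tensor.subspace_single_0)
    show "m < Suc n" using m by simp
    show "(\<Sum>m<Suc n. tscale (of_nat k ^ m) (f (sub_op N n m a b X) - sub_op N n m a b (f X))) \<in> {0}" if "k > 0" for k
    proof -
      have "of_nat k \<noteq> (- 1 :: complex)" by (metis of_nat_0_le_iff of_nat_Suc of_nat_neq_0 add.commute neg_eq_iff_add_eq_0)
      hence "elem_mat N a b (of_nat k) \<in> GL_group N" using ab by (intro elem_mat_GL) auto
      hence "f (act N n (elem_mat N a b (of_nat k)) X) = act N n (elem_mat N a b (of_nat k)) (f X)" using f(2) X by blast
      hence "(\<Sum>m<Suc n. f (tscale (of_nat k ^ m) (sub_op N n m a b X))) = (\<Sum>m<Suc n. tscale (of_nat k ^ m) (sub_op N n m a b (f X)))"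
        unfolding act_elem_series[OF ab] lin_sum[OF f(1)] .
      thus ?thesis by (simp only: tensor.scale_right_diff_distrib sum_subtractf lin_scale[OF f(1)] right_minus_eq singleton_iff)
    qed
  qed
  thus ?thesis by simp
qed

lemma traceless_equivariant:
  assumes U: "subrep N n (GL_group N) U" and f: "lin f" "\<And>g X. g \<in> GL_group N \<Longrightarrow> X \<in> U \<Longrightarrow> f (act N n g X) = act N n g (f X)"
    and bij: "bij_betw f U V" and V: "V \<subseteq> tensors N n" and X: "X \<in> U" and N: "1 \<le> N"
  shows "f X \<in> traceless_tensors N n \<longleftrightarrow> X \<in> traceless_tensors N n"
proof -
  have sub: "tensor.subspace U" "U \<subseteq> tensors N n" using U by (auto simp: subrep_def)
  have XT: "X \<in> tensors N n" "f X \<in> tensors N n" using X sub(2) V bij by (auto simp: bij_betw_def)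
  have "f (total_trace N n X) = total_trace N n (f X) \<and> total_trace N n X \<in> U"
  proof (cases "2 \<le> n")
    case True
    show ?thesis unfolding total_trace_def lin_sum[OF f(1)]
      using equivariant_sub_op[OF U f X _ _ True] sub_op_in_subrep[OF U X _ _ True]
      by (auto intro!: tensor.subspace_sum[OF sub(1)])
  next
    case False
    hence "total_trace N n Y = 0" for Y unfolding total_trace_eq_sum_Q by (intro sum.neutral) auto
    thus ?thesis by (simp add: lin_zero[OF f(1)] tensor.subspace_0[OF sub(1)])
  qed
  moreover have "f Y = 0 \<longleftrightarrow> Y = 0" if "Y \<in> U" for Y
    using bij that tensor.subspace_0[OF sub(1)] lin_zero[OF f(1)] unfolding bij_betw_def by (metis inj_onD)
  ultimately show ?thesis
    unfolding traceless_iff_total_trace[OF XT(1) N] traceless_iff_total_trace[OF XT(2) N] by metis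
qed

subsection \<open>Ordered products over a column tableau\<close>

fun pairs_of :: "nat list \<Rightarrow> (nat \<times> nat) list" where
  "pairs_of [] = []"
| "pairs_of (k # ks) = map (Pair k) ks @ pairs_of ks"

lemma lex_pairs_eq: "lex_pairs n = pairs_of [1..<Suc n]"
proof -
  have "concat (map (\<lambda>k. map (Pair k) [Suc k..<b]) [a..<b]) = pairs_of [a..<b]" for a b
  proof (induction "b - a" arbitrary: a)
    case (Suc d)
    hence "[a..<b] = a # [Suc a..<b]" by (simp add: upt_conv_Cons)
    thus ?case using Suc by simp
  qed simp
  thus ?thesis unfolding lex_pairs_def .
qed

lemma ordered_prod_map: "ordered_prod (map f ps) T = foldr f ps T"
  by (induction ps) (auto simp: ordered_prod_def)

lemma ordered_prod_filter:
  "ordered_prod (concat (map (\<lambda>p. if P p then [f p] else []) ps)) T = foldr f (filter P ps) T"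
  by (induction ps) (auto simp: ordered_prod_def)

text \<open>The situation at points of \<open>E_domain\<close>, where contents are shifted by the
  variables. At equal variables the inequalities fail for boxes on a common diagonal, and the
  product has to be replaced by \<open>Erec\<close>.\<close>

fun column_contents :: "(nat \<Rightarrow> complex) \<Rightarrow> nat list list \<Rightarrow> bool" where
  "column_contents x [] \<longleftrightarrow> True"
| "column_contents x (c # cs) \<longleftrightarrow> c \<noteq> [] \<and> distinct c \<and> set c \<inter> set (concat cs) = {} \<and>
    (\<forall>i<length c. x (c ! i) = x (hd c) - of_nat i) \<and>
    (\<forall>k\<in>set c. \<forall>l\<in>set (concat cs). x k \<noteq> x l) \<and> column_contents x cs"

lemma commutes_on_row_op:
  assumes "k \<notin> B" "\<And>b. b \<in> set cs \<Longrightarrow> B \<subseteq> set b \<or> B \<inter> set b = {}"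
  shows "commutes_on B (row_op x k cs)"
proof -
  have "commutes_on B (\<lambda>T. foldr (\<lambda>b T. T - tscale (1 / (x k - x (hd b))) (PS k (set b) T)) cs T)"
  proof (rule commutes_on_foldr)
    fix b assume "b \<in> set cs"
    from commutes_on_subtract[OF commutes_on_id commutes_on_scaled[OF commutes_on_PS[OF assms(1) assms(2)[OF this]]]]
    show "commutes_on B (\<lambda>T. T - tscale (1 / (x k - x (hd b))) (PS k (set b) T))" .
  qed
  thus ?thesis by (simp add: commutes_on_def lin_def row_op_def)
qed

lemma column_contents_cases:
  assumes "column_contents x cs" "b \<in> set cs" "c \<in> set cs"
  shows "set b \<subseteq> set c \<or> set b \<inter> set c = {}"
  using assms
proof (induction cs)
  case (Cons a cs)
  have "set a \<inter> set d = {}" if "d \<in> set cs" for d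
    using Cons.prems(1) that unfolding column_contents.simps set_concat by blast
  moreover have "column_contents x cs" using Cons.prems(1) by simp
  ultimately show ?case using Cons.IH Cons.prems(2,3) by (metis inf_commute set_ConsD subset_refl)
qed simp

lemma row_op_telescope:
  assumes "column_contents x cs" "k \<notin> set (concat cs)" "\<And>l. l \<in> set (concat cs) \<Longrightarrow> x k \<noteq> x l"
    "\<And>b. b \<in> set cs \<Longrightarrow> alternating (set b) T"
  shows "foldr (\<lambda>l T. T - tscale (1 / (x k - x l)) (P_op k l T)) (concat cs) T = row_op x k cs T"
  using assms
proof (induction cs)
  case (Cons b cs)
  let ?R = "\<lambda>l T. T - tscale (1 / (x k - x l)) (P_op k l T)"
  have disj: "set b \<inter> set c = {}" if "c \<in> set cs" for c
    using Cons.prems(1) that unfolding column_contents.simps set_concat by blast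
  have IH: "foldr ?R (concat cs) T = row_op x k cs T" using Cons.prems by (intro Cons.IH) auto
  have kb: "k \<notin> set b" using Cons.prems(2) by simp
  have comm: "commutes_on (set b) (row_op x k cs)" by (rule commutes_on_row_op) (use kb disj in auto)
  have alt: "alternating (set b) T" using Cons.prems(4)[of b] by simp
  have "foldr ?R b (row_op x k cs T) = row_op x k cs T - tscale (1 / (x k - x (hd b))) (PS k (set b) (row_op x k cs T))"
  proof (rule column_telescope_P)
    show "alternating (set b) (row_op x k cs T)" by (rule commutes_on_alternating[OF comm alt])
    show "x k - x (b ! i) = x k - x (hd b) + of_nat i" if "i < length b" for i
      using Cons.prems(1) that by auto
  qed (use Cons.prems kb in auto)
  thus ?case by (simp add: IH row_op_def)
qed (simp add: row_op_def)

lemma alternating_Erec: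
  assumes "column_contents x cs" "c \<in> set cs" shows "alternating (set c) (Erec x cs T)"
  using assms
proof (induction cs)
  case (Cons b cs)
  let ?Y = "foldr (\<lambda>k. row_op x k cs) b (Erec x cs T)"
  have b: "distinct b" "set b \<inter> set (concat cs) = {}" using Cons.prems(1) by auto
  show ?case
  proof (cases "c = b")
    case True thus ?thesis using alternating_Ant[OF b(1), of ?Y] by simp
  next
    case False
    hence c: "c \<in> set cs" using Cons.prems(2) by simp
    hence disj: "set c \<inter> set b = {}" using b(2) by (auto simp: set_concat)
    have "alternating (set c) (Erec x cs T)" using Cons c by simp
    moreover have "commutes_on (set c) (\<lambda>T. foldr (\<lambda>k. row_op x k cs) b T)"
    proof (rule commutes_on_foldr)
      fix k assume "k \<in> set b"
      thus "commutes_on (set c) (row_op x k cs)"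
        using disj c Cons.prems(1) column_contents_cases[of x cs c] by (intro commutes_on_row_op) auto
    qed
    ultimately have "alternating (set c) ?Y" by (rule commutes_on_alternating[rotated])
    from commutes_on_alternating[OF commutes_on_Ant[OF disj] this] show ?thesis by simp
  qed
qed simp

text \<open>Going up the first column: the antisymmetrizer of the part d below k commutes with the
  factors joining k to later columns. The factors of k with d have the denominators 1, 2, ..., so
  \<open>column_telescope_P\<close> with u = 1 extends \<open>Ant d\<close> to
  \<open>Ant (k # d)\<close>.\<close>

lemma foldr_pairs_Erec:
  assumes "column_contents x cs"
  shows "foldr (\<lambda>(k, l) T. T - tscale (1 / (x k - x l)) (P_op k l T)) (pairs_of (concat cs)) T = Erec x cs T"
  using assms
proof (induction cs)
  case (Cons c cs)
  let ?R = "\<lambda>k l T. T - tscale (1 / (x k - x l)) (P_op k l T)" and ?L = "concat cs"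
  let ?P = "\<lambda>(k, l). ?R k l" and ?X = "Erec x cs T"
  have cs: "column_contents x cs" using Cons.prems by simp
  have row: "foldr ?P (map (Pair k) ls) U = foldr (?R k) ls U" for k ls U by (induction ls) auto
  have "foldr ?P (pairs_of (d @ ?L)) T = Ant d (foldr (\<lambda>k. row_op x k cs) d ?X)"
    if "distinct d" "set d \<inter> set ?L = {}" "\<And>i. i < length d \<Longrightarrow> x (d ! i) = u - of_nat i"
      "\<And>k l. k \<in> set d \<Longrightarrow> l \<in> set ?L \<Longrightarrow> x k \<noteq> x l" for d u
    using that
  proof (induction d arbitrary: u)
    case Nil
    show ?case using Cons.IH[OF cs] by simp
  next
    case (Cons k d)
    let ?Y = "foldr (\<lambda>k. row_op x k cs) d ?X"
    have xd: "x (d ! i) = u - 1 - of_nat i" if "i < length d" for i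
      using Cons.prems(3)[of "Suc i"] that by simp
    have xk: "x k = u" using Cons.prems(3)[of 0] by simp
    have IH: "foldr ?P (pairs_of (d @ ?L)) T = Ant d ?Y"
      by (rule Cons.IH[of "u - 1"]) (use Cons.prems xd in auto)
    have comm: "commutes_on (set d) (\<lambda>T. foldr (?R k) ?L T)"
    proof (rule commutes_on_foldr)
      fix l assume "l \<in> set ?L"
      hence "k \<notin> set d" "l \<notin> set d" using Cons.prems by auto
      hence "commutes_on (set d) (P_op k l)" by (auto simp: commutes_on_def lin_P intro!: P_comm)
      from commutes_on_subtract[OF commutes_on_id commutes_on_scaled[OF this]]
      show "commutes_on (set d) (?R k l)" .
    qed
    have "foldr (?R k) ?L (Ant d ?Y) = Ant d (foldr (?R k) ?L ?Y)"
      by (rule Ant_commute[where F = "\<lambda>T. foldr (?R k) ?L T"])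
        (use comm Cons.prems(1) in \<open>auto simp: commutes_on_def\<close>)
    also have "foldr (?R k) ?L ?Y = row_op x k cs ?Y"
    proof (rule row_op_telescope[OF cs])
      show "k \<notin> set ?L" "\<And>l. l \<in> set ?L \<Longrightarrow> x k \<noteq> x l" using Cons.prems by auto
      fix b assume b: "b \<in> set cs"
      have "commutes_on (set b) (\<lambda>T. foldr (\<lambda>k. row_op x k cs) d T)"
      proof (rule commutes_on_foldr)
        fix m assume "m \<in> set d"
        hence "m \<notin> set b" using Cons.prems(2) b by (auto simp: set_concat)
        thus "commutes_on (set b) (row_op x m cs)"
          using column_contents_cases[OF cs b] by (intro commutes_on_row_op) auto
      qed
      from commutes_on_alternating[OF this alternating_Erec[OF cs b]]
      show "alternating (set b) ?Y" .
    qed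
    finally have L: "foldr (?R k) ?L (Ant d ?Y) = Ant d (row_op x k cs ?Y)" .
    let ?Z = "row_op x k cs ?Y"
    have "foldr (?R k) d (Ant d ?Z) = Ant (k # d) ?Z"
    proof (cases "d = []")
      case False
      have "foldr (?R k) d (Ant d ?Z) = Ant d ?Z - tscale (1 / 1) (PS k (set d) (Ant d ?Z))"
      proof (rule column_telescope_P)
        show "alternating (set d) (Ant d ?Z)" by (rule alternating_Ant) (use Cons.prems(1) in simp)
        show "x k - x (d ! i) = 1 + of_nat i" if "i < length d" for i using xd[OF that] xk by simp
        show "x k - x l \<noteq> 0" if "l \<in> set d" for l
        proof -
          obtain i where "i < length d" "l = d ! i" using \<open>l \<in> set d\<close> by (metis in_set_conv_nth)
          hence "x k - x l = of_nat (Suc i)" using xd xk by simp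
          thus ?thesis by (simp only: of_nat_neq_0 not_False_eq_True)
        qed
      qed (use Cons.prems(1) False in auto)
      thus ?thesis by simp
    qed simp
    thus ?case by (simp add: row IH L)
  qed
  from this[of c "x (hd c)"] Cons.prems show ?case by simp
qed simp

fun columns_separated :: "(nat \<Rightarrow> nat) \<Rightarrow> nat list list \<Rightarrow> bool" where
  "columns_separated w [] \<longleftrightarrow> True"
| "columns_separated w (c # cs) \<longleftrightarrow> (\<forall>k\<in>set c. \<forall>l\<in>set c. w k = w l) \<and>
    (\<forall>k\<in>set c. \<forall>l\<in>set (concat cs). w k \<noteq> w l) \<and> columns_separated w cs"

lemma foldr_pairs_Grec:
  assumes "columns_separated w cs"
  shows "foldr (\<lambda>(k, l). Rb N n y k l) (filter (\<lambda>(k, l). w k \<noteq> w l) (pairs_of (concat cs))) T = Grec N n y cs T"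
  using assms
proof (induction cs)
  case (Cons c cs)
  let ?P = "\<lambda>(k, l). Rb N n y k l" and ?F = "filter (\<lambda>(k, l). w k \<noteq> w l)" and ?L = "concat cs"
  have row: "foldr ?P (map (Pair k) ls) U = foldr (Rb N n y k) ls U" for k ls U by (induction ls) auto
  have main: "foldr ?P (?F (pairs_of (d @ ?L))) T = foldr (\<lambda>k. foldr (Rb N n y k) ?L) d (Grec N n y cs T)"
    if "set d \<subseteq> set c" for d
    using that
  proof (induction d)
    case Nil
    show ?case using Cons.IH Cons.prems by simp
  next
    case (Cons k d)
    have "w k = w l" if "l \<in> set d" for l
      using \<open>columns_separated w (c # cs)\<close> Cons.prems that unfolding columns_separated.simps by (meson list.set_intros subsetD)
    hence "?F (map (Pair k) d) = []" unfolding filter_empty_conv by simp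
    moreover have "w k \<noteq> w l" if "l \<in> set ?L" for l
      using \<open>columns_separated w (c # cs)\<close> Cons.prems that unfolding columns_separated.simps by (meson list.set_intros subsetD)
    hence "?F (map (Pair k) ?L) = map (Pair k) ?L" by (intro filter_True) auto
    moreover have "foldr ?P (?F (pairs_of (d @ ?L))) T = foldr (\<lambda>k. foldr (Rb N n y k) ?L) d (Grec N n y cs T)"
      by (rule Cons.IH) (use Cons.prems in simp)
    ultimately show ?case by (simp add: row)
  qed
  show ?case using main[OF subset_refl] by simp
qed simp

subsection \<open>The columns of the tableau\<close>

primrec blocks :: "nat \<Rightarrow> nat list \<Rightarrow> nat list list" where
  "blocks s [] = []"
| "blocks s (q # qs) = [s..<s + q] # blocks (s + q) qs"

lemma concat_blocks: "concat (blocks s qs) = [s..<s + sum_list qs]"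
proof (induction qs arbitrary: s)
  case (Cons q qs)
  have "[s..<s + q + sum_list qs] = [s..<s + q] @ [s + q..<s + q + sum_list qs]"
    by (rule upt_add_eq_append) simp
  thus ?case using Cons by (simp add: add.assoc)
qed simp

lemma length_blocks [simp]: "length (blocks s qs) = length qs"
  by (induction qs arbitrary: s) auto

lemma length_nth_blocks: "m < length qs \<Longrightarrow> length (blocks s qs ! m) = qs ! m"
  by (induction qs arbitrary: s m) (auto simp: nth_Cons split: nat.split)

text \<open>Positions are numbered from s but list entries from 0. The lower bound is carried along
  because it makes the truncated subtraction exact.\<close>

lemma nth_boxes:
  "m < length js \<Longrightarrow> i < q (js ! m) \<Longrightarrow> s \<le> blocks s (map q js) ! m ! i \<and>
    concat (map (\<lambda>j. map (\<lambda>i. (i, j)) [1..<Suc (q j)]) js) ! (blocks s (map q js) ! m ! i - s) = (Suc i, js ! m)"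
proof (induction js arbitrary: s m)
  case (Cons j js)
  show ?case
  proof (cases m)
    case 0
    thus ?thesis using Cons.prems by (simp add: nth_append del: upt_Suc)
  next
    case (Suc m')
    let ?e = "blocks (s + q j) (map q js) ! m' ! i"
    have "s + q j \<le> ?e \<and> concat (map (\<lambda>j. map (\<lambda>i. (i, j)) [1..<Suc (q j)]) js) ! (?e - (s + q j)) = (Suc i, js ! m')"
      using Cons.prems Suc by (intro Cons.IH) auto
    moreover from this have "\<not> ?e - s < q j" "?e - s - q j = ?e - (s + q j)" by auto
    ultimately show ?thesis using Suc by (simp add: nth_append del: upt_Suc)
  qed
qed simp

definition tableau_columns :: "nat list \<Rightarrow> nat list list" where
  "tableau_columns lam = blocks 1 (map (conj_part lam) [1..<Suc (part lam 1)])"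

lemma length_tableau_columns: "length (tableau_columns lam) = part lam 1"
  by (simp add: tableau_columns_def)

lemma length_nth_tableau_columns: "m < part lam 1 \<Longrightarrow> length (tableau_columns lam ! m) = conj_part lam (Suc m)"
  by (simp add: tableau_columns_def length_nth_blocks del: upt_Suc)

lemma tableau_columns_nth:
  assumes "m < part lam 1" "i < length (tableau_columns lam ! m)"
  shows "column_no lam (tableau_columns lam ! m ! i) = Suc m"
    "content lam (tableau_columns lam ! m ! i) = int m - int i"
proof -
  have "box lam (tableau_columns lam ! m ! i) = (Suc i, [1..<Suc (part lam 1)] ! m)"
    using nth_boxes[of m "[1..<Suc (part lam 1)]" i "conj_part lam" 1] assms
    by (simp add: box_def column_boxes_def tableau_columns_def length_nth_blocks del: upt_Suc)
  thus "column_no lam (tableau_columns lam ! m ! i) = Suc m"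
    "content lam (tableau_columns lam ! m ! i) = int m - int i"
    using assms(1) by (simp_all add: column_no_def content_def del: upt_Suc)
qed

lemma part_antimono:
  assumes "sorted_wrt (\<ge>) lam" "1 \<le> i" "i \<le> j" shows "part lam j \<le> part lam i"
  using assms sorted_wrt_nth_less[OF assms(1), of "i - 1" "j - 1"]
  by (cases "i = j") (auto simp: part_def)

lemma conj_part_antimono: "j \<le> k \<Longrightarrow> conj_part lam k \<le> conj_part lam j"
  unfolding conj_part_def by (intro card_mono) auto

text \<open>The rows with at least j boxes form an initial segment.\<close>

lemma conj_part_gt:
  assumes "sorted_wrt (\<ge>) lam" "1 \<le> j" shows "a < conj_part lam j \<longleftrightarrow> j \<le> part lam (Suc a)"
proof
  assume "j \<le> part lam (Suc a)"
  hence "Suc a \<le> length lam" using assms(2) by (auto simp: part_def split: if_splits)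
  moreover have "j \<le> part lam i" if "1 \<le> i" "i \<le> Suc a" for i
    using part_antimono[OF assms(1) that] \<open>j \<le> part lam (Suc a)\<close> by simp
  ultimately have "{1..Suc a} \<subseteq> {i \<in> {1..length lam}. j \<le> part lam i}" by auto
  hence "card {1..Suc a} \<le> conj_part lam j" unfolding conj_part_def by (intro card_mono) auto
  thus "a < conj_part lam j" by simp
next
  assume a: "a < conj_part lam j"
  show "j \<le> part lam (Suc a)"
  proof (rule ccontr)
    assume "\<not> j \<le> part lam (Suc a)"
    hence "i \<le> a" if "1 \<le> i" "j \<le> part lam i" for i
      using part_antimono[OF assms(1), of "Suc a" i] that by (cases "i \<le> a") auto
    hence "{i \<in> {1..length lam}. j \<le> part lam i} \<subseteq> {1..a}" by auto
    hence "conj_part lam j \<le> card {1..a}" unfolding conj_part_def by (intro card_mono) auto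
    thus False using a by simp
  qed
qed

text \<open>The boxes are counted by columns and by rows.\<close>

lemma sum_list_conj_part:
  assumes "partition_of n lam"
  shows "sum_list (map (conj_part lam) [1..<Suc (part lam 1)]) = n"
proof -
  let ?I = "{1..length lam}" and ?J = "{1..part lam 1}"
  have "sum_list (map (conj_part lam) [1..<Suc (part lam 1)]) = (\<Sum>j\<in>?J. conj_part lam j)"
    by (simp add: interv_sum_list_conv_sum_set_nat atLeastLessThanSuc_atLeastAtMost del: upt_Suc)
  also have "\<dots> = (\<Sum>j\<in>?J. \<Sum>i\<in>?I. if j \<le> part lam i then 1 else 0)"
  proof (rule sum.cong[OF refl])
    fix j
    have "conj_part lam j = (\<Sum>i\<in>{i\<in>?I. j \<le> part lam i}. 1)" by (simp only: conj_part_def card_eq_sum)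
    also have "\<dots> = (\<Sum>i\<in>?I. if j \<le> part lam i then 1 else 0)" by (rule sum.inter_filter) simp
    finally show "conj_part lam j = (\<Sum>i\<in>?I. if j \<le> part lam i then 1 else 0)" .
  qed
  also have "\<dots> = (\<Sum>i\<in>?I. \<Sum>j\<in>?J. if j \<le> part lam i then 1 else 0)" by (rule sum.swap)
  also have "\<dots> = (\<Sum>i\<in>?I. part lam i)"
  proof (rule sum.cong[OF refl])
    fix i assume "i \<in> ?I"
    hence J: "{j\<in>?J. j \<le> part lam i} = {1..part lam i}"
      using part_antimono[of lam 1 i] assms by (auto simp: partition_of_def)
    have "(\<Sum>j\<in>?J. if j \<le> part lam i then 1 else 0) = (\<Sum>j\<in>{j\<in>?J. j \<le> part lam i}. 1 :: nat)"
      by (rule sum.inter_filter[symmetric]) simp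
    thus "(\<Sum>j\<in>?J. if j \<le> part lam i then 1 else 0) = part lam i" unfolding J by simp
  qed
  also have "\<dots> = (\<Sum>i<length lam. lam ! i)"
    by (rule sum.reindex_bij_witness[of _ Suc "\<lambda>i. i - 1"]) (auto simp: part_def)
  also have "\<dots> = n" using assms by (simp add: partition_of_def sum_list_sum_nth atLeast0LessThan)
  finally show ?thesis .
qed

lemma good_colsI:
  assumes "\<And>m. m < length cs \<Longrightarrow> cs ! m \<noteq> []" "distinct (concat cs)"
    "\<And>m i. m < length cs \<Longrightarrow> i < length (cs ! m) \<Longrightarrow> x (cs ! m ! i) = u + of_nat m - of_nat i"
    "\<And>l m. l \<le> m \<Longrightarrow> m < length cs \<Longrightarrow> length (cs ! m) \<le> length (cs ! l)"
  shows "good_cols x u cs"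
  using assms
proof (induction cs arbitrary: u)
  case (Cons c cs)
  have "good_cols x (u + 1) cs"
  proof (rule Cons.IH)
    show "cs ! m \<noteq> []" if "m < length cs" for m using Cons.prems(1)[of "Suc m"] that by simp
    show "distinct (concat cs)" using Cons.prems(2) by simp
    show "x (cs ! m ! i) = u + 1 + of_nat m - of_nat i" if "m < length cs" "i < length (cs ! m)" for m i
      using Cons.prems(3)[of "Suc m" i] that by simp
    show "length (cs ! m) \<le> length (cs ! l)" if "l \<le> m" "m < length cs" for l m
      using Cons.prems(4)[of "Suc l" "Suc m"] that by simp
  qed
  moreover have "length b \<le> length c" if b: "b \<in> set cs" for b
  proof -
    obtain m where "m < length cs" "b = cs ! m" using b by (metis in_set_conv_nth)
    thus ?thesis using Cons.prems(4)[of 0 "Suc m"] by simp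
  qed
  ultimately show ?case using Cons.prems(1)[of 0] Cons.prems(2) Cons.prems(3)[of 0] by simp
qed simp

lemma column_contentsI:
  assumes "\<And>c. c \<in> set cs \<Longrightarrow> c \<noteq> []" "distinct (concat cs)"
    "\<And>c i. c \<in> set cs \<Longrightarrow> i < length c \<Longrightarrow> x (c ! i) = x (hd c) - of_nat i"
    "sorted_wrt (\<lambda>c b. \<forall>k\<in>set c. \<forall>l\<in>set b. x k \<noteq> x l) cs"
  shows "column_contents x cs"
  using assms
proof (induction cs)
  case (Cons c cs)
  have "column_contents x cs"
  proof (rule Cons.IH)
    show "b \<noteq> []" if "b \<in> set cs" for b by (rule Cons.prems(1)) (use that in simp)
    show "distinct (concat cs)" using Cons.prems(2) by simp
    show "x (b ! i) = x (hd b) - of_nat i" if "b \<in> set cs" "i < length b" for b i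
      by (rule Cons.prems(3)) (use that in simp_all)
    show "sorted_wrt (\<lambda>c b. \<forall>k\<in>set c. \<forall>l\<in>set b. x k \<noteq> x l) cs" using Cons.prems(4) by simp
  qed
  moreover have "\<forall>k\<in>set c. \<forall>l\<in>set (concat cs). x k \<noteq> x l"
    using Cons.prems(4) unfolding sorted_wrt.simps set_concat by blast
  moreover have "c \<noteq> []" by (rule Cons.prems(1)) simp
  moreover have "\<forall>i<length c. x (c ! i) = x (hd c) - of_nat i"
    using Cons.prems(3)[of c] by (meson list.set_intros(1))
  ultimately show ?case using Cons.prems(2) unfolding column_contents.simps by simp
qed simp

lemma nonzero_sumsI: "sorted_wrt (\<lambda>c b. \<forall>k\<in>set c. \<forall>l\<in>set b. y k + y l \<noteq> 0) cs \<Longrightarrow> nonzero_sums y cs"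
  by (induction cs) (auto simp: set_concat)

lemma columns_separatedI:
  assumes "sorted_wrt (\<lambda>c b. \<forall>k\<in>set c. \<forall>l\<in>set b. w k \<noteq> w l) cs"
    "\<forall>c\<in>set cs. \<forall>k\<in>set c. \<forall>l\<in>set c. w k = w l"
  shows "columns_separated w cs"
  using assms
proof (induction cs)
  case (Cons c cs)
  have "columns_separated w cs"
  proof (rule Cons.IH)
    show "sorted_wrt (\<lambda>c b. \<forall>k\<in>set c. \<forall>l\<in>set b. w k \<noteq> w l) cs" using Cons.prems(1) by simp
    show "\<forall>c\<in>set cs. \<forall>k\<in>set c. \<forall>l\<in>set c. w k = w l" using Cons.prems(2) by (meson list.set_intros(2))
  qed
  moreover have "\<forall>k\<in>set c. \<forall>l\<in>set (concat cs). w k \<noteq> w l"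
    using Cons.prems(1) unfolding sorted_wrt.simps set_concat by blast
  moreover have "\<forall>k\<in>set c. \<forall>l\<in>set c. w k = w l" using Cons.prems(2) by (meson list.set_intros(1))
  ultimately show ?case unfolding columns_separated.simps by blast
qed simp

section \<open>The tableau columns of a partition and the operators in column form\<close>

lemma concat_tableau_columns: "partition_of n lam \<Longrightarrow> concat (tableau_columns lam) = [1..<Suc n]"
  using sum_list_conj_part[of n lam] by (simp add: tableau_columns_def concat_blocks del: upt_Suc)

lemma set_tableau_columns: "partition_of n lam \<Longrightarrow> set (concat (tableau_columns lam)) = {1..n}"
  by (simp only: concat_tableau_columns set_upt atLeastLessThanSuc_atLeastAtMost)

lemma tableau_column_nonempty:
  assumes "partition_of n lam" "m < part lam 1" shows "0 < length (tableau_columns lam ! m)"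
  using assms conj_part_gt[of lam "Suc m" 0] by (simp add: length_nth_tableau_columns partition_of_def)

lemma tableau_column_cases:
  assumes "c \<in> set (tableau_columns lam)"
  obtains m where "m < part lam 1" "c = tableau_columns lam ! m"
  using assms by (metis in_set_conv_nth length_tableau_columns)

lemma tableau_position_cases:
  assumes "partition_of n lam" "k \<in> {1..n}"
  obtains m i where "m < part lam 1" "i < length (tableau_columns lam ! m)" "k = tableau_columns lam ! m ! i"
proof -
  have "k \<in> set (concat (tableau_columns lam))" using assms by (simp only: set_tableau_columns)
  then obtain c where "c \<in> set (tableau_columns lam)" "k \<in> set c" unfolding set_concat by blast
  thus ?thesis using that tableau_column_cases in_set_conv_nth by metis
qed

lemma tableau_column_subset:
  assumes "partition_of n lam" "m < part lam 1" shows "set (tableau_columns lam ! m) \<subseteq> {1..n}"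
proof -
  have "tableau_columns lam ! m \<in> set (tableau_columns lam)"
    using assms(2) by (simp add: length_tableau_columns)
  hence "set (tableau_columns lam ! m) \<subseteq> set (concat (tableau_columns lam))" unfolding set_concat by blast
  thus ?thesis by (simp only: set_tableau_columns[OF assms(1)])
qed

lemma tableau_position:
  assumes "partition_of n lam" "m < part lam 1" "i < length (tableau_columns lam ! m)"
  shows "tableau_columns lam ! m ! i \<in> {1..n}"
  by (rule subsetD[OF tableau_column_subset[OF assms(1,2)] nth_mem[OF assms(3)]])

lemma tableau_sorted_wrt:
  assumes "\<And>m m' i i'. m < m' \<Longrightarrow> m' < part lam 1 \<Longrightarrow> i < length (tableau_columns lam ! m) \<Longrightarrow>
    i' < length (tableau_columns lam ! m') \<Longrightarrow> R (tableau_columns lam ! m ! i) (tableau_columns lam ! m' ! i')"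
  shows "sorted_wrt (\<lambda>c b. \<forall>k\<in>set c. \<forall>l\<in>set b. R k l) (tableau_columns lam)"
  unfolding sorted_wrt_iff_nth_less length_tableau_columns
proof (intro allI impI ballI)
  fix m m' k l assume m: "m < m'" "m' < part lam 1"
    and "k \<in> set (tableau_columns lam ! m)" "l \<in> set (tableau_columns lam ! m')"
  then obtain i i' where "i < length (tableau_columns lam ! m)" "k = tableau_columns lam ! m ! i"
    "i' < length (tableau_columns lam ! m')" "l = tableau_columns lam ! m' ! i'" by (metis in_set_conv_nth)
  thus "R k l" using assms[OF m] by blast
qed

text \<open>The shift d is 0 for E and (N - 1)/2 for F.\<close>

lemma good_cols_tableau:
  assumes "partition_of n lam"
  shows "good_cols (\<lambda>k. of_int (content lam k) + d) d (tableau_columns lam)"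
proof (rule good_colsI)
  show "tableau_columns lam ! m \<noteq> []" if "m < length (tableau_columns lam)" for m
    using tableau_column_nonempty[OF assms, of m] that by (auto simp: length_tableau_columns)
  show "distinct (concat (tableau_columns lam))" by (simp only: concat_tableau_columns[OF assms] distinct_upt)
  show "of_int (content lam (tableau_columns lam ! m ! i)) + d = d + of_nat m - of_nat i"
    if "m < length (tableau_columns lam)" "i < length (tableau_columns lam ! m)" for m i
    using tableau_columns_nth(2)[of m lam i] that by (simp add: length_tableau_columns)
  show "length (tableau_columns lam ! m) \<le> length (tableau_columns lam ! l)"
    if "l \<le> m" "m < length (tableau_columns lam)" for l m
    using that conj_part_antimono[of "Suc l" "Suc m" lam]
    by (simp add: length_tableau_columns length_nth_tableau_columns)
qed

lemma columns_separated_tableau: "columns_separated (column_no lam) (tableau_columns lam)"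
proof (rule columns_separatedI)
  show "sorted_wrt (\<lambda>c b. \<forall>k\<in>set c. \<forall>l\<in>set b. column_no lam k \<noteq> column_no lam l) (tableau_columns lam)"
    by (rule tableau_sorted_wrt) (simp add: tableau_columns_nth)
  have "column_no lam k = Suc m" if "k \<in> set (tableau_columns lam ! m)" "m < part lam 1" for k m
    using that tableau_columns_nth(1)[OF that(2)] by (metis in_set_conv_nth)
  thus "\<forall>c\<in>set (tableau_columns lam). \<forall>k\<in>set c. \<forall>l\<in>set c. column_no lam k = column_no lam l"
    by (metis tableau_column_cases)
qed

lemma E_den_eq: "E_den lam t k l = (of_int (content lam k) + t k) - (of_int (content lam l) + t l)"
  by (simp add: E_den_def)

lemma column_contents_tableau:
  assumes lam: "partition_of n lam" and t: "t \<in> E_domain n lam"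
  shows "column_contents (\<lambda>k. of_int (content lam k) + t k) (tableau_columns lam)"
proof (rule column_contentsI)
  show "c \<noteq> []" if "c \<in> set (tableau_columns lam)" for c
    by (metis that tableau_column_cases tableau_column_nonempty[OF lam] length_greater_0_conv)
  show "distinct (concat (tableau_columns lam))" by (simp only: concat_tableau_columns[OF lam] distinct_upt)
  fix c i assume "c \<in> set (tableau_columns lam)" and i: "i < length c"
  then obtain m where m: "m < part lam 1" "c = tableau_columns lam ! m" by (metis tableau_column_cases)
  have c0: "0 < length c" using i by linarith
  hence hd: "hd c = c ! 0" by (simp add: hd_conv_nth)
  have "c ! i \<in> {1..n}" "c ! 0 \<in> {1..n}"
    unfolding m(2) using i c0 m by (auto simp only: intro!: tableau_position[OF lam m(1)])
  hence "t (c ! i) = t (c ! 0)"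
    using t tableau_columns_nth(1)[OF m(1), of i] tableau_columns_nth(1)[OF m(1), of 0] i c0 m(2)
    unfolding E_domain_def by (metis (mono_tags, lifting) mem_Collect_eq)
  thus "of_int (content lam (c ! i)) + t (c ! i) = of_int (content lam (hd c)) + t (hd c) - of_nat i"
    unfolding hd using tableau_columns_nth(2)[OF m(1), of i] tableau_columns_nth(2)[OF m(1), of 0] i c0 m(2) by simp
next
  show "sorted_wrt (\<lambda>c b. \<forall>k\<in>set c. \<forall>l\<in>set b. of_int (content lam k) + t k \<noteq> of_int (content lam l) + t l)
    (tableau_columns lam)"
  proof (rule tableau_sorted_wrt)
    fix m m' i i' assume m: "m < m'" "m' < part lam 1"
      and i: "i < length (tableau_columns lam ! m)" "i' < length (tableau_columns lam ! m')"
    let ?k = "tableau_columns lam ! m ! i" and ?l = "tableau_columns lam ! m' ! i'"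
    have m_lt: "m < part lam 1" using m by linarith
    have "?k \<in> {1..n}" by (rule tableau_position[OF lam m_lt i(1)])
    moreover have "?l \<in> {1..n}" by (rule tableau_position[OF lam m(2) i(2)])
    moreover have "?k \<noteq> ?l" using tableau_columns_nth(1)[of m lam i] tableau_columns_nth(1)[of m' lam i'] m i by auto
    ultimately have "E_den lam t ?k ?l \<noteq> 0 \<or> E_den lam t ?l ?k \<noteq> 0"
      using t unfolding E_domain_def by (metis (mono_tags, lifting) mem_Collect_eq linorder_neqE_nat)
    thus "of_int (content lam ?k) + t ?k \<noteq> of_int (content lam ?l) + t ?l" by (metis E_den_eq right_minus_eq)
  qed
qed

lemma E_fun_eq_Erec:
  assumes "partition_of n lam" "t \<in> E_domain n lam"
  shows "E_fun n lam t T = Erec (\<lambda>k. of_int (content lam k) + t k) (tableau_columns lam) T"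
proof -
  let ?x = "\<lambda>k. of_int (content lam k) + t k"
  have "E_fun n lam t T = foldr (\<lambda>(k, l) T. T - tscale (1 / (?x k - ?x l)) (P_op k l T)) (lex_pairs n) T"
    unfolding E_fun_def E_den_eq by (simp only: ordered_prod_map[symmetric] split_def)
  also have "lex_pairs n = pairs_of (concat (tableau_columns lam))"
    by (simp only: lex_pairs_eq concat_tableau_columns[OF assms(1)])
  finally show ?thesis by (simp only: foldr_pairs_Erec[OF column_contents_tableau[OF assms]])
qed

lemma F_Omega_0_eq_Grec:
  assumes "partition_of n lam"
  shows "F_Omega_0 N n lam T
    = Grec N n (\<lambda>k. of_int (content lam k) + (of_nat N - 1) / 2) (tableau_columns lam) (E_Omega n lam T)"
proof -
  let ?y = "\<lambda>k. of_int (content lam k) + (of_nat N - 1) / 2"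
  have "F_den N lam k l = ?y k + ?y l" for k l by (simp add: F_den_def field_simps)
  hence Rb: "(\<lambda>T. T - tscale (1 / F_den N lam k l) (Q_op N n k l T)) = Rb N n ?y k l" for k l
    by (simp only: Rb_def fun_eq_iff) simp
  have "F_Omega_0 N n lam T = foldr (\<lambda>p. Rb N n ?y (fst p) (snd p))
      (filter (\<lambda>p. column_no lam (fst p) \<noteq> column_no lam (snd p)) (lex_pairs n)) (E_Omega n lam T)"
    unfolding F_Omega_0_def Rb comp_apply by (simp only: ordered_prod_filter[symmetric] split_def)
  also have "\<dots> = Grec N n ?y (tableau_columns lam) (E_Omega n lam T)"
    using foldr_pairs_Grec[OF columns_separated_tableau[of lam], of N n ?y "E_Omega n lam T"]
    unfolding lex_pairs_eq concat_tableau_columns[OF assms] split_def .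
  finally show ?thesis .
qed

subsection \<open>Regular values\<close>

text \<open>In contrast to \<open>regular_value\<close>, the fraction must represent f at z too, so
  that f z is itself the regular value there. The closure properties below then carry this through
  the construction of \<open>Erec\<close>.\<close>

definition rational_at :: "nat \<Rightarrow> (nat \<Rightarrow> complex) set \<Rightarrow> (nat \<Rightarrow> complex) \<Rightarrow> ((nat \<Rightarrow> complex) \<Rightarrow> complex) \<Rightarrow> bool" where
  "rational_at n D z f \<longleftrightarrow> (\<exists>p\<in>poly_fun n. \<exists>q\<in>poly_fun n. q z \<noteq> 0 \<and> (\<forall>t\<in>insert z D. q t * f t = p t))"

lemma rational_at_const: "rational_at n D z (\<lambda>_. c)"
  unfolding rational_at_def
  by (rule bexI[OF _ poly_fun.const[of c]], rule bexI[OF _ poly_fun.const[of 1]]) simp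

lemma rational_at_add:
  assumes "rational_at n D z f" "rational_at n D z g" shows "rational_at n D z (\<lambda>t. f t + g t)"
proof -
  obtain p q p' q' where pq: "p \<in> poly_fun n" "q \<in> poly_fun n" "q z \<noteq> 0" "\<And>t. t \<in> insert z D \<Longrightarrow> q t * f t = p t"
    "p' \<in> poly_fun n" "q' \<in> poly_fun n" "q' z \<noteq> 0" "\<And>t. t \<in> insert z D \<Longrightarrow> q' t * g t = p' t"
    using assms unfolding rational_at_def by blast
  have "(q t * q' t) * (f t + g t) = p t * q' t + p' t * q t" if "t \<in> insert z D" for t
    using pq(4)[OF that, symmetric] pq(8)[OF that, symmetric] by (simp only: algebra_simps)
  thus ?thesis unfolding rational_at_def
    using pq by (intro bexI[of _ "\<lambda>t. p t * q' t + p' t * q t"] bexI[of _ "\<lambda>t. q t * q' t"])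
      (auto intro: poly_fun.intros)
qed

lemma rational_at_mult:
  assumes "rational_at n D z f" "rational_at n D z g" shows "rational_at n D z (\<lambda>t. f t * g t)"
proof -
  obtain p q p' q' where pq: "p \<in> poly_fun n" "q \<in> poly_fun n" "q z \<noteq> 0" "\<And>t. t \<in> insert z D \<Longrightarrow> q t * f t = p t"
    "p' \<in> poly_fun n" "q' \<in> poly_fun n" "q' z \<noteq> 0" "\<And>t. t \<in> insert z D \<Longrightarrow> q' t * g t = p' t"
    using assms unfolding rational_at_def by blast
  have "(q t * q' t) * (f t * g t) = p t * p' t" if "t \<in> insert z D" for t
    using pq(4)[OF that, symmetric] pq(8)[OF that, symmetric] by (simp only: mult.assoc mult.left_commute)
  thus ?thesis unfolding rational_at_def
    using pq by (intro bexI[of _ "\<lambda>t. p t * p' t"] bexI[of _ "\<lambda>t. q t * q' t"]) (auto intro: poly_fun.intros)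
qed

lemma rational_at_diff:
  assumes "rational_at n D z f" "rational_at n D z g" shows "rational_at n D z (\<lambda>t. f t - g t)"
  using rational_at_add[OF assms(1) rational_at_mult[OF rational_at_const[of n D z "-1"] assms(2)]] by simp

lemma rational_at_sum:
  "(\<And>a. a \<in> A \<Longrightarrow> rational_at n D z (f a)) \<Longrightarrow> rational_at n D z (\<lambda>t. \<Sum>a\<in>A. f a t)"
proof (induction A rule: infinite_finite_induct)
  case (insert a A)
  have "rational_at n D z (\<lambda>t. f a t + (\<Sum>a\<in>A. f a t))"
    by (rule rational_at_add[OF insert.prems insert.IH[OF insert.prems]]) auto
  thus ?case using insert.hyps by simp
qed (simp_all add: rational_at_const)

lemma rational_at_inverse:
  assumes "d \<in> poly_fun n" "\<And>t. t \<in> insert z D \<Longrightarrow> d t \<noteq> 0" shows "rational_at n D z (\<lambda>t. 1 / d t)"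
  unfolding rational_at_def
  by (rule bexI[OF _ poly_fun.const[of 1]], rule bexI[OF _ assms(1)]) (use assms(2) in auto)

definition rational_tensor :: "nat \<Rightarrow> (nat \<Rightarrow> complex) set \<Rightarrow> (nat \<Rightarrow> complex) \<Rightarrow> ((nat \<Rightarrow> complex) \<Rightarrow> tensor) \<Rightarrow> bool" where
  "rational_tensor n D z F \<longleftrightarrow> (\<forall>i. rational_at n D z (\<lambda>t. F t i))"

lemma rational_tensor_PS: "rational_tensor n D z F \<Longrightarrow> rational_tensor n D z (\<lambda>t. PS k B (F t))"
  unfolding rational_tensor_def PS_def sum_fun_apply P_op_def by (intro allI rational_at_sum) blast

lemma rational_tensor_diff:
  "rational_tensor n D z F \<Longrightarrow> rational_tensor n D z G \<Longrightarrow> rational_tensor n D z (\<lambda>t. F t - G t)"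
  unfolding rational_tensor_def minus_apply by (intro allI rational_at_diff) blast+

lemma rational_tensor_scale:
  "rational_at n D z f \<Longrightarrow> rational_tensor n D z F \<Longrightarrow> rational_tensor n D z (\<lambda>t. tscale (f t) (F t))"
  unfolding rational_tensor_def tscale_apply by (intro allI rational_at_mult) blast+

lemma rational_tensor_Ant: "rational_tensor n D z F \<Longrightarrow> rational_tensor n D z (\<lambda>t. Ant c (F t))"
proof (induction c)
  case (Cons a c)
  have "rational_tensor n D z (\<lambda>t. Ant c (F t))" by (rule Cons.IH[OF Cons.prems])
  from rational_tensor_diff[OF this rational_tensor_PS[OF this]] show ?case by simp
qed simp

lemma poly_fun_diff: "p \<in> poly_fun n \<Longrightarrow> q \<in> poly_fun n \<Longrightarrow> (\<lambda>t. p t - q t) \<in> poly_fun n"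
  using poly_fun.add[OF _ poly_fun.mult[OF poly_fun.const[of "-1"]], of p n q] by simp

lemma rational_tensor_row_op:
  assumes "\<And>b. b \<in> set cs \<Longrightarrow> (\<lambda>t. x t k - x t (hd b)) \<in> poly_fun n"
    "\<And>b t. b \<in> set cs \<Longrightarrow> t \<in> insert z D \<Longrightarrow> x t k - x t (hd b) \<noteq> 0" "rational_tensor n D z F"
  shows "rational_tensor n D z (\<lambda>t. row_op (x t) k cs (F t))"
  using assms(1,2)
proof (induction cs)
  case Nil thus ?case using assms(3) by (simp add: row_op_def)
next
  case (Cons b cs)
  have IH: "rational_tensor n D z (\<lambda>t. row_op (x t) k cs (F t))"
    by (rule Cons.IH) (use Cons.prems in auto)
  have "rational_at n D z (\<lambda>t. 1 / (x t k - x t (hd b)))"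
    by (rule rational_at_inverse) (use Cons.prems in \<open>simp_all\<close>)
  from rational_tensor_diff[OF IH rational_tensor_scale[OF this rational_tensor_PS[OF IH]]]
  show ?case by (simp add: row_op_def)
qed

text \<open>The only denominators are differences between a position and the top of a later column;
  they must not vanish on D and at z.\<close>

lemma rational_tensor_Erec:
  assumes "\<And>k. k \<in> set (concat cs) \<Longrightarrow> (\<lambda>t. x t k) \<in> poly_fun n" "\<And>c. c \<in> set cs \<Longrightarrow> c \<noteq> []"
    "\<And>t. t \<in> insert z D \<Longrightarrow> sorted_wrt (\<lambda>c b. \<forall>k\<in>set c. x t k \<noteq> x t (hd b)) cs"
  shows "rational_tensor n D z (\<lambda>t. Erec (x t) cs T)"
  using assms
proof (induction cs)
  case Nil show ?case by (simp add: rational_tensor_def rational_at_const)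
next
  case (Cons c cs)
  have IH: "rational_tensor n D z (\<lambda>t. Erec (x t) cs T)"
    by (rule Cons.IH) (use Cons.prems in auto)
  have row: "rational_tensor n D z (\<lambda>t. row_op (x t) k cs (F t))" if "k \<in> set c" "rational_tensor n D z F" for k F
  proof (rule rational_tensor_row_op[OF _ _ that(2)])
    fix b assume b: "b \<in> set cs"
    have "k \<in> set (concat (c # cs))" using that(1) by simp
    moreover have "b \<noteq> []" by (rule Cons.prems(2)) (use b in simp)
    hence "hd b \<in> set (concat cs)" using b hd_in_set[of b] unfolding set_concat by blast
    hence "hd b \<in> set (concat (c # cs))" by simp
    ultimately show "(\<lambda>t. x t k - x t (hd b)) \<in> poly_fun n" by (intro poly_fun_diff Cons.prems(1))
    show "x t k - x t (hd b) \<noteq> 0" if t: "t \<in> insert z D" for t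
      using Cons.prems(3)[OF t] b \<open>k \<in> set c\<close> by simp
  qed
  have "rational_tensor n D z (\<lambda>t. foldr (\<lambda>k. row_op (x t) k cs) d (Erec (x t) cs T))" if "set d \<subseteq> set c" for d
    using that
  proof (induction d)
    case Nil show ?case using IH by simp
  next
    case (Cons k d)
    from row[OF _ Cons.IH, of k] Cons.prems show ?case by simp
  qed
  from rational_tensor_Ant[OF this[OF subset_refl]] show ?case by simp
qed

lemma isCont_poly_fun:
  assumes "p \<in> poly_fun n" shows "isCont (\<lambda>s. p (\<lambda>k. z + \<i> * of_real s * w k)) 0"
  using assms by (induction rule: poly_fun.induct) (auto intro!: continuous_intros)

lemma eq_0_at_limit:
  fixes f :: "real \<Rightarrow> complex"
  assumes "isCont f 0" "\<And>s. s \<noteq> 0 \<Longrightarrow> f s = 0" shows "f 0 = 0"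
proof -
  have "(f \<midarrow>0\<rightarrow> f 0) = ((\<lambda>s. 0) \<midarrow>(0 :: real)\<rightarrow> f 0)" by (rule LIM_equal) (use assms(2) in auto)
  hence "(\<lambda>s. 0) \<midarrow>(0 :: real)\<rightarrow> f 0" using assms(1) by (simp only: isCont_def)
  thus ?thesis by (rule LIM_const_eq[symmetric])
qed

text \<open>The domain contains a punctured line through the point, along which the denominators
  do not vanish because the imaginary parts of the variables differ from column to column.\<close>

lemma line_in_E_domain:
  assumes lam: "partition_of n lam" and s: "s \<noteq> 0"
  shows "(\<lambda>k. z + \<i> * of_real s * of_nat (column_no lam k)) \<in> E_domain n lam"
proof -
  let ?t = "\<lambda>k. z + \<i> * of_real s * of_nat (column_no lam k)"
  have "E_den lam ?t k l \<noteq> 0" if kl: "k \<in> {1..n}" "l \<in> {1..n}" "k < l" for k l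
  proof (cases "column_no lam k = column_no lam l")
    case True
    obtain m i where k: "m < part lam 1" "i < length (tableau_columns lam ! m)" "k = tableau_columns lam ! m ! i"
      by (rule tableau_position_cases[OF lam kl(1)])
    obtain m' i' where l: "m' < part lam 1" "i' < length (tableau_columns lam ! m')" "l = tableau_columns lam ! m' ! i'"
      by (rule tableau_position_cases[OF lam kl(2)])
    have "m = m'" using True tableau_columns_nth(1)[OF k(1,2)] tableau_columns_nth(1)[OF l(1,2)] k l by simp
    hence "i \<noteq> i'" using kl(3) k(3) l(3) by auto
    hence "content lam k \<noteq> content lam l"
      using tableau_columns_nth(2)[OF k(1,2)] tableau_columns_nth(2)[OF l(1,2)] k l \<open>m = m'\<close> by simp
    thus ?thesis using True by (simp add: E_den_def)
  next
    case False
    have "Im (E_den lam ?t k l) = s * (of_nat (column_no lam k) - of_nat (column_no lam l))"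
      by (simp add: E_den_def algebra_simps)
    thus ?thesis using s False by (metis eq_iff_diff_eq_0 mult_eq_0_iff of_nat_eq_iff zero_complex.sel(2))
  qed
  thus ?thesis by (simp add: E_domain_def)
qed

text \<open>Cross-multiplication of two representations gives a polynomial that vanishes on the
  punctured line of \<open>line_in_E_domain\<close>, hence by continuity at the point
  itself.\<close>

lemma regular_value_unique:
  assumes lam: "partition_of n lam"
    and "regular_value n (E_domain n lam) f (\<lambda>_. z) v" "regular_value n (E_domain n lam) f (\<lambda>_. z) v'"
  shows "v = v'"
proof -
  let ?D = "E_domain n lam" and ?z = "\<lambda>_. z"
  obtain p q p' q' where pq: "p \<in> poly_fun n" "q \<in> poly_fun n" "q ?z \<noteq> 0" "\<And>t. t \<in> ?D \<Longrightarrow> q t * f t = p t" "v = p ?z / q ?z"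
    "p' \<in> poly_fun n" "q' \<in> poly_fun n" "q' ?z \<noteq> 0" "\<And>t. t \<in> ?D \<Longrightarrow> q' t * f t = p' t" "v' = p' ?z / q' ?z"
    using assms(2,3) unfolding regular_value_def by blast
  define r where "r t = q' t * p t + (-1) * (q t * p' t)" for t
  have "r \<in> poly_fun n" unfolding r_def using pq by (intro poly_fun.intros)
  hence cont: "isCont (\<lambda>s. r (\<lambda>k. z + \<i> * of_real s * of_nat (column_no lam k))) 0" by (rule isCont_poly_fun)
  have r0: "r t = 0" if "t \<in> ?D" for t
    using pq(4)[OF that, symmetric] pq(9)[OF that, symmetric] by (simp add: r_def)
  have "r (\<lambda>k. z + \<i> * of_real 0 * of_nat (column_no lam k)) = 0"
    by (rule eq_0_at_limit[OF cont]) (rule r0[OF line_in_E_domain[OF lam]])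
  hence "p ?z * q' ?z = p' ?z * q ?z" by (simp add: r_def mult.commute)
  thus ?thesis unfolding pq(5,10) by (rule frac_eq_eq[THEN iffD2, OF pq(3,8)])
qed

lemma Erec_shift: "Erec (\<lambda>k. x k + d) cs = Erec x cs"
proof (induction cs)
  case (Cons c cs)
  have "row_op (\<lambda>k. x k + d) k cs = row_op x k cs" for k by (simp add: fun_eq_iff row_op_def)
  thus ?case using Cons by simp
qed simp

lemma E_Omega_eq_Erec:
  assumes lam: "partition_of n lam"
  shows "E_Omega n lam T = Erec (\<lambda>k. of_int (content lam k)) (tableau_columns lam) T"
proof
  fix i
  let ?cs = "tableau_columns lam" and ?D = "E_domain n lam"
  let ?x = "\<lambda>t k. of_int (content lam k) + t k"
  let ?v = "Erec (\<lambda>k. of_int (content lam k)) ?cs T i"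
  have reg: "regular_value n ?D (\<lambda>t. E_fun n lam t T i) (\<lambda>_. z) ?v" for z
  proof -
    have "rational_tensor n ?D (\<lambda>_. z) (\<lambda>t. Erec (?x t) ?cs T)"
    proof (rule rational_tensor_Erec)
      show "(\<lambda>t. ?x t k) \<in> poly_fun n" if "k \<in> set (concat ?cs)" for k
        by (intro poly_fun.intros) (use that in \<open>simp only: set_tableau_columns[OF lam]\<close>)
      show "c \<noteq> []" if "c \<in> set ?cs" for c
        by (metis that tableau_column_cases tableau_column_nonempty[OF lam] length_greater_0_conv)
      fix t assume t: "t \<in> insert (\<lambda>_. z) ?D"
      show "sorted_wrt (\<lambda>c b. \<forall>k\<in>set c. ?x t k \<noteq> ?x t (hd b)) ?cs"
        unfolding sorted_wrt_iff_nth_less length_tableau_columns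
      proof (intro allI impI ballI)
        fix m m' k assume m: "m < m'" "m' < part lam 1" and "k \<in> set (?cs ! m)"
        then obtain a where a: "a < length (?cs ! m)" "k = ?cs ! m ! a" by (metis in_set_conv_nth)
        have ne: "0 < length (?cs ! m')" by (rule tableau_column_nonempty[OF lam m(2)])
        hence hd: "hd (?cs ! m') = ?cs ! m' ! 0" by (simp add: hd_conv_nth)
        show "?x t k \<noteq> ?x t (hd (?cs ! m'))"
        proof (cases "t \<in> ?D")
          case True
          have m_lt: "m < part lam 1" using m by linarith
          have "k \<in> {1..n}" unfolding a(2) by (rule tableau_position[OF lam m_lt a(1)])
          moreover have "hd (?cs ! m') \<in> {1..n}" unfolding hd by (rule tableau_position[OF lam m(2) ne])
          moreover have "k \<noteq> hd (?cs ! m')"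
            using tableau_columns_nth(1)[OF m_lt a(1)] tableau_columns_nth(1)[OF m(2) ne] m(1) a(2) by (auto simp: hd)
          ultimately have "E_den lam t k (hd (?cs ! m')) \<noteq> 0 \<or> E_den lam t (hd (?cs ! m')) k \<noteq> 0"
            using True unfolding E_domain_def by (metis (mono_tags, lifting) mem_Collect_eq linorder_neqE_nat)
          thus ?thesis by (metis E_den_eq right_minus_eq)
        next
          case False
          hence "t = (\<lambda>_. z)" using t by simp
          \<comment> \<open>The top of column m' has content m', larger than the content m - a of k.
            So the denominators of \<open>Erec\<close> do not vanish at equal variables.\<close>
          moreover have "content lam k \<noteq> content lam (hd (?cs ! m'))"
            using tableau_columns_nth(2)[of m lam a] tableau_columns_nth(2)[of m' lam 0] m a ne by (simp add: hd)
          ultimately show ?thesis by simp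
        qed
      qed
    qed
    then obtain p q where pq: "p \<in> poly_fun n" "q \<in> poly_fun n" "q (\<lambda>_. z) \<noteq> 0"
      "\<And>t. t \<in> insert (\<lambda>_. z) ?D \<Longrightarrow> q t * Erec (?x t) ?cs T i = p t"
      unfolding rational_tensor_def rational_at_def by blast
    have "p (\<lambda>_. z) = q (\<lambda>_. z) * ?v" using pq(4)[of "\<lambda>_. z"] by (simp add: Erec_shift)
    hence "?v = p (\<lambda>_. z) / q (\<lambda>_. z)" using pq(3) by simp
    moreover have "q t * E_fun n lam t T i = p t" if "t \<in> ?D" for t
      using pq(4)[of t] that E_fun_eq_Erec[OF lam that] by simp
    ultimately show ?thesis unfolding regular_value_def using pq(1-3) by blast
  qed
  have "(THE v. \<forall>z. regular_value n ?D (\<lambda>t. E_fun n lam t T i) (\<lambda>_. z) v) = ?v"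
    by (rule the_equality) (use reg regular_value_unique[OF lam _ reg] in blast)+
  thus "E_Omega n lam T i = ?v" by (simp only: E_Omega_def)
qed

subsection \<open>The orthogonal group\<close>

lemma O_group_columns:
  assumes g: "g \<in> O_group N" and bc: "b < N" "c < N"
  shows "(\<Sum>a<N. g $$ (a, b) * g $$ (a, c)) = (if b = c then 1 else 0)"
proof -
  have gc: "g \<in> carrier_mat N N" using g by (simp add: O_group_def GL_group_def)
  have e: "(g *\<^sub>v unit_vec N b) $ a = g $$ (a, b)" if "a < N" "b < N" for a b
    using gc that by (simp add: scalar_prod_right_unit)
  have "(g *\<^sub>v unit_vec N b) \<bullet> (g *\<^sub>v unit_vec N c) = unit_vec N b \<bullet> unit_vec N c"
    using g by (simp add: O_group_def)
  moreover have "(g *\<^sub>v unit_vec N b) \<bullet> (g *\<^sub>v unit_vec N c) = (\<Sum>a<N. g $$ (a, b) * g $$ (a, c))"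
    unfolding scalar_prod_def using gc bc e by (simp add: atLeast0LessThan)
  moreover have "unit_vec N b \<bullet> unit_vec N c = (if b = c then 1 else 0 :: complex)"
    using bc by (simp add: scalar_prod_left_unit)
  ultimately show ?thesis by simp
qed

lemma traceless_act:
  assumes g: "g \<in> O_group N" and T: "T \<in> traceless_tensors N n" and N: "1 \<le> N"
  shows "act N n g T \<in> traceless_tensors N n"
proof -
  have "contract N k l (act N n g T) i = 0" if kl: "k \<in> {1..n}" "l \<in> {1..n}" "k \<noteq> l" and i: "i \<in> midx N n" for k l i
  proof -
    let ?R = "\<lambda>j. \<Prod>m\<in>{1..n} - {k, l}. g $$ (i m, j m)" and ?D = "{j\<in>midx N n. j k = j l}"
    have split: "(\<Prod>m\<in>{1..n}. h m) = h k * (h l * (\<Prod>m\<in>{1..n} - {k, l}. h m))" for h :: "nat \<Rightarrow> complex"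
    proof -
      have "(\<Prod>m\<in>{1..n}. h m) = h k * (\<Prod>m\<in>{1..n} - {k}. h m)" by (rule prod.remove) (use kl in auto)
      also have "(\<Prod>m\<in>{1..n} - {k}. h m) = h l * (\<Prod>m\<in>{1..n} - {k} - {l}. h m)" by (rule prod.remove) (use kl in auto)
      also have "{1..n} - {k} - {l} = {1..n} - {k, l}" by auto
      finally show ?thesis .
    qed
    have "contract N k l (act N n g T) i = (\<Sum>a<N. \<Sum>j\<in>midx N n. g $$ (a, j k) * g $$ (a, j l) * (?R j * T j))"
      unfolding contract_def
    proof (rule sum.cong[OF refl])
      fix a assume "a \<in> {..<N}"
      hence ia: "i(k := a, l := a) \<in> midx N n" using i kl by (intro midx_upd) auto
      have "(\<Prod>m\<in>{1..n}. g $$ ((i(k := a, l := a)) m, j m)) = g $$ (a, j k) * (g $$ (a, j l) * ?R j)" for j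
      proof -
        have "(\<Prod>m\<in>{1..n} - {k, l}. g $$ ((i(k := a, l := a)) m, j m)) = ?R j" by (rule prod.cong) auto
        moreover have "(i(k := a, l := a)) k = a" "(i(k := a, l := a)) l = a" using kl(3) by simp_all
        ultimately show ?thesis by (simp only: split[of "\<lambda>m. g $$ ((i(k := a, l := a)) m, j m)"])
      qed
      thus "act N n g T (i(k := a, l := a)) = (\<Sum>j\<in>midx N n. g $$ (a, j k) * g $$ (a, j l) * (?R j * T j))"
        unfolding act_apply[OF ia] by (simp only: mult.assoc)
    qed
    also have "\<dots> = (\<Sum>j\<in>midx N n. \<Sum>a<N. g $$ (a, j k) * g $$ (a, j l) * (?R j * T j))" by (rule sum.swap)
    also have "\<dots> = (\<Sum>j\<in>midx N n. if j \<in> {j. j k = j l} then ?R j * T j else 0)"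
    proof (rule sum.cong[OF refl])
      fix j assume j: "j \<in> midx N n"
      show "(\<Sum>a<N. g $$ (a, j k) * g $$ (a, j l) * (?R j * T j)) = (if j \<in> {j. j k = j l} then ?R j * T j else 0)"
        unfolding sum_distrib_right[symmetric] O_group_columns[OF g midx_lt[OF j kl(1)] midx_lt[OF j kl(2)]] by simp
    qed
    also have "\<dots> = (\<Sum>j\<in>?D. ?R j * T j)"
      using sum.inter_filter[OF finite_midx[of N n], of "\<lambda>j. ?R j * T j" "\<lambda>j. j k = j l"] by simp
    finally have c: "contract N k l (act N n g T) i = (\<Sum>j\<in>?D. ?R j * T j)" .
    \<comment> \<open>The sum runs over words with a common letter at k and l, which
      \<open>?R\<close> does not see. Summing over this letter, at the price of a factor N, produces
      the contraction of T.\<close>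
    have "of_nat N * (\<Sum>j\<in>?D. ?R j * T j) = (\<Sum>j\<in>?D. \<Sum>a<N. ?R j * T j)" by (simp add: sum_distrib_left)
    also have "\<dots> = (\<Sum>j\<in>?D. \<Sum>a<N. ?R (j(k := a, l := a)) * T (j(k := a, l := a)))"
      by (rule sum_diagonal_pairs[OF kl])
    also have "\<dots> = (\<Sum>j\<in>?D. ?R j * contract N k l T j)"
    proof (rule sum.cong[OF refl])
      fix j
      have "?R (j(k := a, l := a)) = ?R j" for a by (rule prod.cong) auto
      thus "(\<Sum>a<N. ?R (j(k := a, l := a)) * T (j(k := a, l := a))) = ?R j * contract N k l T j"
        by (simp only: contract_def sum_distrib_left)
    qed
    also have "\<dots> = 0" using T kl by (intro sum.neutral) (simp add: traceless_tensors_def)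
    finally have "of_nat N * contract N k l (act N n g T) i = 0" unfolding c .
    thus ?thesis using N by simp
  qed
  thus ?thesis by (simp add: traceless_tensors_def tensors_act)
qed

lemma subspace_traceless: "tensor.subspace (traceless_tensors N n)"
  by (rule tensor.subspaceI)
    (simp_all add: traceless_tensors_def tensors_0 tensors_add tensors_scale contract_def plus_fun_apply
      zero_fun_apply tscale_apply sum.distrib sum_distrib_left[symmetric])

lemma subrep_traceless:
  assumes "subrep N n (GL_group N) V" "1 \<le> N"
  shows "subrep N n (O_group N) (V \<inter> traceless_tensors N n)"
  unfolding subrep_def
proof (intro conjI ballI)
  show "V \<inter> traceless_tensors N n \<subseteq> tensors N n" using assms(1) by (auto simp: subrep_def)
  show "tensor.subspace (V \<inter> traceless_tensors N n)"
    using assms(1) by (intro tensor.subspace_inter subspace_traceless) (simp add: subrep_def)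
  fix g T assume "g \<in> O_group N" "T \<in> V \<inter> traceless_tensors N n"
  thus "act N n g T \<in> V \<inter> traceless_tensors N n"
    using assms traceless_act[of g N T n] by (auto simp: subrep_def O_group_def)
qed

subsection \<open>The images of the two operators\<close>

lemma act_row_op:
  assumes "k \<in> {1..n}" "set (concat cs) \<subseteq> {1..n}"
  shows "act N n g (row_op x k cs T) = row_op x k cs (act N n g T)"
  using assms(2)
proof (induction cs)
  case (Cons b cs)
  have "act N n g (row_op x k cs T) = row_op x k cs (act N n g T)" using Cons by simp
  moreover have "act N n g (PS k (set b) S) = PS k (set b) (act N n g S)" for S
    by (rule commutes_on_PS_apply[OF commutes_on_act assms(1)]) (use Cons.prems in simp)
  ultimately show ?case by (simp add: row_op_def lin_diff[OF lin_act] lin_scale[OF lin_act])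
qed (simp add: row_op_def)

lemma act_Erec:
  assumes "set (concat cs) \<subseteq> {1..n}" "distinct (concat cs)"
  shows "act N n g (Erec x cs T) = Erec x cs (act N n g T)"
  using assms
proof (induction cs)
  case (Cons c cs)
  have row: "act N n g (foldr (\<lambda>k. row_op x k cs) d S) = foldr (\<lambda>k. row_op x k cs) d (act N n g S)"
    if "set d \<subseteq> {1..n}" for d S
    using that
  proof (induction d)
    case (Cons k d)
    thus ?case using \<open>set (concat (c # cs)) \<subseteq> {1..n}\<close> by (simp add: act_row_op)
  qed simp
  have "act N n g (Ant c S) = Ant c (act N n g S)" for S
    by (rule Ant_commute[where F = "act N n g", OF lin_act act_P]) (use Cons.prems in auto)
  thus ?case using Cons by (simp add: row)
qed simp

lemma tensors_Q: "Q_op N n k l T \<in> tensors N n"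
  by (simp add: tensors_def Q_op_def)

lemma tensors_Grec: "T \<in> tensors N n \<Longrightarrow> Grec N n y cs T \<in> tensors N n"
proof (induction cs)
  case (Cons c cs)
  have R: "Rb N n y k l S \<in> tensors N n" if "S \<in> tensors N n" for k l S
    unfolding Rb_def by (intro tensors_diff tensors_scale tensors_Q that)
  have row: "foldr (Rb N n y k) ls S \<in> tensors N n" if "S \<in> tensors N n" for k ls S
    using that by (induction ls) (simp_all add: R)
  have "foldr (\<lambda>k. foldr (Rb N n y k) (concat cs)) d S \<in> tensors N n" if "S \<in> tensors N n" for d S
    using that by (induction d) (simp_all add: row)
  thus ?case using Cons by simp
qed simp

lemma Grec_traceless:
  assumes T: "T \<in> traceless_tensors N n" and "set (concat cs) \<subseteq> {1..n}" "distinct (concat cs)"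
  shows "Grec N n y cs T = T"
  using assms(2,3)
proof (induction cs)
  case (Cons c cs)
  have R: "Rb N n y k l T = T" if "k \<in> set c" "l \<in> set (concat cs)" for k l
  proof -
    have "k \<in> {1..n}" "l \<in> {1..n}" "k \<noteq> l" using that Cons.prems by auto
    hence "Q_op N n k l T = 0" using T traceless_iff_Q[of T N n] by (auto simp: traceless_tensors_def)
    thus ?thesis by (simp add: Rb_def)
  qed
  have row: "foldr (Rb N n y k) ls T = T" if "k \<in> set c" "set ls \<subseteq> set (concat cs)" for k ls
    using that(2) by (induction ls) (use that(1) R in auto)
  have "foldr (\<lambda>k. foldr (Rb N n y k) (concat cs)) d T = T" if "set d \<subseteq> set c" for d
    using that by (induction d) (use row in auto)
  thus ?case using Cons by simp
qed simp

lemma Grec_in_traceless: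
  assumes good: "good_cols y ((of_nat N - 1) / 2) cs" and nz: "nonzero_sums y cs" and set: "set (concat cs) = {1..n}"
    and T: "garnir cs T" "T \<in> tensors N n" and N: "1 \<le> N"
  shows "Grec N n y cs T \<in> traceless_tensors N n"
proof -
  let ?U = "Grec N n y cs T"
  have U: "garnir cs ?U" by (rule garnir_Grec[OF good nz _ T(1)]) (simp add: set)
  have "Q_op N n k l ?U = 0" if kl: "k \<in> {1..n}" "l \<in> {1..n}" "k \<noteq> l" for k l
  proof (cases cs rule: list.exhaust)
    case Nil thus ?thesis using kl set by simp
  next
    case (Cons c cs')
    show ?thesis
    proof (cases cs')
      case Nil
      hence "alternating {1..n} ?U" using U Cons set by simp
      thus ?thesis using kl by (intro Q_eq_0) (rule alternatingD)
    next
      case (Cons b cs'')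
      hence cs: "cs = c # b # cs''" using \<open>cs = c # cs'\<close> by simp
      note c = good_colsD[OF good[unfolded cs]]
      note b = good_colsD[OF c(7)]
      have sub: "set (concat (c # b # cs'')) = {1..n}" using set by (simp only: cs)
      have hd: "hd c \<in> {1..n}" "hd b \<in> {1..n}"
        using hd_in_set[OF c(1)] hd_in_set[OF b(1)] unfolding sub[symmetric] by simp_all
      \<comment> \<open>The first column starts with (N - 1)/2 and the second with one more.\<close>
      have yN: "y (hd c) + y (hd b) = of_nat N" unfolding c(4) b(4) by (simp add: field_simps)
      have Q: "Q_op N n (hd c) (hd b) (Grec N n y (c # b # cs'') T) = 0"
        by (rule Q_hd_Grec[OF c(1) b(1) hd yN N])
      have "set (concat (c # b # cs'')) \<subseteq> {1..n}" unfolding sub by (rule subset_refl)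
      from Q_garnir_eq_0[OF U[unfolded cs] good[unfolded cs] this Q, unfolded sub, OF kl]
      show ?thesis unfolding cs .
    qed
  qed
  thus ?thesis using traceless_iff_Q[OF tensors_Grec[OF T(2)]] by simp
qed

text \<open>With contents m - i and m' - i', where m \<ge> 0, m' \<ge> 1, i < \<lambda>'_1 and i' <
  \<lambda>'_2, the denominator is at least N + 2 - \<lambda>'_1 - \<lambda>'_2, which is
  positive.\<close>

lemma nonzero_sums_tableau:
  assumes "conj_part lam 1 + conj_part lam 2 \<le> N"
  shows "nonzero_sums (\<lambda>k. of_int (content lam k) + (of_nat N - 1) / 2) (tableau_columns lam)"
proof (rule nonzero_sumsI, rule tableau_sorted_wrt)
  fix m m' i i' assume m: "m < m'" "m' < part lam 1"
    and i: "i < length (tableau_columns lam ! m)" "i' < length (tableau_columns lam ! m')"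
  let ?k = "tableau_columns lam ! m ! i" and ?l = "tableau_columns lam ! m' ! i'"
  have m_lt: "m < part lam 1" using m by linarith
  have "i < conj_part lam 1"
    using i(1) conj_part_antimono[of 1 "Suc m" lam] by (simp add: length_nth_tableau_columns[OF m_lt])
  moreover have "i' < conj_part lam 2"
    using i(2) m(1) conj_part_antimono[of 2 "Suc m'" lam] by (simp add: length_nth_tableau_columns[OF m(2)])
  ultimately have "0 < content lam ?k + content lam ?l + int N - 1"
    using assms m(1) tableau_columns_nth(2)[OF m_lt i(1)] tableau_columns_nth(2)[OF m(2) i(2)] by linarith
  hence "(of_int (content lam ?k + content lam ?l + int N - 1) :: complex) \<noteq> 0"
    by (simp only: of_int_eq_0_iff)
  moreover have "of_int (content lam ?k) + (of_nat N - 1) / 2 + (of_int (content lam ?l) + (of_nat N - 1) / 2)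
      = (of_int (content lam ?k + content lam ?l + int N - 1) :: complex)"
    by (simp add: field_simps)
  ultimately show "of_int (content lam ?k) + (of_nat N - 1) / 2 + (of_int (content lam ?l) + (of_nat N - 1) / 2) \<noteq> (0 :: complex)"
    by metis
qed

lemma length_filter_tableau_columns:
  assumes "partition_of n lam"
  shows "length (filter (\<lambda>c. a < length c) (tableau_columns lam)) = part lam (Suc a)"
proof -
  have sorted: "sorted_wrt (\<ge>) lam" using assms by (simp add: partition_of_def)
  have "map length (tableau_columns lam) = map (conj_part lam) [1..<Suc (part lam 1)]"
    by (rule nth_equalityI) (simp_all add: length_tableau_columns length_nth_tableau_columns del: upt_Suc)
  hence "length (filter (\<lambda>c. a < length c) (tableau_columns lam))
      = length (filter (\<lambda>q. a < q) (map (conj_part lam) [1..<Suc (part lam 1)]))"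
    by (metis (no_types, lifting) comp_def filter_cong filter_map length_map)
  also have "\<dots> = length (filter (\<lambda>j. a < conj_part lam j) [1..<Suc (part lam 1)])"
    by (simp add: filter_map comp_def del: upt_Suc)
  also have "\<dots> = card ({j. a < conj_part lam j} \<inter> set [1..<Suc (part lam 1)])"
    by (rule distinct_length_filter) (rule distinct_upt)
  also have "{j. a < conj_part lam j} \<inter> set [1..<Suc (part lam 1)] = {1..part lam (Suc a)}"
    using conj_part_gt[OF sorted] part_antimono[OF sorted, of 1 "Suc a"] by (auto simp del: upt_Suc)
  finally show ?thesis by simp
qed

lemma ex_row_word_tableau:
  assumes lam: "partition_of n lam" and N: "conj_part lam 1 \<le> N"
  obtains z where "row_word (tableau_columns lam) z" "z \<in> midx N n"
proof -
  \<comment> \<open>The column number minus one minus the content is the row index counted from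
    0.\<close>
  define z where "z = (\<lambda>k\<in>{1..n}. nat (int (column_no lam k) - 1 - content lam k))"
  have z: "z (tableau_columns lam ! m ! i) = i" if "m < part lam 1" "i < length (tableau_columns lam ! m)" for m i
    unfolding z_def using tableau_position[OF lam that] tableau_columns_nth[OF that] by simp
  have "row_word (tableau_columns lam) z"
    unfolding row_word_def using z by (metis tableau_column_cases)
  moreover have "z k < N" if k: "k \<in> {1..n}" for k
  proof -
    obtain m i where k: "m < part lam 1" "i < length (tableau_columns lam ! m)" "k = tableau_columns lam ! m ! i"
      by (rule tableau_position_cases[OF lam k])
    thus ?thesis using z[OF k(1,2)] conj_part_antimono[of 1 "Suc m" lam] N
      by (simp add: length_nth_tableau_columns)
  qed
  hence "z \<in> midx N n" unfolding midx_def z_def by (auto simp: PiE_iff)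
  ultimately show ?thesis by (rule that)
qed

text \<open>The image of \<open>Erec\<close> is invariant, satisfies the column relations and
  contains the highest weight tensor by \<open>ex_Erec_eq_col_tensor\<close>; irreducibility makes
  it the whole space.\<close>

lemma image_Erec:
  assumes good: "good_cols x u cs" and set: "set (concat cs) = {1..n}" and z: "row_word cs z" "z \<in> midx N n"
  shows "Erec x cs ` tensors N n = garnir_tensors N n cs"
    "irreducible_subrep N n (GL_group N) (garnir_tensors N n cs)" "col_tensor cs z \<in> garnir_tensors N n cs"
proof -
  have dist: "distinct (concat cs)" using distinct_concat_good_cols[OF good] .
  have sub: "set (concat cs) \<subseteq> {1..n}" by (simp add: set)
  obtain T where T: "T \<in> tensors N n" "Erec x cs T = col_tensor cs z"
    using ex_Erec_eq_col_tensor[OF good sub z(2,1)] by blast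
  have im: "Erec x cs ` tensors N n \<subseteq> garnir_tensors N n cs"
    using tensors_Erec[OF sub] garnir_Erec[OF good] by (auto simp: garnir_tensors_def)
  show c: "col_tensor cs z \<in> garnir_tensors N n cs" using im T by (metis imageI subsetD)
  show irr: "irreducible_subrep N n (GL_group N) (garnir_tensors N n cs)"
    by (rule irreducible_garnir_tensors[OF dist set z]) (use c in \<open>simp add: garnir_tensors_def\<close>)
  have "subrep N n (GL_group N) (Erec x cs ` tensors N n)"
    unfolding subrep_def
  proof (intro conjI ballI)
    show "Erec x cs ` tensors N n \<subseteq> tensors N n" using im by (auto simp: garnir_tensors_def)
    show "tensor.subspace (Erec x cs ` tensors N n)"
    proof (rule tensor.subspaceI)
      show "0 \<in> Erec x cs ` tensors N n" using lin_zero[OF lin_Erec[of x cs]] tensors_0 by (metis imageI)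
      show "S + S' \<in> Erec x cs ` tensors N n"
        if SS': "S \<in> Erec x cs ` tensors N n" "S' \<in> Erec x cs ` tensors N n" for S S'
      proof -
        obtain R R' where "R \<in> tensors N n" "R' \<in> tensors N n" "S = Erec x cs R" "S' = Erec x cs R'" using SS' by blast
        thus ?thesis using lin_add[OF lin_Erec[of x cs], of R R'] tensors_add[of R N n R'] by (metis imageI)
      qed
      show "tscale c S \<in> Erec x cs ` tensors N n" if S: "S \<in> Erec x cs ` tensors N n" for c S
      proof -
        obtain R where "R \<in> tensors N n" "S = Erec x cs R" using S by blast
        thus ?thesis using lin_scale[OF lin_Erec[of x cs], of c R] tensors_scale[of R N n c] by (metis imageI)
      qed
    qed
    show "act N n g S \<in> Erec x cs ` tensors N n" if S: "S \<in> Erec x cs ` tensors N n" for g S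
    proof -
      obtain R where "S = Erec x cs R" using S by blast
      thus ?thesis using act_Erec[OF sub dist, of N g x R] tensors_act[of N n g R] by (metis imageI)
    qed
  qed
  moreover have "col_tensor cs z z = 1" by (rule col_tensor_at[OF dist row_word_image(2)[OF z(1)]])
  hence "col_tensor cs z \<noteq> 0" by (metis zero_fun_apply zero_neq_one)
  hence "Erec x cs ` tensors N n \<noteq> {0}" using T by (metis imageI singletonD)
  ultimately show "Erec x cs ` tensors N n = garnir_tensors N n cs"
    using irr im unfolding irreducible_subrep_def by blast
qed

theorem mainTheorem4:
  fixes N n :: nat and lam :: "nat list"
  assumes "1 \<le> N"
    and "partition_of n lam"
    and "conj_part lam 1 + conj_part lam 2 \<le> N"
  shows "F_Omega_0 N n lam ` tensors N n
           = E_Omega n lam ` tensors N n \<inter> traceless_tensors N n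
       \<and> (\<exists>W. W_realisation N n lam W)
       \<and> (\<forall>W. W_realisation N n lam W \<longrightarrow>
            equivalent_reps N n (O_group N) (F_Omega_0 N n lam ` tensors N n) W)"
proof -
  let ?cs = "tableau_columns lam" and ?x = "\<lambda>k. of_int (content lam k) :: complex"
  let ?y = "\<lambda>k. of_int (content lam k) + (of_nat N - 1) / 2 :: complex"
  let ?V = "garnir_tensors N n ?cs" and ?tr = "traceless_tensors N n"
  note lam = assms(2)
  have set: "set (concat ?cs) = {1..n}" by (rule set_tableau_columns[OF lam])
  have dist: "distinct (concat ?cs)" by (simp only: concat_tableau_columns[OF lam] distinct_upt)
  have good: "good_cols ?x 0 ?cs" using good_cols_tableau[OF lam, of 0] by simp
  have N: "conj_part lam 1 \<le> N" using assms(3) by simp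
  obtain z where z: "row_word ?cs z" "z \<in> midx N n" by (rule ex_row_word_tableau[OF lam N])
  note V = image_Erec[OF good set z]
  have E: "E_Omega n lam ` tensors N n = ?V"
    using V(1) by (simp add: E_Omega_eq_Erec[OF lam])
  have "F_Omega_0 N n lam ` tensors N n = Grec N n ?y ?cs ` ?V"
    unfolding E[symmetric] image_image by (rule image_cong[OF refl F_Omega_0_eq_Grec[OF lam]])
  also have "\<dots> = ?V \<inter> ?tr"
  proof (intro equalityI subsetI)
    fix S assume "S \<in> Grec N n ?y ?cs ` ?V"
    then obtain T where T: "T \<in> tensors N n" "garnir ?cs T" "S = Grec N n ?y ?cs T"
      unfolding garnir_tensors_def by blast
    note y = good_cols_tableau[OF lam, of "(of_nat N - 1) / 2"] nonzero_sums_tableau[OF assms(3)]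
    have "garnir ?cs S" unfolding T(3) by (rule garnir_Grec[OF y _ T(2)]) (simp add: set)
    moreover have "S \<in> ?tr" unfolding T(3) by (rule Grec_in_traceless[OF y set T(2,1) assms(1)])
    ultimately show "S \<in> ?V \<inter> ?tr" by (simp add: garnir_tensors_def traceless_tensors_def)
  next
    fix S assume "S \<in> ?V \<inter> ?tr"
    hence "S \<in> ?V" "Grec N n ?y ?cs S = S" using Grec_traceless[of S N n ?cs ?y] set dist by auto
    thus "S \<in> Grec N n ?y ?cs ` ?V" by (metis imageI)
  qed
  finally have F: "F_Omega_0 N n lam ` tensors N n = ?V \<inter> ?tr" .
  have len: "length c \<le> N" if c: "c \<in> set ?cs" for c
  proof -
    obtain m where "m < part lam 1" "c = ?cs ! m" by (rule tableau_column_cases[OF c])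
    thus ?thesis using conj_part_antimono[of 1 "Suc m" lam] N by (simp add: length_nth_tableau_columns)
  qed
  have hw: "highest_weight_vector N n lam (col_tensor ?cs z)"
    by (rule highest_weight_col_tensor[OF dist set z len length_filter_tableau_columns[OF lam]])
  have copy: "V_copy N n lam ?V" unfolding V_copy_def using V(2,3) hw by blast
  have subV: "subrep N n (GL_group N) ?V" using V(2) by (simp add: irreducible_subrep_def)
  have "equivalent_reps N n (O_group N) (?V \<inter> ?tr) W" if WR: "W_realisation N n lam W" for W
  proof -
    obtain V' T where V': "irreducible_subrep N n (GL_group N) V'" "T \<in> V'" "highest_weight_vector N n lam T"
      and W: "W = V' \<inter> ?tr"
      using WR unfolding W_realisation_def V_copy_def by blast
    have sub': "subrep N n (GL_group N) V'" using V'(1) by (simp add: irreducible_subrep_def)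
    hence tens: "V' \<subseteq> tensors N n" by (simp add: subrep_def)
    obtain f where f: "lin f" "bij_betw f ?V V'"
      "\<And>g X. g \<in> GL_group N \<Longrightarrow> X \<in> ?V \<Longrightarrow> f (act N n g X) = act N n g (f X)"
      using copies_equivalent[OF V' V(2,3) hw] by blast
    have tr: "f X \<in> ?tr \<longleftrightarrow> X \<in> ?tr" if "X \<in> ?V" for X
      by (rule traceless_equivariant[OF subV f(1,3,2) tens that assms(1)])
    have "f ` (?V \<inter> ?tr) = W"
    proof (intro equalityI subsetI)
      fix Y assume "Y \<in> f ` (?V \<inter> ?tr)"
      then obtain X where X: "X \<in> ?V" "X \<in> ?tr" "Y = f X" by blast
      have "f X \<in> V'" using X(1) f(2) by (metis bij_betwE)
      thus "Y \<in> W" using X tr[OF X(1)] by (simp add: W)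
    next
      fix Y assume Y: "Y \<in> W"
      hence "Y \<in> f ` ?V" using f(2) by (simp add: W bij_betw_def)
      then obtain X where X: "X \<in> ?V" "Y = f X" by blast
      hence "X \<in> ?tr" using Y tr[OF X(1)] by (simp add: W)
      thus "Y \<in> f ` (?V \<inter> ?tr)" using X by blast
    qed
    moreover have "inj_on f (?V \<inter> ?tr)" using f(2) by (auto simp: bij_betw_def intro: inj_on_subset)
    ultimately have "bij_betw f (?V \<inter> ?tr) W" by (simp add: bij_betw_def)
    moreover have "\<forall>g\<in>O_group N. \<forall>X\<in>?V \<inter> ?tr. f (act N n g X) = act N n g (f X)"
      using f(3) by (simp add: O_group_def)
    ultimately show ?thesis
      unfolding equivalent_reps_def using subrep_traceless[OF subV assms(1)] subrep_traceless[OF sub' assms(1)] f(1)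
      by (auto simp: linear_lin W)
  qed
  moreover have "\<exists>W. W_realisation N n lam W" unfolding W_realisation_def using copy by blast
  ultimately show ?thesis unfolding E F by blast
qed

end
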